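(* For all integers $m,n$ with $0\le m\le n$ there exists a piecewise linear function $F$ on $n+1$ intervals, having exactly $m$ jump points and $n-m$ fold points, such that the system $$\dot x=F(x)-y,\qquad \dot y=x$$ has at least $n+m$ limit cycles, where limit cycles may be of crossing, sliding, grazing or composite type. (That is, $n+m$ is a lower bound for the maximum number of limit cycles of such systems.)
   Context: A piecewise linear function on $n+1$ intervals is a function of the form $$F(x)=ax+b+\sum_{i=1}^n a_i|x-x_i|+\sum_{i=1}^n b_i\,\mathrm{sgn}(x-x_i),$$ with real $a,b,a_i,b_i,x_i$, $(a_i^2+b_i^2)x_i\ne0$ for all $i$, and $x_1<\dots<x_n$. The point $(x_i,F(x_i))$ is a jump point if $F(x_i^-)\ne F(x_i^+)$ (equivalently $b_i\ne0$), and a fold point if $F$ is continuous at $x_i$ but its left and right derivatives there differ (equivalently $b_i=0$, $a_i\neq0$). Orbits are understood in the sense of Filippov, with switching lines $L_i=\{x=x_i\}$. At a fold point the crossing set is $L_i^c=\{(x,y)\in L_i:y\ne F(x_i)\}$. At a jump point the crossing set is $L_i^c=\{(x,y)\in L_i:\ y<\min\{F(x_i^-),F(x_i^+)\}\text{ or }y>\max\{F(x_i^-),F(x_i^+)\}\}$ and the sliding set is $L_i^s=\{(x,y)\in L_i:\ \min\{F(x_i^-),F(x_i^+)\}<y<\max\{F(x_i^-),F(x_i^+)\}\}$. (The sliding set includes both attracting and repelling sliding.) Orbits may move along $L_i^s$ with $\dot y=x_i$, so the orientation along a sliding segment is determined by $\mathrm{sgn}(x_i)$. Limit cycles are of the following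 types. (a) A periodic orbit is a crossing limit cycle if it crosses the switching line transversally and a suitable neighborhood of it has no other periodic orbits. (b) A periodic orbit $\Gamma$ is a sliding limit cycle if it contains nonempty open segments $\Gamma_s$ in the sliding set and $\Gamma\setminus\Gamma_s$ has a neighborhood which does not contain orbit arcs outside the sliding set of any other sliding periodic orbit. (c) A periodic orbit is a grazing limit cycle if it is tangent to the switching line at some point and it has a neighborhood which does not contain orbit arcs outside the sliding set of any other periodic orbit. (d) A periodic orbit is a composite limit cycle if at least two of the behaviors crossing, grazing, sliding occur simultaneously on it and it has a neighborhood which does not contain orbit arcs outside the sliding set of any other periodic orbit. *)

theory Defs
  imports "HOL-Analysis.Analysis"
begin

section \<open>Piecewise linear functions\<close>

definition pwl_function ::
  "nat \<Rightarrow> real \<Rightarrow> real \<Rightarrow> (nat \<Rightarrow> real) \<Rightarrow> (nat \<Rightarrow> real) \<Rightarrow> (nat \<Rightarrow> real) \<Rightarrow> real \<Rightarrow> real"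
  where
  "pwl_function n a b A B X x =
     a * x + b + (\<Sum>i=1..n. A i * \<bar>x - X i\<bar>) + (\<Sum>i=1..n. B i * sgn (x - X i))"

definition is_pwl :: "(real \<Rightarrow> real) \<Rightarrow> nat \<Rightarrow> (nat \<Rightarrow> real) \<Rightarrow> bool" where
  "is_pwl F n X \<longleftrightarrow>
     (\<exists>a b A B. F = pwl_function n a b A B X \<and>
        (\<forall>i\<in>{1..n}. ((A i)\<^sup>2 + (B i)\<^sup>2) * X i \<noteq> 0)) \<and>
     strict_mono_on {1..n} X"

definition left_lim :: "(real \<Rightarrow> real) \<Rightarrow> real \<Rightarrow> real" where
  "left_lim F p = Lim (at_left p) F"

definition right_lim :: "(real \<Rightarrow> real) \<Rightarrow> real \<Rightarrow> real" where
  "right_lim F p = Lim (at_right p) F"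

definition jump_at :: "(real \<Rightarrow> real) \<Rightarrow> real \<Rightarrow> bool" where
  "jump_at F p \<longleftrightarrow> left_lim F p \<noteq> right_lim F p"

definition fold_at :: "(real \<Rightarrow> real) \<Rightarrow> real \<Rightarrow> bool" where
  "fold_at F p \<longleftrightarrow> isCont F p \<and>
     (\<exists>l r. (F has_real_derivative l) (at_left p) \<and>
            (F has_real_derivative r) (at_right p) \<and> l \<noteq> r)"

section \<open>Filippov solutions\<close>

definition absolutely_continuous_fun_on ::
  "real set \<Rightarrow> (real \<Rightarrow> 'a::real_normed_vector) \<Rightarrow> bool" where
  "absolutely_continuous_fun_on S g \<longleftrightarrow>
     (\<forall>e>0. \<exists>d>0. \<forall>D T. D division_of T \<and> T \<subseteq> S \<and> (\<Sum>k\<in>D. Sup k - Inf k) < d \<longrightarrow>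
        (\<Sum>k\<in>D. norm (g (Sup k) - g (Inf k))) < e)"

definition filippov_map :: "('a::euclidean_space \<Rightarrow> 'a) \<Rightarrow> 'a \<Rightarrow> 'a set" where
  "filippov_map f p =
     (\<Inter>d\<in>{0<..}. \<Inter>N\<in>null_sets lebesgue. closure (convex hull (f ` (ball p d - N))))"

definition filippov_solution ::
  "('a::euclidean_space \<Rightarrow> 'a) \<Rightarrow> (real \<Rightarrow> 'a) \<Rightarrow> bool" where
  "filippov_solution f g \<longleftrightarrow>
     (\<forall>s t. absolutely_continuous_fun_on {s..t} g) \<and>
     (AE t in lebesgue. \<exists>v\<in>filippov_map f (g t). (g has_vector_derivative v) (at t))"

definition lienard_field :: "(real \<Rightarrow> real) \<Rightarrow> real \<times> real \<Rightarrow> real \<times> real" where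
  "lienard_field F = (\<lambda>(x, y). (F x - y, x))"

text \<open>Constant solutions (equilibria) are not periodic orbits. Periodic orbits are the ranges of
  periodic solutions; they are compared and counted as subsets of the plane.\<close>

definition periodic_solution :: "(real \<Rightarrow> real) \<Rightarrow> (real \<Rightarrow> real \<times> real) \<Rightarrow> bool" where
  "periodic_solution F g \<longleftrightarrow>
     filippov_solution (lienard_field F) g \<and>
     (\<exists>T>0. \<forall>t. g (t + T) = g t) \<and> (\<exists>s t. g s \<noteq> g t)"

definition periodic_orbit :: "(real \<Rightarrow> real) \<Rightarrow> (real \<times> real) set \<Rightarrow> bool" where
  "periodic_orbit F \<Gamma> \<longleftrightarrow> (\<exists>g. periodic_solution F g \<and> \<Gamma> = range g)"

section \<open>Switching lines, crossing, sliding and grazing\<close>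

text \<open>In the following, \<open>P\<close> is the finite set of abscissae of the switching lines. If \<open>F\<close> is
  continuous at \<open>p \<in> P\<close>, both one-sided limits equal \<open>F p\<close>, so that the crossing set on that line
  is given by \<open>y \<noteq> F p\<close> and its sliding set is empty.\<close>

definition switching_lines :: "real set \<Rightarrow> (real \<times> real) set" where
  "switching_lines P = P \<times> UNIV"

definition crossing_set :: "(real \<Rightarrow> real) \<Rightarrow> real set \<Rightarrow> (real \<times> real) set" where
  "crossing_set F P = {(p, y). p \<in> P \<and>
     (y < min (left_lim F p) (right_lim F p) \<or> y > max (left_lim F p) (right_lim F p))}"

definition sliding_set :: "(real \<Rightarrow> real) \<Rightarrow> real set \<Rightarrow> (real \<times> real) set" where
  "sliding_set F P = {(p, y). p \<in> P \<and>
     min (left_lim F p) (right_lim F p) < y \<and> y < max (left_lim F p) (right_lim F p)}"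

text \<open>The union of all nonempty open segments of \<open>\<Gamma>\<close> in the sliding set.\<close>

definition sliding_part ::
  "(real \<Rightarrow> real) \<Rightarrow> real set \<Rightarrow> (real \<times> real) set \<Rightarrow> (real \<times> real) set" where
  "sliding_part F P \<Gamma> =
     \<Union>{{p} \<times> {c<..<d} |p c d. c < d \<and> {p} \<times> {c<..<d} \<subseteq> \<Gamma> \<inter> sliding_set F P}"

definition has_crossing :: "(real \<Rightarrow> real) \<Rightarrow> real set \<Rightarrow> (real \<times> real) set \<Rightarrow> bool" where
  "has_crossing F P \<Gamma> \<longleftrightarrow> \<Gamma> \<inter> crossing_set F P \<noteq> {}"

definition has_sliding :: "(real \<Rightarrow> real) \<Rightarrow> real set \<Rightarrow> (real \<times> real) set \<Rightarrow> bool" where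
  "has_sliding F P \<Gamma> \<longleftrightarrow> sliding_part F P \<Gamma> \<noteq> {}"

text \<open>Tangency to a switching line. The contact has to be isolated in time; otherwise every orbit
  leaving a sliding segment at its end point would also count as grazing.\<close>

definition has_grazing :: "(real \<Rightarrow> real) \<Rightarrow> real set \<Rightarrow> (real \<times> real) set \<Rightarrow> bool" where
  "has_grazing F P \<Gamma> \<longleftrightarrow>
     (\<exists>g t. periodic_solution F g \<and> \<Gamma> = range g \<and> fst (g t) \<in> P \<and>
        ((\<lambda>s. fst (g s)) has_real_derivative 0) (at t) \<and>
        (\<forall>\<^sub>F s in at t. fst (g s) \<noteq> fst (g t)))"

section \<open>Limit cycles\<close>

definition crossing_limit_cycle ::
  "(real \<Rightarrow> real) \<Rightarrow> real set \<Rightarrow> (real \<times> real) set \<Rightarrow> bool" where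
  "crossing_limit_cycle F P \<Gamma> \<longleftrightarrow>
     periodic_orbit F \<Gamma> \<and> has_crossing F P \<Gamma> \<and>
     \<Gamma> \<inter> switching_lines P \<subseteq> crossing_set F P \<and>
     (\<exists>U. open U \<and> \<Gamma> \<subseteq> U \<and>
        (\<forall>\<Gamma>'. periodic_orbit F \<Gamma>' \<and> \<Gamma>' \<noteq> \<Gamma> \<longrightarrow> \<not> \<Gamma>' \<subseteq> U))"

definition contains_nonsliding_arc ::
  "(real \<Rightarrow> real) \<Rightarrow> real set \<Rightarrow> (real \<times> real) set \<Rightarrow> (real \<times> real) set \<Rightarrow> bool" where
  "contains_nonsliding_arc F P U \<Gamma> \<longleftrightarrow>
     (\<exists>g s t. periodic_solution F g \<and> \<Gamma> = range g \<and> s < t \<and>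
        g ` {s..t} \<subseteq> U - sliding_set F P)"

definition sliding_limit_cycle ::
  "(real \<Rightarrow> real) \<Rightarrow> real set \<Rightarrow> (real \<times> real) set \<Rightarrow> bool" where
  "sliding_limit_cycle F P \<Gamma> \<longleftrightarrow>
     periodic_orbit F \<Gamma> \<and> has_sliding F P \<Gamma> \<and>
     (\<exists>U. open U \<and> \<Gamma> - sliding_part F P \<Gamma> \<subseteq> U \<and>
        (\<forall>\<Gamma>'. periodic_orbit F \<Gamma>' \<and> has_sliding F P \<Gamma>' \<and> \<Gamma>' \<noteq> \<Gamma> \<longrightarrow>
           \<not> contains_nonsliding_arc F P U \<Gamma>'))"

definition isolated_outside_sliding ::
  "(real \<Rightarrow> real) \<Rightarrow> real set \<Rightarrow> (real \<times> real) set \<Rightarrow> bool" where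
  "isolated_outside_sliding F P \<Gamma> \<longleftrightarrow>
     (\<exists>U. open U \<and> \<Gamma> \<subseteq> U \<and>
        (\<forall>\<Gamma>'. periodic_orbit F \<Gamma>' \<and> \<Gamma>' \<noteq> \<Gamma> \<longrightarrow> \<not> contains_nonsliding_arc F P U \<Gamma>'))"

definition grazing_limit_cycle ::
  "(real \<Rightarrow> real) \<Rightarrow> real set \<Rightarrow> (real \<times> real) set \<Rightarrow> bool" where
  "grazing_limit_cycle F P \<Gamma> \<longleftrightarrow>
     periodic_orbit F \<Gamma> \<and> has_grazing F P \<Gamma> \<and> isolated_outside_sliding F P \<Gamma>"

definition composite_limit_cycle ::
  "(real \<Rightarrow> real) \<Rightarrow> real set \<Rightarrow> (real \<times> real) set \<Rightarrow> bool" where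
  "composite_limit_cycle F P \<Gamma> \<longleftrightarrow>
     periodic_orbit F \<Gamma> \<and>
     (has_crossing F P \<Gamma> \<and> has_grazing F P \<Gamma> \<or>
      has_crossing F P \<Gamma> \<and> has_sliding F P \<Gamma> \<or>
      has_grazing F P \<Gamma> \<and> has_sliding F P \<Gamma>) \<and>
     isolated_outside_sliding F P \<Gamma>"

definition limit_cycle ::
  "(real \<Rightarrow> real) \<Rightarrow> real set \<Rightarrow> (real \<times> real) set \<Rightarrow> bool" where
  "limit_cycle F P \<Gamma> \<longleftrightarrow>
     crossing_limit_cycle F P \<Gamma> \<or> sliding_limit_cycle F P \<Gamma> \<or>
     grazing_limit_cycle F P \<Gamma> \<or> composite_limit_cycle F P \<Gamma>"

end

theory Submission
  imports Defs "HOL-Complex_Analysis.Complex_Analysis"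
begin

text \<open>The nodes are positive and added one after the other, each one far to the right of all previous
  ones, first the jumps and then the folds; all jumps are downward. Then the system is one-sided
  Lipschitz, so that Filippov solutions are unique in forward time. Consequently two periodic orbits
  with a common point coincide, and as sliding is attracting there is at most one sliding periodic
  orbit for each jump.

  The periodic orbits correspond to the fixed points of the return map of the negative y-axis. In the
  left half plane the orbits are arcs of one logarithmic spiral, and in the right half plane they are
  traced forwards and backwards from the points \<open>(\<xi>, F \<xi>)\<close> of the nullcline in the last zone. For
  large \<open>\<xi>\<close> the sign of the displacement is decided by the slope in the last zone. A fold changes
  this slope so that the sign at infinity changes, while it persists near the new node: this gives a
  zero of the displacement, which is isolated since the displacement is real analytic. A high jump
  that keeps the slope reverses the sign only near the new node; this gives a crossing cycle, and
  the orbit leaving the sliding segment returns to it, which gives a sliding cycle.\<close>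

section \<open>Absolutely continuous functions\<close>

text \<open>Isolation quantifies over every periodic Filippov solution, not only over orbits
  assembled from known arcs. Forward uniqueness is the device against this: an unknown periodic
  orbit contains every explicit arc that starts on it. Backward uniqueness fails on sliding
  segments, but periodicity replaces it. Tracing orbits from \<open>(\<xi>, F \<xi>)\<close> in both
  directions gives the start and the return point on the negative y-axis as increasing functions of
  one parameter, so the return map is never inverted and its fixed points are the zeros of one
  analytic function. The left slope is 1 = 2 cos(pi/3); the outer slopes are 2 cos(pi/3) and 2 cos(3
  pi/4). A turn far away expands or contracts according to the sign of cot(pi/3) + cot \<theta>,
  positive for the first and negative for the second. The jump step needs expansion at infinity and
  preserves it, whereas each fold reverses the sign; hence all jumps precede the folds. Earlier
  cycles are compact, so a node far to the right leaves them untouched, and the properties carried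
  along depend on F only to the left of that node.\<close>

lemma absolutely_continuous_funD:
  assumes "absolutely_continuous_fun_on S g" "e > 0"
  obtains d where "d > 0"
    "\<And>D T. D division_of T \<Longrightarrow> T \<subseteq> S \<Longrightarrow> (\<Sum>k\<in>D. Sup k - Inf k) < d \<Longrightarrow>
        (\<Sum>k\<in>D. norm (g (Sup k) - g (Inf k))) < e"
  using assms unfolding absolutely_continuous_fun_on_def by meson

lemma division_of_Sup_Inf:
  fixes D :: "real set set"
  assumes "D division_of T" "k \<in> D"
  shows "Inf k \<in> k" "Sup k \<in> k" "Inf k \<le> Sup k" "k = {Inf k..Sup k}"
proof -
  obtain u v where uv: "k = cbox u v" using assms by blast
  moreover have "k \<noteq> {}" using assms by blast
  ultimately have "u \<le> v" by auto
  then show "Inf k \<in> k" "Sup k \<in> k" "Inf k \<le> Sup k" "k = {Inf k..Sup k}" using uv by auto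
qed

lemma absolutely_continuous_fun_on_subset:
  "absolutely_continuous_fun_on S g \<Longrightarrow> T \<subseteq> S \<Longrightarrow> absolutely_continuous_fun_on T g"
  unfolding absolutely_continuous_fun_on_def by (meson subset_trans)

text \<open>A single domination criterion stands in for a calculus of absolutely continuous
  functions: Lipschitz functions, squared distances, products and coordinates all have increments
  controlled by those of two known functions and of time.\<close>

lemma absolutely_continuous_fun_on_dominated:
  fixes f :: "real \<Rightarrow> 'a::real_normed_vector" and g :: "real \<Rightarrow> 'b::real_normed_vector"
    and h :: "real \<Rightarrow> 'c::real_normed_vector"
  assumes f: "absolutely_continuous_fun_on S f" and g: "absolutely_continuous_fun_on S g"
    and K: "K \<ge> 0"
    and dom: "\<And>u v. u \<in> S \<Longrightarrow> v \<in> S \<Longrightarrow>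
      norm (h v - h u) \<le> K * (norm (f v - f u) + norm (g v - g u) + \<bar>v - u\<bar>)"
  shows "absolutely_continuous_fun_on S h"
  unfolding absolutely_continuous_fun_on_def
proof (intro allI impI)
  fix e :: real assume "e > 0"
  \<comment> \<open>The increments of f, of g and of t contribute at most \<open>e'\<close> each;
    \<open>K + 1\<close> instead of \<open>K\<close> keeps the quotient meaningful for K = 0 and the
    final estimate strict.\<close>
  define e' where "e' = e / (3 * (K + 1))"
  have e': "e' > 0" using \<open>e > 0\<close> K by (simp add: e'_def)
  obtain d1 where d1: "d1 > 0" "\<And>D T. D division_of T \<Longrightarrow> T \<subseteq> S \<Longrightarrow> (\<Sum>k\<in>D. Sup k - Inf k) < d1 \<Longrightarrow>
        (\<Sum>k\<in>D. norm (f (Sup k) - f (Inf k))) < e'"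
    using absolutely_continuous_funD[OF f e'] by metis
  obtain d2 where d2: "d2 > 0" "\<And>D T. D division_of T \<Longrightarrow> T \<subseteq> S \<Longrightarrow> (\<Sum>k\<in>D. Sup k - Inf k) < d2 \<Longrightarrow>
        (\<Sum>k\<in>D. norm (g (Sup k) - g (Inf k))) < e'"
    using absolutely_continuous_funD[OF g e'] by metis
  show "\<exists>d>0. \<forall>D T. D division_of T \<and> T \<subseteq> S \<and> (\<Sum>k\<in>D. Sup k - Inf k) < d \<longrightarrow>
        (\<Sum>k\<in>D. norm (h (Sup k) - h (Inf k))) < e"
  proof (intro exI[of _ "min e' (min d1 d2)"] conjI allI impI)
    show "0 < min e' (min d1 d2)" using e' d1 d2 by simp
    fix D T assume D: "D division_of T \<and> T \<subseteq> S \<and> (\<Sum>k\<in>D. Sup k - Inf k) < min e' (min d1 d2)"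
    have sub: "k \<subseteq> S" if "k \<in> D" for k using D that division_ofD(2) by blast
    have "(\<Sum>k\<in>D. norm (h (Sup k) - h (Inf k)))
        \<le> (\<Sum>k\<in>D. K * (norm (f (Sup k) - f (Inf k)) + norm (g (Sup k) - g (Inf k)) + (Sup k - Inf k)))"
    proof (rule sum_mono)
      fix k assume k: "k \<in> D"
      note * = division_of_Sup_Inf[of D T k] 
      have "Inf k \<in> S" "Sup k \<in> S" "Inf k \<le> Sup k" using * D k sub by blast+
      then show "norm (h (Sup k) - h (Inf k)) \<le> K * (norm (f (Sup k) - f (Inf k)) + norm (g (Sup k) - g (Inf k)) + (Sup k - Inf k))"
        using dom[of "Inf k" "Sup k"] by simp
    qed
    also have "\<dots> = K * ((\<Sum>k\<in>D. norm (f (Sup k) - f (Inf k))) + (\<Sum>k\<in>D. norm (g (Sup k) - g (Inf k)))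
        + (\<Sum>k\<in>D. Sup k - Inf k))"
      by (simp add: sum.distrib flip: sum_distrib_left)
    also have "\<dots> \<le> K * (e' + e' + e')"
      using D d1(2)[of D T] d2(2)[of D T] K by (intro mult_left_mono add_mono) auto
    also have "\<dots> < (K + 1) * (e' + e' + e')" using e' by simp
    also have "\<dots> = e' * (3 * (K + 1))" by (simp add: algebra_simps)
    also have "\<dots> = e" using K by (simp add: e'_def)
    finally show "(\<Sum>k\<in>D. norm (h (Sup k) - h (Inf k))) < e" .
  qed
qed

lemma absolutely_continuous_fun_on_const: "absolutely_continuous_fun_on S (\<lambda>t. c)"
  unfolding absolutely_continuous_fun_on_def using zero_less_one by auto

lemma lipschitz_imp_absolutely_continuous_fun_on:
  fixes g :: "real \<Rightarrow> 'a::real_normed_vector"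
  assumes "L-lipschitz_on S g"
  shows "absolutely_continuous_fun_on S g"
proof (rule absolutely_continuous_fun_on_dominated[OF absolutely_continuous_fun_on_const absolutely_continuous_fun_on_const,
      of L _ _ "0::real" "0::real"])
  show "L \<ge> 0" using assms lipschitz_on_nonneg by blast
  show "norm (g v - g u) \<le> L * (norm (0 - 0::real) + norm (0 - 0::real) + \<bar>v - u\<bar>)" if "u \<in> S" "v \<in> S" for u v
    using lipschitz_onD[OF assms that(2,1)] by (simp add: dist_norm)
qed

lemma absolutely_continuous_fun_on_imp_continuous:
  assumes g: "absolutely_continuous_fun_on {a..b} g"
  shows "continuous_on {a..b} g"
  unfolding continuous_on_iff
proof (intro ballI allI impI)
  fix x e :: real assume x: "x \<in> {a..b}" and e: "e > 0"
  obtain d where d: "d > 0" "\<And>D T. D division_of T \<Longrightarrow> T \<subseteq> {a..b} \<Longrightarrow> (\<Sum>k\<in>D. Sup k - Inf k) < d \<Longrightarrow>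
        (\<Sum>k\<in>D. norm (g (Sup k) - g (Inf k))) < e"
    using absolutely_continuous_funD[OF g e] by metis
  have *: "norm (g v - g u) < e" if "a \<le> u" "u \<le> v" "v \<le> b" "v - u < d" for u v
  proof -
    have "{{u..v}} division_of {u..v}" using that by (metis atLeastatMost_empty_iff2 division_of_self interval_cbox not_le)
    from d(2)[OF this] that show ?thesis by auto
  qed
  show "\<exists>d>0. \<forall>x'\<in>{a..b}. dist x' x < d \<longrightarrow> dist (g x') (g x) < e"
  proof (intro exI[of _ d] conjI ballI impI d(1))
    fix y assume y: "y \<in> {a..b}" "dist y x < d"
    show "dist (g y) (g x) < e"
    proof (cases "x \<le> y")
      case True
      then show ?thesis using *[of x y] x y by (auto simp: dist_norm)
    next
      case False
      then show ?thesis using *[of y x] x y by (auto simp: dist_norm norm_minus_commute)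
    qed
  qed
qed

text \<open>Cousin's lemma: subintervals tagged in the exceptional null set are controlled by absolute
  continuity, the remaining ones by the derivative at the tag.\<close>

lemma absolutely_continuous_nonincreasing:
  fixes h :: "real \<Rightarrow> real"
  assumes ab: "a \<le> b" and h: "absolutely_continuous_fun_on {a..b} h"
    and N: "negligible N"
    and D: "\<And>t. a < t \<Longrightarrow> t < b \<Longrightarrow> t \<notin> N \<Longrightarrow> \<exists>D\<le>0. (h has_real_derivative D) (at t)"
  shows "h b \<le> h a"
proof -
  have main: "h b - h a \<le> e * (b - a) + e" if e: "e > 0" for e
  proof -
    obtain d where d: "d > 0" "\<And>D T. D division_of T \<Longrightarrow> T \<subseteq> {a..b} \<Longrightarrow> (\<Sum>k\<in>D. Sup k - Inf k) < d \<Longrightarrow>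
        (\<Sum>k\<in>D. norm (h (Sup k) - h (Inf k))) < e"
      using absolutely_continuous_funD[OF h e] by metis
    \<comment> \<open>The endpoints join the null set because a derivative is only given in the open
      interval.\<close>
    define N' where "N' = insert a (insert b N)"
    have "negligible N'" using N by (simp add: N'_def negligible_insert)
    then have nn: "N' \<in> null_sets lebesgue" by (simp add: negligible_iff_null_sets)
    \<comment> \<open>With an open cover of measure below d, the intervals that are tagged in
      \<open>N'\<close> and lie in balls inside G have total length below d.\<close>
    then obtain G where G: "open G" "N' \<subseteq> G" "G - N' \<in> lmeasurable" "emeasure lebesgue (G - N') < ennreal d"
      using sets_lebesgue_outer_open[of N' d] d(1) by (metis null_setsD2)
    have gm: "G \<in> lmeasurable"
      using G nn by (metis Diff_partition Un_commute fmeasurable.Un fmeasurableI_null_sets)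
    have "emeasure lebesgue (G - N') = emeasure lebesgue G"
      using nn G(1) by (intro emeasure_Diff_null_set) (auto intro: lebesgue_openin)
    then have "emeasure lebesgue G < ennreal d" using G(4) by simp
    then have mG: "measure lebesgue G < d"
      using gm d(1) by (simp add: emeasure_eq_measure2 ennreal_less_iff)
    have "\<exists>r>0. (t \<in> N' \<longrightarrow> ball t r \<subseteq> G) \<and>
        (t \<in> {a..b} \<and> t \<notin> N' \<longrightarrow> (\<forall>u v. u \<le> t \<and> t \<le> v \<and> \<bar>u - t\<bar> < r \<and> \<bar>v - t\<bar> < r \<longrightarrow> h v - h u \<le> e * (v - u)))" for t
    proof (cases "t \<in> N'")
      case True
      then obtain r where "r > 0" "ball t r \<subseteq> G" using G(1,2) by (metis openE subsetD)
      then show ?thesis using True by blast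
    next
      case nN: False
      show ?thesis
      proof (cases "t \<in> {a..b}")
        case True
        then have "a < t" "t < b" "t \<notin> N" using nN by (auto simp: N'_def less_le)
        then obtain D where D: "D \<le> 0" "(h has_real_derivative D) (at t)" using D by blast
        then obtain r where r: "r > 0" "\<And>y. \<bar>y - t\<bar> < r \<Longrightarrow> norm (h y - h t - D * (y - t)) \<le> e * norm (y - t)"
          using has_derivative_at_alt[of h "(*) D" t] e unfolding has_field_derivative_def
          by (metis real_norm_def)
        have "h v - h u \<le> e * (v - u)" if "u \<le> t" "t \<le> v" "\<bar>u - t\<bar> < r" "\<bar>v - t\<bar> < r" for u v
        proof -
          have 1: "\<bar>h v - h t - D * (v - t)\<bar> \<le> e * (v - t)" using r(2)[of v] that by simp
          have 2: "\<bar>h u - h t - D * (u - t)\<bar> \<le> e * (t - u)" using r(2)[of u] that by simp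
          have "D * (v - t) \<le> 0" "D * (u - t) \<ge> 0" using D(1) that 
            by (simp_all add: mult_nonpos_nonneg mult_nonpos_nonpos)
          then have "h v - h t \<le> e * (v - t)" "h t - h u \<le> e * (t - u)" using 1 2 by linarith+
          then show ?thesis by (simp add: algebra_simps)
        qed
        then show ?thesis using r(1) nN by blast
      next
        case False
        then show ?thesis using nN zero_less_one by blast
      qed
    qed
    then obtain r where r: "\<And>t. r t > 0" "\<And>t. t \<in> N' \<Longrightarrow> ball t (r t) \<subseteq> G"
      "\<And>t u v. t \<in> {a..b} \<Longrightarrow> t \<notin> N' \<Longrightarrow> u \<le> t \<Longrightarrow> t \<le> v \<Longrightarrow> \<bar>u - t\<bar> < r t \<Longrightarrow> \<bar>v - t\<bar> < r t \<Longrightarrow> h v - h u \<le> e * (v - u)"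
      by metis
    have "gauge (\<lambda>t. ball t (r t))" using r(1) by (simp add: gauge_def)
    then obtain p where p: "p tagged_division_of {a..b}" "(\<lambda>t. ball t (r t)) fine p"
      using fine_division_exists_real by blast
    have fin: "finite p" using p(1) by (rule tagged_division_of_finite)
    have k: "x \<in> k \<and> k = {Inf k..Sup k} \<and> Inf k \<le> Sup k \<and> k \<subseteq> {a..b} \<and> k \<subseteq> ball x (r x) \<and> x \<in> {a..b}" if "(x, k) \<in> p" for x k
    proof -
      have "x \<in> k" "k \<subseteq> {a..b}" using tagged_division_ofD(2,3)[OF p(1) that] by auto
      moreover obtain u v where "k = cbox u v"
        using tagged_division_ofD(4)[OF p(1) \<open>(x, k) \<in> p\<close>] by blast
      moreover have "k \<subseteq> ball x (r x)" using p(2) that by (auto simp: fine_def)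
      ultimately have "u \<le> v" "k = {u..v}" "x \<in> k" "k \<subseteq> {a..b}" "k \<subseteq> ball x (r x)" by auto
      then show ?thesis by (metis cInf_atLeastAtMost cSup_atLeastAtMost subsetD)
    qed
    have tele: "(\<Sum>(x,k)\<in>p. h (Sup k) - h (Inf k)) = h b - h a"
      using additive_tagged_division_1[OF ab p(1)] by simp
    define p1 where "p1 = {xk\<in>p. fst xk \<in> N'}"
    define p2 where "p2 = {xk\<in>p. fst xk \<notin> N'}"
    have pp: "p = p1 \<union> p2" "p1 \<inter> p2 = {}" by (auto simp: p1_def p2_def)
    have fin12: "finite p1" "finite p2" using fin pp by auto
    have s2: "(\<Sum>(x,k)\<in>p2. h (Sup k) - h (Inf k)) \<le> e * (b - a)"
    proof -
      have "(\<Sum>(x,k)\<in>p2. h (Sup k) - h (Inf k)) \<le> (\<Sum>(x,k)\<in>p2. e * (Sup k - Inf k))"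
      proof (rule sum_mono, clarify)
        fix x k assume "(x, k) \<in> p2"
        then have xk: "(x, k) \<in> p" "x \<notin> N'" by (auto simp: p2_def)
        note kk = k[OF xk(1)]
        have m: "Inf k \<in> k" "Sup k \<in> k" using kk by (metis atLeastAtMost_iff order_refl)+
        then have "\<bar>Inf k - x\<bar> < r x" "\<bar>Sup k - x\<bar> < r x" using kk by (auto simp: dist_real_def abs_minus_commute)
        moreover have "Inf k \<le> x" "x \<le> Sup k" using kk by (metis atLeastAtMost_iff)+
        ultimately show "h (Sup k) - h (Inf k) \<le> e * (Sup k - Inf k)" using r(3) kk xk by blast
      qed
      also have "\<dots> \<le> (\<Sum>(x,k)\<in>p. e * (Sup k - Inf k))"
      proof (rule sum_mono2[OF fin])
        show "p2 \<subseteq> p" using pp by blast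
        fix xk assume "xk \<in> p - p2"
        then show "0 \<le> (case xk of (x, k) \<Rightarrow> e * (Sup k - Inf k))"
          using k[of "fst xk" "snd xk"] e by (simp add: case_prod_unfold)
      qed
      also have "\<dots> = e * (\<Sum>(x,k)\<in>p. (Sup k - Inf k))"
        by (simp add: sum_distrib_left case_prod_unfold)
      also have "\<dots> = e * (b - a)" using additive_tagged_division_1[OF ab p(1), of "\<lambda>x. x"] by simp
      finally show ?thesis .
    qed
    have s1: "(\<Sum>(x,k)\<in>p1. h (Sup k) - h (Inf k)) \<le> e"
    proof -
      define T where "T = \<Union>(snd ` p1)"
      have td: "p1 tagged_division_of T"
        unfolding T_def
      proof (rule tagged_partial_division_of_Union_self)
        have "p tagged_partial_division_of {a..b}" using p(1) unfolding tagged_division_of_def by blast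
        then show "p1 tagged_partial_division_of {a..b}"
          by (rule tagged_partial_division_subset) (use pp in blast)
      qed
      have dv: "snd ` p1 division_of T" by (rule division_of_tagged_division[OF td])
      have ne: "l \<noteq> {}" if "(x, l) \<in> p1" for x l
        using that k[of x l] by (auto simp: p1_def)
      have conv: "(\<Sum>(x,k)\<in>p1. f (Sup k) - f (Inf k)) = (\<Sum>k\<in>snd ` p1. f (Sup k) - f (Inf k))" for f :: "real \<Rightarrow> real"
      proof -
        \<comment> \<open>\<open>Sup\<close> and \<open>Inf\<close> of the empty set are
          unspecified, while the summation lemma asks for the value 0 on every interval with empty
          interior; hence the explicit case.\<close>
        define d where "d = (\<lambda>k. if k = {} then 0 else f (Sup k) - f (Inf k))"
        have "(\<Sum>(x,k)\<in>p1. d k) = (\<Sum>k\<in>snd ` p1. d k)"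
        proof (rule sum.over_tagged_division_lemma[OF td])
          fix u v :: real assume "box u v = {}"
          then have "v \<le> u" by (simp add: box_eq_empty)
          then show "d (cbox u v) = 0" by (cases "u = v") (auto simp: d_def)
        qed
        moreover have "(\<Sum>(x,k)\<in>p1. d k) = (\<Sum>(x,k)\<in>p1. f (Sup k) - f (Inf k))"
          by (rule sum.cong) (use ne in \<open>auto simp: d_def\<close>)
        moreover have "(\<Sum>k\<in>snd ` p1. d k) = (\<Sum>k\<in>snd ` p1. f (Sup k) - f (Inf k))"
          by (rule sum.cong) (use ne in \<open>auto simp: d_def\<close>)
        ultimately show ?thesis by simp
      qed
      have TG: "T \<subseteq> G \<inter> {a..b}"
      proof
        fix y assume "y \<in> T"
        then obtain x l where "(x, l) \<in> p" "x \<in> N'" "y \<in> l" by (auto simp: T_def p1_def)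
        then show "y \<in> G \<inter> {a..b}" using k[of x l] r(2)[of x] by blast
      qed
      have "(\<Sum>k\<in>snd ` p1. Sup k - Inf k) = (\<Sum>k\<in>snd ` p1. measure lebesgue k)"
      proof (rule sum.cong[OF refl])
        fix l assume "l \<in> snd ` p1"
        then obtain x where "(x, l) \<in> p" by (auto simp: p1_def)
        then have "l = {Inf l..Sup l}" "Inf l \<le> Sup l" using k[of x l] by blast+
        then have "measure lebesgue l = measure lebesgue (cbox (Inf l) (Sup l))" by (metis interval_cbox)
        then show "Sup l - Inf l = measure lebesgue l" using \<open>Inf l \<le> Sup l\<close> by simp
      qed
      also have "\<dots> = measure lebesgue T"
        using content_division[OF dv] by simp
      also have "\<dots> \<le> measure lebesgue G"
        using TG dv gm by (intro measure_mono_fmeasurable) (auto intro: fmeasurableD lmeasurable_division)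
      also have "\<dots> < d" by (rule mG)
      finally have "(\<Sum>k\<in>snd ` p1. norm (h (Sup k) - h (Inf k))) < e"
        using d(2)[OF dv] TG by blast
      moreover have "(\<Sum>k\<in>snd ` p1. h (Sup k) - h (Inf k)) \<le> (\<Sum>k\<in>snd ` p1. norm (h (Sup k) - h (Inf k)))"
        by (rule sum_mono) simp
      moreover note conv[of h]
      ultimately show ?thesis by linarith
    qed
    show ?thesis using s1 s2 tele pp fin12 by (simp add: sum.union_disjoint)
  qed
  show ?thesis
  proof (rule ccontr)
    assume "\<not> h b \<le> h a"
    then have pos: "h b - h a > 0" by simp
    \<comment> \<open>With this choice the bound \<open>e * (b - a) + e\<close> is only half of the
      assumed increase.\<close>
    define e where "e = (h b - h a) / (2 * (b - a + 1))"
    have "e > 0" using pos ab by (simp add: e_def)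
    then have "h b - h a \<le> e * (b - a + 1)" using main[of e] by (simp add: algebra_simps)
    also have "\<dots> = (h b - h a) / 2" using ab by (simp add: e_def field_simps)
    finally show False using pos by simp
  qed
qed

section \<open>Filippov solutions\<close>

text \<open>Null sets cannot hide the limit: U meets every ball around p in a nonempty open set,
  hence in positive measure, so points with values near v survive the removal of N. Used with the
  whole space at continuity points and with half planes at switching lines.\<close>

lemma filippov_map_memI:
  assumes "open U" and U: "\<And>r. r > 0 \<Longrightarrow> ball p r \<inter> U \<noteq> {}" and lim: "(f \<longlongrightarrow> v) (at p within U)"
  shows "v \<in> filippov_map f p"
  unfolding filippov_map_def
proof (intro INT_I)
  fix d :: real and N :: "'a set" assume d: "d \<in> {0<..}" and N: "N \<in> null_sets lebesgue"
  show "v \<in> closure (convex hull (f ` (ball p d - N)))"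
    unfolding closure_approachable
  proof (intro allI impI)
    fix e :: real assume e: "e > 0"
    then obtain r where r: "r > 0" "\<And>x. x \<in> U \<Longrightarrow> x \<noteq> p \<Longrightarrow> dist x p < r \<Longrightarrow> dist (f x) v < e"
      using lim unfolding tendsto_iff eventually_at by (metis greaterThan_iff)
    let ?B = "ball p (min r d) \<inter> U"
    have "open ?B" using \<open>open U\<close> by blast
    moreover have "?B \<noteq> {}" using U[of "min r d"] r d by simp
    ultimately have "\<not> negligible ?B" using open_not_negligible by blast
    moreover have "negligible (insert p N)" using N by (simp add: negligible_insert negligible_iff_null_sets)
    ultimately obtain x where "x \<in> ?B" "x \<notin> insert p N" using negligible_subset by blast
    then have "dist (f x) v < e" "x \<in> ball p d - N" using r(2)[of x] by (auto simp: dist_commute)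
    then show "\<exists>y\<in>convex hull (f ` (ball p d - N)). dist y v < e"
      by (meson hull_inc imageI)
  qed
qed

lemma convex_filippov_map: "convex (filippov_map f p)"
  unfolding filippov_map_def by (intro convex_INT ballI convex_closure convex_convex_hull)

lemma filippov_map_isCont:
  assumes "isCont f p" shows "f p \<in> filippov_map f p"
  by (rule filippov_map_memI[of UNIV]) (use assms in \<open>auto simp: isCont_def\<close>)

lemma isCont_lienard_field:
  assumes "isCont F (fst p)" shows "isCont (lienard_field F) p"
proof -
  have "isCont (\<lambda>q. F (fst q)) p"
    using assms isCont_o2[of p fst F] by (simp add: isCont_fst)
  then have "isCont (\<lambda>q. (F (fst q) - snd q, fst q)) p"
    by (intro continuous_intros) 
  then show ?thesis by (simp add: lienard_field_def case_prod_unfold)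
qed

text \<open>Half planes are closed and convex, so a bound for the field on a ball, taken with the
  empty null set, passes to the closed convex hull. The slack d is the variation of y, or of x, over
  the ball.\<close>

lemma filippov_map_lienard_bounds:
  assumes v: "v \<in> filippov_map (lienard_field F) p" and d: "d > 0"
  shows "(\<And>x. \<bar>x - fst p\<bar> < d \<Longrightarrow> lo \<le> F x) \<Longrightarrow> lo - snd p - d \<le> fst v"
    and "(\<And>x. \<bar>x - fst p\<bar> < d \<Longrightarrow> F x \<le> hi) \<Longrightarrow> fst v \<le> hi - snd p + d"
    and "\<bar>snd v - fst p\<bar> \<le> d"
proof -
  have *: "v \<in> closure (convex hull (lienard_field F ` ball p d))"
    using v d unfolding filippov_map_def by (metis (no_types, lifting) Diff_empty INT_E greaterThan_iff null_sets.empty_sets)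
  have sub: "v \<in> H" if "closed H" "convex H" "\<And>q. q \<in> ball p d \<Longrightarrow> lienard_field F q \<in> H" for H
    using * that by (metis closure_minimal hull_minimal image_subsetI subsetD)
  have b: "\<bar>fst q - fst p\<bar> < d \<and> \<bar>snd q - snd p\<bar> < d" if "q \<in> ball p d" for q
    using that dist_fst_le[of q p] dist_snd_le[of q p] by (auto simp: dist_real_def dist_commute)
  have cl: "closed {w::real\<times>real. c \<le> fst w}" "closed {w::real\<times>real. fst w \<le> c}" 
     "closed {w::real\<times>real. c \<le> snd w}" "closed {w::real\<times>real. snd w \<le> c}" for c
    by (intro closed_Collect_le continuous_intros)+
  have cv: "convex {w::real\<times>real. c \<le> fst w}" "convex {w::real\<times>real. fst w \<le> c}" 
     "convex {w::real\<times>real. c \<le> snd w}" "convex {w::real\<times>real. snd w \<le> c}" for c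
    using convex_halfspace_ge[of c "(1::real,0::real)"] convex_halfspace_le[of "(1::real,0::real)" c]
       convex_halfspace_ge[of c "(0::real,1::real)"] convex_halfspace_le[of "(0::real,1::real)" c]
    by (simp_all add: inner_prod_def)
  show "lo - snd p - d \<le> fst v" if "\<And>x. \<bar>x - fst p\<bar> < d \<Longrightarrow> lo \<le> F x"
  proof -
    have "lienard_field F q \<in> {w. lo - snd p - d \<le> fst w}" if "q \<in> ball p d" for q
      using b[OF that] \<open>\<And>x. \<bar>x - fst p\<bar> < d \<Longrightarrow> lo \<le> F x\<close>[of "fst q"] by (auto simp: lienard_field_def case_prod_unfold)
    then show ?thesis using sub[OF cl(1) cv(1)] by blast
  qed
  show "fst v \<le> hi - snd p + d" if "\<And>x. \<bar>x - fst p\<bar> < d \<Longrightarrow> F x \<le> hi"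
  proof -
    have "lienard_field F q \<in> {w. fst w \<le> hi - snd p + d}" if "q \<in> ball p d" for q
      using b[OF that] \<open>\<And>x. \<bar>x - fst p\<bar> < d \<Longrightarrow> F x \<le> hi\<close>[of "fst q"] by (auto simp: lienard_field_def case_prod_unfold)
    then show ?thesis using sub[OF cl(2) cv(2)] by blast
  qed
  have "lienard_field F q \<in> {w. fst p - d \<le> snd w}" if "q \<in> ball p d" for q
    using b[OF that] by (auto simp: lienard_field_def case_prod_unfold)
  then have "fst p - d \<le> snd v" using sub[OF cl(3) cv(3)] by blast
  moreover have "lienard_field F q \<in> {w. snd w \<le> fst p + d}" if "q \<in> ball p d" for q
    using b[OF that] by (auto simp: lienard_field_def case_prod_unfold)
  then have "snd v \<le> fst p + d" using sub[OF cl(4) cv(4)] by blast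
  ultimately show "\<bar>snd v - fst p\<bar> \<le> d" by linarith
qed

text \<open>The component x of the field is continuous, so convexification leaves it unchanged; thus
  y' = x holds on switching lines too, sliding included.\<close>

lemma filippov_map_lienard_snd:
  assumes "v \<in> filippov_map (lienard_field F) p" shows "snd v = fst p"
proof -
  have "\<bar>snd v - fst p\<bar> \<le> d" if "d > 0" for d using filippov_map_lienard_bounds(3)[OF assms that] .
  then have "\<bar>snd v - fst p\<bar> \<le> 0" by (rule field_le_epsilon) simp
  then show ?thesis by simp
qed

section \<open>Forward uniqueness of Filippov solutions\<close>

definition one_sided_lipschitz :: "real \<Rightarrow> (real \<Rightarrow> real) \<Rightarrow> bool" where
  "one_sided_lipschitz L F \<longleftrightarrow> 0 \<le> L \<and> (\<forall>x y. x < y \<longrightarrow> F y - F x \<le> L * (y - x))"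

lemma filippov_map_dissipative:
  assumes F: "one_sided_lipschitz L F"
    and v: "v \<in> filippov_map (lienard_field F) p" and w: "w \<in> filippov_map (lienard_field F) q"
  shows "(w - v) \<bullet> (q - p) \<le> L * (norm (q - p))\<^sup>2"
proof -
  have ord: "fst w - fst v \<le> L * (fst q - fst p) - (snd q - snd p)"
    if lt: "fst p < fst q" and v: "v \<in> filippov_map (lienard_field F) p"
      and w: "w \<in> filippov_map (lienard_field F) q" for v w p q
  proof (rule field_le_epsilon)
    fix e :: real assume e: "e > 0"
    have L: "L \<ge> 0" using F by (simp add: one_sided_lipschitz_def)
    \<comment> \<open>The first bound keeps the neighbourhoods of both abscissae in order, so that
      the one-sided estimate applies across them; the second makes the total error
      \<open>2 * L * d + 2 * d\<close> at most e.\<close>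
    define d where "d = min ((fst q - fst p) / 2) (e / (2 * L + 2))"
    have d: "d > 0" using lt e L by (simp add: d_def add_nonneg_pos)
    have d': "d \<le> (fst q - fst p) / 2" "d \<le> e / (2 * L + 2)" unfolding d_def by (rule min.cobounded1 min.cobounded2)+
    have dd: "2 * L * d + 2 * d \<le> e"
      using d'(2) L by (simp add: field_simps)
    \<comment> \<open>The infimum of F near p is a common reference value: it bounds F from below
      near p and, up to the one-sided slope, from above near q.\<close>
    define lo where "lo = Inf (F ` {x. \<bar>x - fst p\<bar> < d})"
    have F1: "F y - L * (fst q - fst p + 2 * d) \<le> F x" if "\<bar>x - fst p\<bar> < d" "\<bar>y - fst q\<bar> < d" for x y
    proof -
      have "x < y" using that d'(1) by (auto simp: abs_less_iff)
      then have "F y - F x \<le> L * (y - x)" using F by (simp add: one_sided_lipschitz_def)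
      also have "\<dots> \<le> L * (fst q - fst p + 2 * d)" using that L by (intro mult_left_mono) auto
      finally show ?thesis by simp
    qed
    have ne: "F ` {x. \<bar>x - fst p\<bar> < d} \<noteq> {}" using d by (auto intro!: exI[of _ "fst p"])
    have bd: "bdd_below (F ` {x. \<bar>x - fst p\<bar> < d})"
      by (rule bdd_belowI2[of _ "F (fst q) - L * (fst q - fst p + 2 * d)"]) (use F1[of _ "fst q"] d in auto)
    have lo: "lo \<le> F x" if "\<bar>x - fst p\<bar> < d" for x
      unfolding lo_def using bd that by (intro cINF_lower) auto
    have hi: "F y \<le> lo + L * (fst q - fst p + 2 * d)" if "\<bar>y - fst q\<bar> < d" for y
    proof -
      have "F y - L * (fst q - fst p + 2 * d) \<le> lo" unfolding lo_def
        by (rule cINF_greatest) (use ne F1[OF _ that] in auto)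
      then show ?thesis by simp
    qed
    have "lo - snd p - d \<le> fst v" using filippov_map_lienard_bounds(1)[OF v d] lo by blast
    moreover have "fst w \<le> lo + L * (fst q - fst p + 2 * d) - snd q + d"
      using filippov_map_lienard_bounds(2)[OF w d] hi by blast
    ultimately show "fst w - fst v \<le> L * (fst q - fst p) - (snd q - snd p) + e"
      using dd by (simp add: algebra_simps)
  qed
  have L: "L \<ge> 0" using F by (simp add: one_sided_lipschitz_def)
  have s: "snd v = fst p" "snd w = fst q" using v w filippov_map_lienard_snd by blast+
  have "(fst w - fst v) * (fst q - fst p) + (fst q - fst p) * (snd q - snd p) \<le> L * (fst q - fst p)\<^sup>2"
  proof (cases "fst p" "fst q" rule: linorder_cases)
    case less
    have "(fst w - fst v) * (fst q - fst p) \<le> (L * (fst q - fst p) - (snd q - snd p)) * (fst q - fst p)"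
      using ord[OF less v w] less by (intro mult_right_mono) auto
    then show ?thesis by (simp add: algebra_simps power2_eq_square)
  next
    case equal then show ?thesis by simp
  next
    case greater
    have "fst v - fst w \<le> L * (fst p - fst q) - (snd p - snd q)" using ord[OF greater w v] .
    then have "(fst v - fst w) * (fst p - fst q) \<le> (L * (fst p - fst q) - (snd p - snd q)) * (fst p - fst q)"
      using greater by (intro mult_right_mono) auto
    then show ?thesis by (simp add: algebra_simps power2_eq_square)
  qed
  moreover have "(fst q - fst p)\<^sup>2 \<le> (norm (q - p))\<^sup>2"
    by (simp add: norm_prod_def)
  then have "L * (fst q - fst p)\<^sup>2 \<le> L * (norm (q - p))\<^sup>2" using L mult_left_mono by blast
  ultimately show ?thesis by (simp add: inner_prod_def s)
qed

text \<open>A form on a bounded interval with an explicit exceptional set, in which pieces of global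
  solutions and finitely glued arcs can be compared.\<close>

definition filippov_on :: "(real \<Rightarrow> real) \<Rightarrow> (real \<Rightarrow> real \<times> real) \<Rightarrow> real \<Rightarrow> real \<Rightarrow> bool" where
  "filippov_on F g a b \<longleftrightarrow> absolutely_continuous_fun_on {a..b} g \<and>
     (\<exists>N. negligible N \<and> (\<forall>t. a < t \<and> t < b \<and> t \<notin> N \<longrightarrow>
        (\<exists>v\<in>filippov_map (lienard_field F) (g t). (g has_vector_derivative v) (at t))))"

lemma filippov_solution_imp_on:
  assumes "filippov_solution (lienard_field F) g" shows "filippov_on F g a b"
proof -
  have "AE t in lebesgue. \<exists>v\<in>filippov_map (lienard_field F) (g t). (g has_vector_derivative v) (at t)"
    using assms by (simp add: filippov_solution_def)
  then obtain N where N: "N \<in> null_sets lebesgue"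
    "{t \<in> space lebesgue. \<not> (\<exists>v\<in>filippov_map (lienard_field F) (g t). (g has_vector_derivative v) (at t))} \<subseteq> N"
    by (auto simp: eventually_ae_filter)
  have "negligible N" using N(1) by (simp add: negligible_iff_null_sets)
  moreover have "\<exists>v\<in>filippov_map (lienard_field F) (g t). (g has_vector_derivative v) (at t)" if "t \<notin> N" for t
    using N(2) that by auto
  moreover have "absolutely_continuous_fun_on {a..b} g"
    using assms by (simp add: filippov_solution_def)
  ultimately show ?thesis unfolding filippov_on_def by blast
qed

text \<open>Gronwall without integrals: \<open>exp (- 2 * L * t)\<close> times the squared distance
  is absolutely continuous with nonpositive derivative almost everywhere. Only the forward direction
  holds, since different orbits merge on sliding segments.\<close>

lemma filippov_unique:
  assumes F: "one_sided_lipschitz L F" and ab: "a \<le> b"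
    and f: "filippov_on F f a b" and g: "filippov_on F g a b" and eq: "f a = g a"
  shows "f b = g b"
proof -
  have acf: "absolutely_continuous_fun_on {a..b} f" and acg: "absolutely_continuous_fun_on {a..b} g"
    using f g by (auto simp: filippov_on_def)
  define n where "n t = (norm (g t - f t))\<^sup>2" for t
  define h where "h t = exp (- 2 * L * t) * n t" for t
  have "compact ((\<lambda>t. g t - f t) ` {a..b})"
    using acf acg by (intro compact_continuous_image continuous_intros absolutely_continuous_fun_on_imp_continuous) auto
  then have "bounded ((\<lambda>t. g t - f t) ` {a..b})" by (rule compact_imp_bounded)
  then obtain M where M: "M > 0" "\<And>t. t \<in> {a..b} \<Longrightarrow> norm (g t - f t) \<le> M"
    unfolding bounded_pos by blast
  have acn: "absolutely_continuous_fun_on {a..b} n"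
  proof (rule absolutely_continuous_fun_on_dominated[OF acf acg])
    show "0 \<le> 2 * M" using M by simp
    fix u v assume uv: "u \<in> {a..b}" "v \<in> {a..b}"
    have "norm (n v - n u) = \<bar>norm (g v - f v) - norm (g u - f u)\<bar> * (norm (g v - f v) + norm (g u - f u))"
      by (simp add: n_def power2_eq_square square_diff_square_factored abs_mult mult.commute)
    also have "\<dots> \<le> norm ((g v - f v) - (g u - f u)) * (M + M)"
      using M uv by (intro mult_mono norm_triangle_ineq3 add_mono) auto
    also have "\<dots> \<le> (norm (f v - f u) + norm (g v - g u) + \<bar>v - u\<bar>) * (M + M)"
    proof -
      have "norm ((g v - f v) - (g u - f u)) = norm ((g v - g u) - (f v - f u))" by (simp add: algebra_simps)
      also have "\<dots> \<le> norm (g v - g u) + norm (f v - f u)" by (rule norm_triangle_ineq4)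
      finally show ?thesis using M by (intro mult_right_mono) auto
    qed
    finally show "norm (n v - n u) \<le> 2 * M * (norm (f v - f u) + norm (g v - g u) + \<bar>v - u\<bar>)" by (simp add: mult.commute mult.left_commute)
  qed
  have lipe: "\<exists>C. C-lipschitz_on {a..b} (\<lambda>t. exp (- 2 * L * t))"
  proof -
    have "bounded ((\<lambda>t. exp (- 2 * L * t) * (- 2 * L)) ` {a..b})"
      by (intro compact_imp_bounded compact_continuous_image continuous_intros) auto
    then obtain B where B: "B > 0" "\<And>t. t \<in> {a..b} \<Longrightarrow> norm (exp (- 2 * L * t) * (- 2 * L)) \<le> B"
      unfolding bounded_pos by blast
    have "B-lipschitz_on {a..b} (\<lambda>t. exp (- 2 * L * t))"
    proof (rule bounded_derivative_imp_lipschitz)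
      show "((\<lambda>t. exp (- 2 * L * t)) has_derivative (*) (exp (- 2 * L * t) * (- 2 * L))) (at t within {a..b})" for t
        unfolding has_field_derivative_def[symmetric] by (auto intro!: derivative_eq_intros)
      show "onorm ((*) (exp (- 2 * L * t) * (- 2 * L))) \<le> B" if "t \<in> {a..b}" for t
        by (rule onorm_le) (use B(2)[OF that] in \<open>auto simp: abs_mult intro!: mult_right_mono\<close>)
    qed (use B in auto)
    then show ?thesis by blast
  qed
  then have ace: "absolutely_continuous_fun_on {a..b} (\<lambda>t. exp (- 2 * L * t))"
    using lipschitz_imp_absolutely_continuous_fun_on by blast
  have ach: "absolutely_continuous_fun_on {a..b} h"
  proof -
    have "compact (n ` {a..b})" "compact ((\<lambda>t. exp (- 2 * L * t)) ` {a..b})"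
      using acn ace by (auto intro!: compact_continuous_image absolutely_continuous_fun_on_imp_continuous)
    then have "bounded (n ` {a..b})" "bounded ((\<lambda>t. exp (- 2 * L * t)) ` {a..b})"
      by (simp_all only: compact_imp_bounded)
    then obtain K1 K2 where K: "\<And>t. t \<in> {a..b} \<Longrightarrow> \<bar>n t\<bar> \<le> K1" "\<And>t. t \<in> {a..b} \<Longrightarrow> \<bar>exp (- 2 * L * t)\<bar> \<le> K2"
      "K1 > 0" "K2 > 0"
      unfolding bounded_pos real_norm_def by blast
    show ?thesis
    proof (rule absolutely_continuous_fun_on_dominated[OF acn ace])
      show "0 \<le> K1 + K2" using K by simp
      fix u v assume uv: "u \<in> {a..b}" "v \<in> {a..b}"
      have "norm (h v - h u) = \<bar>exp (- 2 * L * v) * (n v - n u) + n u * (exp (- 2 * L * v) - exp (- 2 * L * u))\<bar>"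
        by (simp add: h_def algebra_simps)
      also have "\<dots> \<le> \<bar>exp (- 2 * L * v)\<bar> * \<bar>n v - n u\<bar> + \<bar>n u\<bar> * \<bar>exp (- 2 * L * v) - exp (- 2 * L * u)\<bar>"
        by (metis abs_mult abs_triangle_ineq)
      also have "\<dots> \<le> K2 * \<bar>n v - n u\<bar> + K1 * \<bar>exp (- 2 * L * v) - exp (- 2 * L * u)\<bar>"
        using K uv by (intro add_mono mult_right_mono) auto
      also have "\<dots> \<le> (K1 + K2) * \<bar>n v - n u\<bar> + (K1 + K2) * \<bar>exp (- 2 * L * v) - exp (- 2 * L * u)\<bar>"
        using K by (intro add_mono mult_right_mono) auto
      also have "\<dots> \<le> (K1 + K2) * (\<bar>n v - n u\<bar> + \<bar>exp (- 2 * L * v) - exp (- 2 * L * u)\<bar> + \<bar>v - u\<bar>)"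
        using K by (simp add: algebra_simps)
      finally show "norm (h v - h u) \<le> (K1 + K2) * (norm (n v - n u) + norm (exp (- 2 * L * v) - exp (- 2 * L * u)) + \<bar>v - u\<bar>)"
        by simp
    qed
  qed
  obtain N1 where N1: "negligible N1" "\<And>t. a < t \<Longrightarrow> t < b \<Longrightarrow> t \<notin> N1 \<Longrightarrow>
      \<exists>v\<in>filippov_map (lienard_field F) (f t). (f has_vector_derivative v) (at t)"
    using f by (auto simp: filippov_on_def)
  obtain N2 where N2: "negligible N2" "\<And>t. a < t \<Longrightarrow> t < b \<Longrightarrow> t \<notin> N2 \<Longrightarrow>
      \<exists>v\<in>filippov_map (lienard_field F) (g t). (g has_vector_derivative v) (at t)"
    using g by (auto simp: filippov_on_def)
  have "h b \<le> h a"
  proof (rule absolutely_continuous_nonincreasing[OF ab ach, of "N1 \<union> N2"])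
    show "negligible (N1 \<union> N2)" using N1(1) N2(1) by (rule negligible_Un)
    fix t assume t: "a < t" "t < b" "t \<notin> N1 \<union> N2"
    obtain v where v: "v \<in> filippov_map (lienard_field F) (f t)" "(f has_vector_derivative v) (at t)" using N1 t by blast
    obtain w where w: "w \<in> filippov_map (lienard_field F) (g t)" "(g has_vector_derivative w) (at t)" using N2 t by blast
    have "((\<lambda>t. g t - f t) has_vector_derivative w - v) (at t)"
      using v w by (intro derivative_intros)
    then have d: "((\<lambda>t. g t - f t) has_derivative (\<lambda>s. s *\<^sub>R (w - v))) (at t)" by (simp add: has_vector_derivative_def)
    have "(n has_derivative (\<lambda>s. 2 * s * ((w - v) \<bullet> (g t - f t)))) (at t)"
      unfolding n_def power2_norm_eq_inner
      by (rule has_derivative_eq_rhs[OF has_derivative_inner[OF d d]]) (auto simp: inner_commute)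
    then have dn: "(n has_real_derivative 2 * ((w - v) \<bullet> (g t - f t))) (at t)"
      unfolding has_field_derivative_def by (rule has_derivative_eq_rhs) (auto simp: fun_eq_iff)
    have "(h has_real_derivative exp (- 2 * L * t) * (2 * ((w - v) \<bullet> (g t - f t)) - 2 * L * n t)) (at t)"
      unfolding h_def by (rule derivative_eq_intros dn refl | simp add: algebra_simps)+
    moreover have "2 * ((w - v) \<bullet> (g t - f t)) - 2 * L * n t \<le> 0"
      using filippov_map_dissipative[OF F v(1) w(1)] by (simp add: n_def)
    then have "exp (- 2 * L * t) * (2 * ((w - v) \<bullet> (g t - f t)) - 2 * L * n t) \<le> 0"
      by (simp add: mult_nonneg_nonpos)
    ultimately show "\<exists>D\<le>0. (h has_real_derivative D) (at t)" by blast
  qed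
  then have "exp (- 2 * L * b) * n b \<le> 0" using eq by (simp add: h_def n_def)
  then have "n b \<le> 0" by (simp add: mult_le_0_iff)
  then show ?thesis by (simp add: n_def)
qed

lemma filippov_on_subinterval:
  assumes "filippov_on F g a b" "a \<le> a'" "b' \<le> b" shows "filippov_on F g a' b'"
  using assms absolutely_continuous_fun_on_subset[of "{a..b}" g "{a'..b'}"] unfolding filippov_on_def
  by (metis atLeastatMost_subset_iff order_le_less_trans order_less_le_trans)

section \<open>Translation in time\<close>

lemma division_of_translation:
  fixes D :: "real set set"
  assumes "D division_of T"
  shows "(\<lambda>k. (\<lambda>x. x + c) ` k) ` D division_of (\<lambda>x. x + c) ` T"
proof (rule division_ofI)
  show "finite ((\<lambda>k. (\<lambda>x. x + c) ` k) ` D)" using assms by blast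
  show "\<Union> ((\<lambda>k. (\<lambda>x. x + c) ` k) ` D) = (\<lambda>x. x + c) ` T"
    using division_ofD(6)[OF assms] by blast
  fix k assume "k \<in> (\<lambda>k. (\<lambda>x. x + c) ` k) ` D"
  then obtain l where l: "l \<in> D" "k = (\<lambda>x. x + c) ` l" by blast
  note dl = division_ofD(2,3,4)[OF assms l(1)]
  show "k \<subseteq> (\<lambda>x. x + c) ` T" "k \<noteq> {}" using dl l(2) by blast+
  obtain u v where "l = cbox u v" using dl by blast
  then have "k = cbox (u + c) (v + c)" using l(2) by (simp add: add.commute)
  then show "\<exists>a b. k = cbox a b" by blast
  fix k' assume "k' \<in> (\<lambda>k. (\<lambda>x. x + c) ` k) ` D" and ne: "k \<noteq> k'"
  then obtain l' where l': "l' \<in> D" "k' = (\<lambda>x. x + c) ` l'" by blast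
  have "interior l \<inter> interior l' = {}" using division_ofD(5)[OF assms l(1) l'(1)] ne l l' by blast
  moreover have "interior ((\<lambda>x. x + c) ` m) = (\<lambda>x. x + c) ` interior m" for m :: "real set"
    using interior_translation[of c m] by (simp add: add.commute)
  ultimately show "interior k \<inter> interior k' = {}" using l l' by auto
qed

lemma absolutely_continuous_fun_on_shift:
  fixes g :: "real \<Rightarrow> 'a::real_normed_vector"
  assumes "absolutely_continuous_fun_on {a + c..b + c} g"
  shows "absolutely_continuous_fun_on {a..b} (\<lambda>t. g (t + c))"
  unfolding absolutely_continuous_fun_on_def
proof (intro allI impI)
  fix e :: real assume "e > 0"
  obtain d where d: "d > 0" "\<And>D T. D division_of T \<Longrightarrow> T \<subseteq> {a + c..b + c} \<Longrightarrow> (\<Sum>k\<in>D. Sup k - Inf k) < d \<Longrightarrow>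
        (\<Sum>k\<in>D. norm (g (Sup k) - g (Inf k))) < e"
    using assms \<open>e > 0\<close> by (rule absolutely_continuous_funD) (rule that)
  show "\<exists>d>0. \<forall>D T. D division_of T \<and> T \<subseteq> {a..b} \<and> (\<Sum>k\<in>D. Sup k - Inf k) < d \<longrightarrow>
        (\<Sum>k\<in>D. norm (g (Sup k + c) - g (Inf k + c))) < e"
  proof (intro exI[of _ d] conjI d(1) allI impI)
    fix D T assume D: "D division_of T \<and> T \<subseteq> {a..b} \<and> (\<Sum>k\<in>D. Sup k - Inf k) < d"
    let ?s = "\<lambda>k::real set. (\<lambda>x. x + c) ` k"
    have inj: "inj_on ?s D"
      by (rule inj_onI) (simp add: inj_image_eq_iff inj_def)
    have si: "Sup (?s k) = Sup k + c \<and> Inf (?s k) = Inf k + c" if "k \<in> D" for k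
    proof -
      have "k = {Inf k..Sup k}" "Inf k \<le> Sup k" using division_of_Sup_Inf(3,4)[of D T k] D that by blast+
      then have "?s k = {Inf k + c..Sup k + c}" by (metis image_add_atLeastAtMost')
      then show ?thesis using \<open>Inf k \<le> Sup k\<close> by simp
    qed
    have dv: "?s ` D division_of ?s T" using D division_of_translation by blast
    moreover have "?s T \<subseteq> {a + c..b + c}" using D by auto
    moreover have "(\<Sum>k\<in>?s ` D. Sup k - Inf k) = (\<Sum>k\<in>D. Sup k - Inf k)"
      using si by (simp add: sum.reindex[OF inj])
    ultimately have "(\<Sum>k\<in>?s ` D. norm (g (Sup k) - g (Inf k))) < e" using d(2)[of "?s ` D" "?s T"] D by simp
    then show "(\<Sum>k\<in>D. norm (g (Sup k + c) - g (Inf k + c))) < e"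
      using si by (simp add: sum.reindex[OF inj])
  qed
qed

lemma has_vector_derivative_shift_arg:
  assumes "(g has_vector_derivative v) (at (t + c))"
  shows "((\<lambda>t. g (t + c)) has_vector_derivative v) (at t)"
proof -
  have "((\<lambda>t. t + c) has_vector_derivative 1) (at t)"
    by (auto intro!: derivative_eq_intros)
  from vector_diff_chain_at[OF this assms] show ?thesis by (simp add: o_def)
qed

lemma filippov_on_shift:
  assumes "filippov_on F g (a + c) (b + c)"
  shows "filippov_on F (\<lambda>t. g (t + c)) a b"
proof -
  obtain N where N: "negligible N" "\<And>t. a + c < t \<Longrightarrow> t < b + c \<Longrightarrow> t \<notin> N \<Longrightarrow>
      \<exists>v\<in>filippov_map (lienard_field F) (g t). (g has_vector_derivative v) (at t)"
    using assms by (auto simp: filippov_on_def)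
  have "negligible ((+) (- c) ` N)" using N(1) by (rule negligible_translation)
  moreover have "\<exists>v\<in>filippov_map (lienard_field F) (g (t + c)). ((\<lambda>t. g (t + c)) has_vector_derivative v) (at t)"
    if "a < t" "t < b" "t \<notin> (+) (- c) ` N" for t
  proof -
    have "t + c \<notin> N" using that(3) by (metis add.commute add_minus_cancel image_eqI minus_add_cancel)
    then show ?thesis using N(2)[of "t + c"] that has_vector_derivative_shift_arg by fastforce
  qed
  moreover have "absolutely_continuous_fun_on {a..b} (\<lambda>t. g (t + c))"
    using assms absolutely_continuous_fun_on_shift unfolding filippov_on_def by blast
  ultimately show ?thesis unfolding filippov_on_def by blast
qed

section \<open>Concatenation of arcs\<close>

text \<open>\<open>Q\<close> is left open so that one gluing calculus serves both classical arcs and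
  Filippov arcs. Finitely many exceptional times cover the junctions, the Lipschitz bound yields
  absolute continuity, and W keeps track of the trace.\<close>

definition arc_of ::
  "(real \<times> real \<Rightarrow> real \<times> real \<Rightarrow> bool) \<Rightarrow> real \<times> real \<Rightarrow> real \<times> real \<Rightarrow> (real \<times> real) set \<Rightarrow> bool" where
  "arc_of Q p r W \<longleftrightarrow> (\<exists>g T. 0 \<le> T \<and> g 0 = p \<and> g T = r \<and> g ` {0..T} = W \<and>
     (\<exists>L. L-lipschitz_on {0..T} g) \<and>
     (\<exists>S. finite S \<and> (\<forall>t. 0 < t \<and> t < T \<and> t \<notin> S \<longrightarrow>
        (\<exists>v. Q (g t) v \<and> (g has_vector_derivative v) (at t)))))"

lemma arc_ofE:
  assumes "arc_of Q p r W"
  obtains g T L S where "0 \<le> T" "g 0 = p" "g T = r" "g ` {0..T} = W" "L-lipschitz_on {0..T} g" "finite S"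
     "\<And>t. 0 < t \<Longrightarrow> t < T \<Longrightarrow> t \<notin> S \<Longrightarrow> \<exists>v. Q (g t) v \<and> (g has_vector_derivative v) (at t)"
  using assms unfolding arc_of_def
proof (elim exE conjE)
  fix g T L S assume "0 \<le> T" "g 0 = p" "g T = r" "g ` {0..T} = W" "L-lipschitz_on {0..T} g" "finite S"
     "\<forall>t. 0 < t \<and> t < T \<and> t \<notin> S \<longrightarrow> (\<exists>v. Q (g t) v \<and> (g has_vector_derivative v) (at t))"
  then show thesis by (intro that[of T g L S]) simp_all
qed

lemma arc_ofI:
  assumes "0 \<le> T" "g 0 = p" "g T = r" "g ` {0..T} = W" "L-lipschitz_on {0..T} g" "finite S"
     "\<And>t. 0 < t \<Longrightarrow> t < T \<Longrightarrow> t \<notin> S \<Longrightarrow> \<exists>v. Q (g t) v \<and> (g has_vector_derivative v) (at t)"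
  shows "arc_of Q p r W"
  unfolding arc_of_def
proof (intro exI conjI)
  show "\<forall>t. 0 < t \<and> t < T \<and> t \<notin> S \<longrightarrow> (\<exists>v. Q (g t) v \<and> (g has_vector_derivative v) (at t))"
    using assms(7) by simp
qed (fact assms(1-6))+

lemma arc_of_mono:
  assumes "arc_of Q p r W" "\<And>q v. q \<in> W \<Longrightarrow> Q q v \<Longrightarrow> Q' q v"
  shows "arc_of Q' p r W"
proof -
  obtain g T L S where g: "0 \<le> T" "g 0 = p" "g T = r" "g ` {0..T} = W" "L-lipschitz_on {0..T} g" "finite S"
     "\<And>t. 0 < t \<Longrightarrow> t < T \<Longrightarrow> t \<notin> S \<Longrightarrow> (\<exists>v. Q (g t) v \<and> (g has_vector_derivative v) (at t))"
    using assms(1) by (rule arc_ofE) (rule that)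
  have "\<exists>v. Q' (g t) v \<and> (g has_vector_derivative v) (at t)" if "0 < t" "t < T" "t \<notin> S" for t
  proof -
    have "g t \<in> W" using g(4) that by auto
    then show ?thesis using g(7)[OF that] assms(2) by blast
  qed
  then show ?thesis by (intro arc_ofI[OF g(1-6)]) blast
qed

lemma arc_of_refl: "arc_of Q p p {p}"
  by (rule arc_ofI[where T = 0 and g = "\<lambda>_. p" and L = 0 and S = "{}"]) (simp_all add: lipschitz_on_def)

lemma arc_of_trans:
  assumes "arc_of Q p q V" "arc_of Q q r W"
  shows "arc_of Q p r (V \<union> W)"
proof -
  obtain g T L S where g: "0 \<le> T" "g 0 = p" "g T = q" "g ` {0..T} = V" "L-lipschitz_on {0..T} g" "finite S"
     "\<And>t. 0 < t \<Longrightarrow> t < T \<Longrightarrow> t \<notin> S \<Longrightarrow> (\<exists>v. Q (g t) v \<and> (g has_vector_derivative v) (at t))"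
    using assms(1) by (rule arc_ofE) (rule that)
  obtain g' T' L' S' where g': "0 \<le> T'" "g' 0 = q" "g' T' = r" "g' ` {0..T'} = W" "L'-lipschitz_on {0..T'} g'" "finite S'"
     "\<And>t. 0 < t \<Longrightarrow> t < T' \<Longrightarrow> t \<notin> S' \<Longrightarrow> (\<exists>v. Q (g' t) v \<and> (g' has_vector_derivative v) (at t))"
    using assms(2) by (rule arc_ofE) (rule that)
  define h where "h t = (if t \<le> T then g t else g' (t - T))" for t
  define M where "M = max L L'"
  have l1: "M-lipschitz_on {0..T} g" using g(5) by (rule lipschitz_on_le) (simp add: M_def)
  have l2: "M-lipschitz_on {T..T + T'} (\<lambda>t. g' (t - T))"
  proof (rule lipschitz_onI)
    show "0 \<le> M" using l1 lipschitz_on_nonneg by blast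
    fix x y assume "x \<in> {T..T + T'}" "y \<in> {T..T + T'}"
    then have "dist (g' (x - T)) (g' (y - T)) \<le> L' * dist (x - T) (y - T)"
      by (intro lipschitz_onD[OF g'(5)]) auto
    also have "\<dots> \<le> M * dist x y" by (simp add: M_def dist_real_def mult_right_mono)
    finally show "dist (g' (x - T)) (g' (y - T)) \<le> M * dist x y" .
  qed
  have lip: "M-lipschitz_on {0..T + T'} h"
    unfolding h_def using lipschitz_on_concat[OF l1 l2] g(3) g'(2) by simp
  have img: "h ` {0..T + T'} = V \<union> W"
  proof -
    have "h ` {0..T} = V" using g(4) by (force simp: h_def)
    moreover have "h ` {T..T + T'} = W"
    proof -
      have "h t = g' (t - T)" if "t \<in> {T..T + T'}" for t using that g(3) g'(2) by (auto simp: h_def)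
      then have "h ` {T..T + T'} = (\<lambda>t. g' (t - T)) ` {T..T + T'}" by (rule image_cong[OF refl])
      also have "\<dots> = g' ` ((\<lambda>t. t - T) ` {T..T + T'})" by (simp only: image_image)
      also have "(\<lambda>t. t - T) ` {T..T + T'} = {0..T'}"
        using image_add_atLeastAtMost'[of "- T" T "T + T'"] by simp
      finally show ?thesis using g'(4) by simp
    qed
    moreover have "{0..T + T'} = {0..T} \<union> {T..T + T'}" using g(1) g'(1) by auto
    ultimately show ?thesis by (simp add: image_Un)
  qed
  \<comment> \<open>The junction time T becomes exceptional, because the velocities on its two sides
    may differ.\<close>
  have der: "\<exists>v. Q (h t) v \<and> (h has_vector_derivative v) (at t)"
    if t: "0 < t" "t < T + T'" "t \<notin> insert T (S \<union> (\<lambda>s. s + T) ` S')" for t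
  proof (cases "t < T")
    case True
    then obtain v where v: "Q (g t) v" "(g has_vector_derivative v) (at t)" using g(7)[of t] t by auto
    have "(h has_vector_derivative v) (at t)"
      by (rule has_vector_derivative_transform_within_open[OF v(2), of "{..<T}"]) (use True in \<open>auto simp: h_def\<close>)
    moreover have "h t = g t" using True by (simp add: h_def)
    ultimately show ?thesis using v(1) by metis
  next
    case False
    then have "t > T" using t by auto
    have "t - T \<notin> S'" using t(3) by force
    then obtain v where v: "Q (g' (t - T)) v" "(g' has_vector_derivative v) (at (t + - T))"
      using g'(7)[of "t - T"] \<open>t > T\<close> t by auto
    have "((\<lambda>t. g' (t + - T)) has_vector_derivative v) (at t)" using v(2) by (rule has_vector_derivative_shift_arg)
    then have "(h has_vector_derivative v) (at t)"
      by (rule has_vector_derivative_transform_within_open[of _ _ _ "{T<..}"]) (use \<open>t > T\<close> in \<open>auto simp: h_def\<close>)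
    moreover have "h t = g' (t - T)" using \<open>t > T\<close> by (simp add: h_def)
    ultimately show ?thesis using v(1) by metis
  qed
  show ?thesis
  proof (rule arc_ofI[OF _ _ _ img lip, where S = "insert T (S \<union> (\<lambda>s. s + T) ` S')"])
    show "h (T + T') = r" using g(3) g'(1,2,3) by (cases "T' = 0") (auto simp: h_def)
    show "finite (insert T (S \<union> (\<lambda>s. s + T) ` S'))" using g(6) g'(6) by simp
    show "h 0 = p" "0 \<le> T + T'" using g(1,2) g'(1) by (auto simp: h_def)
  qed (rule der)
qed

section \<open>Time reversal\<close>

definition reflect :: "real \<times> real \<Rightarrow> real \<times> real" where
  "reflect p = (fst p, - snd p)"

text \<open>Reversing time and reflecting in the x-axis turns the system of \<open>F\<close> into that of \<open>- F\<close>.\<close>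

lemma arc_of_reflect:
  assumes "arc_of Q p r W" "\<And>q v. Q q v \<Longrightarrow> Q' (reflect q) (- fst v, snd v)"
  shows "arc_of Q' (reflect r) (reflect p) (reflect ` W)"
proof -
  obtain g T L S where g: "0 \<le> T" "g 0 = p" "g T = r" "g ` {0..T} = W" "L-lipschitz_on {0..T} g" "finite S"
     "\<And>t. 0 < t \<Longrightarrow> t < T \<Longrightarrow> t \<notin> S \<Longrightarrow> (\<exists>v. Q (g t) v \<and> (g has_vector_derivative v) (at t))"
    using assms(1) by (rule arc_ofE) (rule that)
  define h where "h t = reflect (g (T - t))" for t
  have dr: "dist (reflect a) (reflect b) = dist a b" for a b
    by (simp add: reflect_def dist_prod_def dist_real_def power2_commute)
  have lip: "L-lipschitz_on {0..T} h"
  proof (rule lipschitz_onI)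
    show "0 \<le> L" using g(5) lipschitz_on_nonneg by blast
    fix x y assume "x \<in> {0..T}" "y \<in> {0..T}"
    then have "dist (g (T - x)) (g (T - y)) \<le> L * dist (T - x) (T - y)"
      by (intro lipschitz_onD[OF g(5)]) auto
    then show "dist (h x) (h y) \<le> L * dist x y" by (simp add: h_def dr dist_real_def abs_minus_commute)
  qed
  have "h = (\<lambda>t. reflect (g (T - t)))" by (simp add: fun_eq_iff h_def)
  then have "h ` {0..T} = reflect ` g ` ((\<lambda>t. T - t) ` {0..T})" by (simp only: image_image)
  also have "(\<lambda>t. T - t) ` {0..T} = {0..T}" using g(1) by (simp add: image_diff_atLeastAtMost)
  finally have img: "h ` {0..T} = reflect ` W" using g(4) by simp
  have der: "\<exists>v. Q' (h t) v \<and> (h has_vector_derivative v) (at t)"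
    if t: "0 < t" "t < T" "t \<notin> (\<lambda>s. T - s) ` S" for t
  proof -
    have "T - t \<notin> S" using t(3) by (metis diff_diff_eq2 add_diff_cancel_left' image_eqI)
    then obtain v where v: "Q (g (T - t)) v" "(g has_vector_derivative v) (at (T - t))"
      using g(7)[of "T - t"] t by auto
    have "((\<lambda>t. T - t) has_vector_derivative -1) (at t)" by (auto intro!: derivative_eq_intros)
    from vector_diff_chain_at[OF this v(2)] have d: "((\<lambda>t. g (T - t)) has_vector_derivative - v) (at t)"
      by (simp add: o_def)
    have bl: "bounded_linear reflect"
      unfolding reflect_def by (intro bounded_linear_Pair bounded_linear_fst bounded_linear_minus bounded_linear_snd)
    have "(h has_vector_derivative reflect (- v)) (at t)"
      unfolding h_def using bounded_linear.has_vector_derivative[OF bl d] .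
    moreover have "reflect (- v) = (- fst v, snd v)" by (simp add: reflect_def)
    ultimately show ?thesis using assms(2)[OF v(1)] unfolding h_def by metis
  qed
  show ?thesis
  proof (rule arc_ofI[OF g(1) _ _ img lip, where S = "(\<lambda>s. T - s) ` S"])
    show "finite ((\<lambda>s. T - s) ` S)" using g(6) by simp
    show "h 0 = reflect r" "h T = reflect p" using g(2,3) by (auto simp: h_def)
  qed (rule der)
qed

lemma arc_of_image:
  assumes "arc_of Q p r W"
  shows "compact W" "connected W" "p \<in> W" "r \<in> W"
proof -
  obtain g T L S where g: "0 \<le> T" "g 0 = p" "g T = r" "g ` {0..T} = W" "L-lipschitz_on {0..T} g" "finite S"
     "\<And>t. 0 < t \<Longrightarrow> t < T \<Longrightarrow> t \<notin> S \<Longrightarrow> (\<exists>v. Q (g t) v \<and> (g has_vector_derivative v) (at t))"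
    using assms(1) by (rule arc_ofE) (rule that)
  have "continuous_on {0..T} g" using g(5) by (rule lipschitz_on_continuous_on)
  then show "compact W" "connected W"
    unfolding g(4)[symmetric] by (intro compact_continuous_image connected_continuous_image; simp)+
  show "p \<in> W" "r \<in> W" using g(1-4) by force+
qed

abbreviation filippov_arc :: "(real \<Rightarrow> real) \<Rightarrow> real \<times> real \<Rightarrow> real \<times> real \<Rightarrow> (real \<times> real) set \<Rightarrow> bool" where
  "filippov_arc F \<equiv> arc_of (\<lambda>q v. v \<in> filippov_map (lienard_field F) q)"

lemma filippov_on_lipschitz:
  assumes "L-lipschitz_on {a..b} g" "finite S"
    "\<And>t. a < t \<Longrightarrow> t < b \<Longrightarrow> t \<notin> S \<Longrightarrow> \<exists>v. v \<in> filippov_map (lienard_field F) (g t) \<and> (g has_vector_derivative v) (at t)"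
  shows "filippov_on F g a b"
  unfolding filippov_on_def
proof (intro conjI exI[of _ S])
  show "absolutely_continuous_fun_on {a..b} g" using assms(1) by (rule lipschitz_imp_absolutely_continuous_fun_on)
  show "negligible S" using assms(2) by (rule negligible_finite)
  show "\<forall>t. a < t \<and> t < b \<and> t \<notin> S \<longrightarrow> (\<exists>v\<in>filippov_map (lienard_field F) (g t). (g has_vector_derivative v) (at t))"
    using assms(3) by auto
qed

text \<open>By forward uniqueness the arc is a time shift of the periodic solution; hence explicit
  arcs reveal points of an otherwise unknown periodic orbit.\<close>

lemma periodic_orbit_follow:
  assumes F: "one_sided_lipschitz L F" and per: "periodic_orbit F \<Gamma>" and p: "p \<in> \<Gamma>"
    and arc: "filippov_arc F p r W"
  shows "W \<subseteq> \<Gamma>"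
proof -
  obtain f where f: "periodic_solution F f" "\<Gamma> = range f" using per by (auto simp: periodic_orbit_def)
  then obtain t0 where t0: "f t0 = p" using p by blast
  obtain g T L S where g: "0 \<le> T" "g 0 = p" "g T = r" "g ` {0..T} = W" "L-lipschitz_on {0..T} g" "finite S"
     "\<And>t. 0 < t \<Longrightarrow> t < T \<Longrightarrow> t \<notin> S \<Longrightarrow> (\<exists>v. v \<in> filippov_map (lienard_field F) (g t) \<and> (g has_vector_derivative v) (at t))"
    using arc by (rule arc_ofE) (rule that)
  have gon: "filippov_on F g 0 T" using filippov_on_lipschitz[OF g(5,6)] g(7) by blast
  have "g t = f (t + t0)" if "t \<in> {0..T}" for t
  proof (rule filippov_unique[OF F, of 0 t g "\<lambda>t. f (t + t0)"])
    show "0 \<le> t" using that by simp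
    show "filippov_on F g 0 t" using filippov_on_subinterval[OF gon] that by simp
    show "filippov_on F (\<lambda>t. f (t + t0)) 0 t"
      using f(1) by (intro filippov_on_shift filippov_solution_imp_on) (simp add: periodic_solution_def)
    show "g 0 = f (0 + t0)" using t0 g(2) by simp
  qed
  then show ?thesis using f(2) g(4) by auto
qed

text \<open>Forward uniqueness is enough here: every point of a periodic orbit also lies in the
  future of the common point p.\<close>

lemma periodic_orbits_eq:
  assumes F: "one_sided_lipschitz L F" and 1: "periodic_orbit F \<Gamma>" and 2: "periodic_orbit F \<Gamma>'"
    and p: "p \<in> \<Gamma>" "p \<in> \<Gamma>'"
  shows "\<Gamma> = \<Gamma>'"
proof -
  have sub: "\<Gamma> \<subseteq> \<Gamma>'" if 1: "periodic_orbit F \<Gamma>" and 2: "periodic_orbit F \<Gamma>'" and p: "p \<in> \<Gamma>" "p \<in> \<Gamma>'" for \<Gamma> \<Gamma>'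
  proof
    fix q assume q: "q \<in> \<Gamma>"
    obtain f where f: "periodic_solution F f" "\<Gamma> = range f" using 1 by (auto simp: periodic_orbit_def)
    obtain g where g: "periodic_solution F g" "\<Gamma>' = range g" using 2 by (auto simp: periodic_orbit_def)
    obtain t0 t1 t2 where t: "f t0 = p" "g t1 = p" "f t2 = q" using p q unfolding f(2) g(2) by (metis imageE)
    obtain T where T: "T > 0" "\<And>t. f (t + T) = f t" using f(1) by (auto simp: periodic_solution_def)
    have Tn: "f (t + real n * T) = f t" for t n
    proof (induction n)
      case (Suc n) 
      have "f (t + real (Suc n) * T) = f ((t + real n * T) + T)" by (simp add: algebra_simps)
      then show ?case using Suc T(2) by simp
    qed simp
    \<comment> \<open>Adding n periods moves the visit of q to a time not before
      \<open>t0\<close>.\<close>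
    obtain n :: nat where n: "(t0 - t2) / T < real n" using reals_Archimedean2 by blast
    define s where "s = t2 + real n * T - t0"
    have s: "s \<ge> 0" using n T(1) by (simp add: s_def field_simps)
    have "f (s + t0) = g (s + t1)"
    proof (rule filippov_unique[OF F s, of "\<lambda>t. f (t + t0)" "\<lambda>t. g (t + t1)"])
      show "filippov_on F (\<lambda>t. f (t + t0)) 0 s" "filippov_on F (\<lambda>t. g (t + t1)) 0 s"
        using f(1) g(1) by (intro filippov_on_shift filippov_solution_imp_on; simp add: periodic_solution_def)+
      show "f (0 + t0) = g (0 + t1)" using t by simp
    qed
    moreover have "f (s + t0) = q" using Tn[of t2 n] t by (simp add: s_def algebra_simps)
    ultimately show "q \<in> \<Gamma>'" using g(2) by (metis rangeI)
  qed
  show ?thesis using sub[OF 1 2 p] sub[OF 2 1 p(2,1)] by blast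
qed

lemma periodic_orbit_compact:
  assumes "periodic_orbit F \<Gamma>" shows "compact \<Gamma>"
proof -
  obtain g where g: "periodic_solution F g" "\<Gamma> = range g" using assms by (auto simp: periodic_orbit_def)
  then obtain T where T: "T > 0" "\<And>t. g (t + T) = g t" by (auto simp: periodic_solution_def)
  have "range g = g ` {0..T}"
  proof (intro equalityI subsetI)
    fix q assume "q \<in> range g"
    then obtain t where t: "q = g t" by blast
    have Tn: "g (t + real n * T) = g t" for t n
    proof (induction n)
      case (Suc n)
      have "g (t + real (Suc n) * T) = g ((t + real n * T) + T)" by (simp add: algebra_simps)
      then show ?case using Suc T(2) by simp
    qed simp
    define s where "s = t - T * of_int \<lfloor>t / T\<rfloor>"
    have "T * of_int \<lfloor>t / T\<rfloor> \<le> t" "t \<le> T * (of_int \<lfloor>t / T\<rfloor> + 1)"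
      using floor_divide_lower[OF T(1), of t] floor_divide_upper[OF T(1), of t] by (simp_all add: mult.commute)
    then have s: "s \<in> {0..T}" by (simp add: s_def algebra_simps)
    have "g s = g t"
    proof (cases "\<lfloor>t / T\<rfloor> \<ge> 0")
      case True
      then show ?thesis using Tn[of s "nat \<lfloor>t / T\<rfloor>"] by (simp add: s_def algebra_simps)
    next
      case False
      then show ?thesis using Tn[of t "nat (- \<lfloor>t / T\<rfloor>)"] by (simp add: s_def algebra_simps)
    qed
    then show "q \<in> g ` {0..T}" using s t by (metis image_eqI)
  qed blast
  moreover have "continuous_on {0..T} g"
    using g(1) unfolding periodic_solution_def filippov_solution_def
    by (intro absolutely_continuous_fun_on_imp_continuous) blast
  ultimately show ?thesis unfolding g(2) by (simp add: compact_continuous_image)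
qed

section \<open>Periodic orbits and limit cycles\<close>

text \<open>The arc is repeated with its duration T as period; \<open>q \<noteq> p\<close> rules out
  a constant solution.\<close>

lemma closed_arc_periodic_orbit:
  assumes arc: "filippov_arc F p p W" and q: "q \<in> W" "q \<noteq> p"
  shows "periodic_orbit F W"
proof -
  obtain g T L S where g: "0 \<le> T" "g 0 = p" "g T = p" "g ` {0..T} = W" "L-lipschitz_on {0..T} g" "finite S"
     "\<And>t. 0 < t \<Longrightarrow> t < T \<Longrightarrow> t \<notin> S \<Longrightarrow> (\<exists>v. v \<in> filippov_map (lienard_field F) (g t) \<and> (g has_vector_derivative v) (at t))"
    using arc by (rule arc_ofE) (rule that)
  have T: "T > 0" using g(1-4) q by (cases "T = 0") auto
  define r where "r t = t - of_int \<lfloor>t / T\<rfloor> * T" for t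
  define h where "h t = g (r t)" for t
  have r: "0 \<le> r t" "r t < T" for t
    using floor_divide_lower[OF T, of t] floor_divide_upper[OF T, of t] by (simp_all add: r_def algebra_simps)
  have hT: "h (t + T) = h t" for t
    using T by (simp add: h_def r_def add_divide_distrib algebra_simps)
  have h0: "h t = g t" if "t \<in> {0..T}" for t
  proof (cases "t = T")
    case True then show ?thesis using T g by (simp add: h_def r_def)
  next
    case False
    then have "\<lfloor>t / T\<rfloor> = 0" using that T by (simp add: floor_eq_iff)
    then show ?thesis by (simp add: h_def r_def)
  qed
  have range: "range h = W"
  proof
    have "r t \<in> {0..T}" for t using r[of t] by simp
    then show "range h \<subseteq> W" unfolding g(4)[symmetric] h_def by blast
    show "W \<subseteq> range h" unfolding g(4)[symmetric] using h0 by (metis image_subsetI rangeI)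
  qed
  have L: "L \<ge> 0" using g(5) lipschitz_on_nonneg by blast
  have lip: "L-lipschitz_on UNIV h"
  proof (rule lipschitz_on_leI[OF _ L])
    fix u v :: real assume uv: "u \<le> v"
    define n where "n = \<lfloor>u / T\<rfloor>"
    define m where "m = \<lfloor>v / T\<rfloor>"
    have nm: "n \<le> m" unfolding n_def m_def using uv T by (intro floor_mono divide_right_mono) auto
    have ru: "r u = u - of_int n * T" and rv: "r v = v - of_int m * T" by (simp_all add: r_def n_def m_def)
    show "dist (h u) (h v) \<le> L * dist u v"
    proof (cases "n = m")
      case True
      have "dist (g (r u)) (g (r v)) \<le> L * dist (r u) (r v)"
        using r less_imp_le by (intro lipschitz_onD[OF g(5)]) auto
      then show ?thesis using True by (simp add: h_def ru rv dist_real_def)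
    next
      case False
      then have "of_int n + 1 \<le> (of_int m :: real)" using nm by linarith
      then have "(of_int n + 1) * T \<le> of_int m * T" using T by (intro mult_right_mono) auto
      \<comment> \<open>Times in different periods are compared via the junction
        \<open>g T = g 0\<close>; the two remaining stretches together last at most
        \<open>v - u\<close>, so the constant L survives.\<close>
      then have le: "(T - r u) + r v \<le> v - u" by (simp add: ru rv algebra_simps)
      have "dist (g (r u)) (g T) \<le> L * dist (r u) T" "dist (g 0) (g (r v)) \<le> L * dist 0 (r v)"
        using r[of u] r[of v] T by (intro lipschitz_onD[OF g(5)]; simp)+
      then have "dist (g (r u)) (g (r v)) \<le> L * dist (r u) T + L * dist 0 (r v)"
        using dist_triangle[of "g (r u)" "g (r v)" "g T"] g(2,3) by simp
      also have "\<dots> = L * ((T - r u) + r v)" using r[of u] r[of v] by (simp add: dist_real_def algebra_simps)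
      also have "\<dots> \<le> L * (v - u)" using le L by (rule mult_left_mono)
      finally show ?thesis using uv by (simp add: h_def dist_real_def)
    qed
  qed
  \<comment> \<open>All period translates of the exceptional times, with 0 added for the junction;
    they remain countable.\<close>
  define N where "N = (\<Union>n::int. (\<lambda>s. s + of_int n * T) ` insert 0 S)"
  have "negligible N" unfolding N_def using g(6)
    by (intro negligible_countable_Union) (auto intro!: negligible_finite)
  have der: "\<exists>v\<in>filippov_map (lienard_field F) (h t). (h has_vector_derivative v) (at t)" if t: "t \<notin> N" for t
  proof -
    define n where "n = \<lfloor>t / T\<rfloor>"
    have rt: "r t = t - of_int n * T" by (simp add: r_def n_def)
    have "r t \<notin> insert 0 S"
    proof
      assume *: "r t \<in> insert 0 S"
      have "t = r t + of_int n * T" by (simp add: rt)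
      then have "t \<in> (\<lambda>s. s + of_int n * T) ` insert 0 S" using * by (rule image_eqI)
      then show False using t by (auto simp: N_def)
    qed
    then have "0 < r t" "r t < T" "r t \<notin> S" using r[of t] by (auto simp: less_le)
    then obtain v where v: "v \<in> filippov_map (lienard_field F) (g (r t))" "(g has_vector_derivative v) (at (r t))"
      using g(7) by blast
    have "((\<lambda>u. g (u + - (of_int n * T))) has_vector_derivative v) (at t)"
      by (rule has_vector_derivative_shift_arg) (use v(2) rt in simp)
    then have "(h has_vector_derivative v) (at t)"
    proof (rule has_vector_derivative_transform_within_open)
      show "open {of_int n * T<..<of_int n * T + T}" by simp
      show "t \<in> {of_int n * T<..<of_int n * T + T}" using \<open>0 < r t\<close> \<open>r t < T\<close> by (simp add: rt)
      fix u assume u: "u \<in> {of_int n * T<..<of_int n * T + T}"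
      then have "of_int n < u / T" "u / T < of_int n + 1" using T by (simp_all add: field_simps)
      then have "\<lfloor>u / T\<rfloor> = n" by linarith
      then show "g (u + - (of_int n * T)) = h u" by (simp add: h_def r_def)
    qed
    then show ?thesis using v(1) by (auto simp: h_def)
  qed
  have "filippov_solution (lienard_field F) h"
    unfolding filippov_solution_def
  proof (intro conjI allI)
    show "absolutely_continuous_fun_on {s..t} h" for s t
      by (rule lipschitz_imp_absolutely_continuous_fun_on[OF lipschitz_on_subset[OF lip]]) simp
    show "AE t in lebesgue. \<exists>v\<in>filippov_map (lienard_field F) (h t). (h has_vector_derivative v) (at t)"
      using \<open>negligible N\<close> der unfolding negligible_iff_null_sets by (intro AE_I'[of N]) auto
  qed
  moreover have "\<exists>s t. h s \<noteq> h t" using q range arc_of_image(3)[OF arc] by (metis imageE)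
  ultimately have "periodic_solution F h" unfolding periodic_solution_def using T hT by blast
  then show ?thesis using range unfolding periodic_orbit_def by blast
qed

section \<open>Locality: changing F to the right of a vertical line\<close>

lemma filippov_map_cong:
  assumes "open U" "p \<in> U" "\<And>q. q \<in> U \<Longrightarrow> f q = g q"
  shows "filippov_map f p = filippov_map g p"
proof -
  have "filippov_map f p \<subseteq> filippov_map g p" if U: "open U" "p \<in> U" "\<And>q. q \<in> U \<Longrightarrow> f q = g q" for f g
  proof
    fix v assume v: "v \<in> filippov_map f p"
    obtain r where r: "r > 0" "ball p r \<subseteq> U" using U openE by blast
    show "v \<in> filippov_map g p" unfolding filippov_map_def
    proof (intro INT_I)
      fix d :: real and N :: "'a set" assume "d \<in> {0<..}" "N \<in> null_sets lebesgue"
      \<comment> \<open>Shrinking the radius to \<open>min r d\<close> keeps the ball inside U; v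
        lies in the closed hulls for all radii, so the smaller one may be used.\<close>
      then have "v \<in> closure (convex hull (f ` (ball p (min r d) - N)))"
        using v r(1) by (simp add: filippov_map_def)
      also have "f ` (ball p (min r d) - N) = g ` (ball p (min r d) - N)"
        using U(3) r(2) by (intro image_cong) auto
      also have "closure (convex hull \<dots>) \<subseteq> closure (convex hull (g ` (ball p d - N)))"
        by (intro closure_mono hull_mono image_mono) auto
      finally show "v \<in> closure (convex hull (g ` (ball p d - N)))" .
    qed
  qed
  then show ?thesis using assms by (intro subset_antisym) simp_all
qed

lemma filippov_map_lienard_cong:
  assumes "\<And>x. x < b \<Longrightarrow> F x = G x" "fst q < b"
  shows "filippov_map (lienard_field F) q = filippov_map (lienard_field G) q"
proof (rule filippov_map_cong[of "{q. fst q < b}"])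
  show "open {q::real\<times>real. fst q < b}" by (intro open_Collect_less continuous_intros)
qed (use assms in \<open>auto simp: lienard_field_def\<close>)

lemma left_lim_eqI: "(F \<longlongrightarrow> l) (at_left p) \<Longrightarrow> left_lim F (p::real) = l"
  unfolding left_lim_def by (rule tendsto_Lim) simp_all

lemma right_lim_eqI: "(F \<longlongrightarrow> l) (at_right p) \<Longrightarrow> right_lim F (p::real) = l"
  unfolding right_lim_def by (rule tendsto_Lim) simp_all

lemma lim_cong_below:
  assumes "\<And>x. x < b \<Longrightarrow> F x = G x" "p < b"
  shows "left_lim F p = left_lim G p" "right_lim F p = right_lim G p"
proof -
  have nh: "\<forall>\<^sub>F x in nhds p. F x = G x"
    using eventually_nhds_in_open[of "{..<b}" p] assms by (auto elim: eventually_mono)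
  have ev: "\<forall>\<^sub>F x in at_left p. F x = G x" "\<forall>\<^sub>F x in at_right p. F x = G x"
    using nh by (auto simp: eventually_at_filter elim: eventually_mono)
  show "left_lim F p = left_lim G p"
    unfolding left_lim_def t2_space_class.Lim_def using tendsto_cong[OF ev(1)] by simp
  show "right_lim F p = right_lim G p"
    unfolding right_lim_def t2_space_class.Lim_def using tendsto_cong[OF ev(2)] by simp
qed

lemma periodic_solution_cong_below:
  assumes "\<And>x. x < b \<Longrightarrow> F x = G x" "\<And>t. fst (g t) < b" "periodic_solution F g"
  shows "periodic_solution G g"
proof -
  have "filippov_map (lienard_field F) (g t) = filippov_map (lienard_field G) (g t)" for t
    using assms(1,2) by (rule filippov_map_lienard_cong)
  then show ?thesis using assms(3) by (simp add: periodic_solution_def filippov_solution_def)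
qed

lemma periodic_orbit_cong_below:
  assumes "\<And>x. x < b \<Longrightarrow> F x = G x" "\<Gamma> \<subseteq> {q. fst q < b}" "periodic_orbit F \<Gamma>"
  shows "periodic_orbit G \<Gamma>"
proof -
  obtain g where "periodic_solution F g" "\<Gamma> = range g" using assms(3) by (auto simp: periodic_orbit_def)
  moreover from this have "periodic_solution G g"
    using assms(1,2) by (intro periodic_solution_cong_below[of b F G g]) auto
  ultimately show ?thesis by (auto simp: periodic_orbit_def)
qed

text \<open>The isolating neighbourhood is cut down to the half plane left of b. A periodic orbit of
  G inside it is a periodic orbit of F, so the old isolation still decides.\<close>

lemma crossing_limit_cycle_extend:
  assumes FG: "\<And>x. x < b \<Longrightarrow> F x = G x" and \<Gamma>: "\<Gamma> \<subseteq> {q. fst q < b}" and P: "P \<subseteq> {..<b}"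
    and cyc: "crossing_limit_cycle F P \<Gamma>"
  shows "crossing_limit_cycle G (insert b P) \<Gamma>"
proof -
  have cs: "(x, y) \<in> crossing_set G (insert b P) \<longleftrightarrow> (x, y) \<in> crossing_set F P" if "x < b" for x y
    using that lim_cong_below[OF FG that] by (auto simp: crossing_set_def)
  have "periodic_orbit G \<Gamma>" using FG \<Gamma> cyc by (auto simp: crossing_limit_cycle_def intro: periodic_orbit_cong_below)
  moreover have "has_crossing G (insert b P) \<Gamma>"
    using cyc cs \<Gamma> unfolding crossing_limit_cycle_def has_crossing_def by fastforce
  moreover have "\<Gamma> \<inter> switching_lines (insert b P) \<subseteq> crossing_set G (insert b P)"
    using cyc cs \<Gamma> unfolding crossing_limit_cycle_def switching_lines_def by fastforce
  moreover have "\<exists>U. open U \<and> \<Gamma> \<subseteq> U \<and> (\<forall>\<Gamma>'. periodic_orbit G \<Gamma>' \<and> \<Gamma>' \<noteq> \<Gamma> \<longrightarrow> \<not> \<Gamma>' \<subseteq> U)"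
  proof -
    obtain U where U: "open U" "\<Gamma> \<subseteq> U" "\<And>\<Gamma>'. periodic_orbit F \<Gamma>' \<Longrightarrow> \<Gamma>' \<noteq> \<Gamma> \<Longrightarrow> \<not> \<Gamma>' \<subseteq> U"
      using cyc by (auto simp: crossing_limit_cycle_def)
    have "open {q::real\<times>real. fst q < b}" by (intro open_Collect_less continuous_intros)
    then have "open (U \<inter> {q. fst q < b})" using U(1) by blast
    moreover have "\<not> \<Gamma>' \<subseteq> U \<inter> {q. fst q < b}" if "periodic_orbit G \<Gamma>'" "\<Gamma>' \<noteq> \<Gamma>" for \<Gamma>'
    proof
      assume *: "\<Gamma>' \<subseteq> U \<inter> {q. fst q < b}"
      then have "periodic_orbit F \<Gamma>'" using that(1) FG by (intro periodic_orbit_cong_below[of b G F]) auto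
      then show False using U(3) that(2) * by blast
    qed
    ultimately show ?thesis using U(2) \<Gamma> by blast
  qed
  ultimately show ?thesis unfolding crossing_limit_cycle_def by blast
qed

text \<open>Only the presence of sliding is carried along. Isolation of sliding orbits is recovered
  for the final system by \<open>sliding_periodic_orbit_limit_cycle\<close>.\<close>

lemma has_sliding_extend:
  assumes FG: "\<And>x. x < b \<Longrightarrow> F x = G x" and P: "P \<subseteq> {..<b}" and sl: "has_sliding F P \<Gamma>"
  shows "has_sliding G (insert b P) \<Gamma>"
proof -
  have "sliding_set F P \<subseteq> sliding_set G (insert b P)"
    using P lim_cong_below[OF FG] by (fastforce simp: sliding_set_def)
  then have "sliding_part F P \<Gamma> \<subseteq> sliding_part G (insert b P) \<Gamma>"
    unfolding sliding_part_def by (intro Union_mono Collect_mono) (blast intro: order_trans)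
  then show ?thesis using sl by (auto simp: has_sliding_def)
qed

lemma has_slidingE:
  assumes "has_sliding F P \<Gamma>"
  obtains p c d where "c < d" "{p} \<times> {c<..<d} \<subseteq> \<Gamma> \<inter> sliding_set F P"
proof -
  have "\<exists>A. A \<in> {{p} \<times> {c<..<d} |p c d. c < d \<and> {p} \<times> {c<..<d} \<subseteq> \<Gamma> \<inter> sliding_set F P}"
    using assms unfolding has_sliding_def sliding_part_def by (metis (no_types, lifting) Union_empty_conv ex_in_conv)
  then show thesis using that by blast
qed

text \<open>For the count of cycles: the midpoint of a sliding segment would have to lie in the
  crossing set as well, so crossing and sliding cycles are never the same orbit.\<close>

lemma crossing_limit_cycle_not_sliding:
  assumes "crossing_limit_cycle F P \<Gamma>" shows "\<not> has_sliding F P \<Gamma>"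
proof
  assume "has_sliding F P \<Gamma>"
  then obtain p c d where *: "c < d" "{p} \<times> {c<..<d} \<subseteq> \<Gamma> \<inter> sliding_set F P"
    by (rule has_slidingE)
  then have "(p, (c + d) / 2) \<in> \<Gamma> \<inter> sliding_set F P" by auto
  moreover from this have "(p, (c + d) / 2) \<in> crossing_set F P"
    using assms unfolding crossing_limit_cycle_def switching_lines_def sliding_set_def by fastforce
  ultimately show False by (auto simp: sliding_set_def crossing_set_def)
qed

text \<open>All jumps are downward, so that the system is one-sided Lipschitz and sliding is attracting.\<close>

definition downward_system :: "(real \<Rightarrow> real) \<Rightarrow> real set \<Rightarrow> bool" where
  "downward_system F P \<longleftrightarrow> finite P \<and> P \<subseteq> {0<..} \<and> (\<exists>L. one_sided_lipschitz L F) \<and>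
     (\<forall>x. x \<notin> P \<longrightarrow> isCont F x) \<and> (\<forall>x\<le>0. F x = x) \<and>
     (\<forall>p\<in>P. (F \<longlongrightarrow> left_lim F p) (at_left p) \<and> (F \<longlongrightarrow> right_lim F p) (at_right p) \<and>
        right_lim F p \<le> left_lim F p)"

lemma downward_systemE:
  assumes "downward_system F P" obtains L where "one_sided_lipschitz L F"
  using assms by (auto simp: downward_system_def)

section \<open>Attracting sliding segments\<close>

lemma lienard_tendsto_at_half:
  assumes "(F \<longlongrightarrow> l) (at p within A)" "\<And>e. e > 0 \<Longrightarrow> \<exists>a\<in>A. \<bar>a - p\<bar> < e" "open A"
  shows "(l - y, p) \<in> filippov_map (lienard_field F) (p, y)"
\<comment> \<open>The abscissa p is removed, because the limit says nothing about the value of F at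
  p.\<close>
proof (rule filippov_map_memI[of "(A - {p}) \<times> UNIV"])
  show "open ((A - {p}) \<times> (UNIV :: real set))" using assms(3) by (intro open_Times) auto
  show "ball (p, y) r \<inter> ((A - {p}) \<times> UNIV) \<noteq> {}" if r: "r > 0" for r
  proof -
    obtain a where a: "a \<in> A" "\<bar>a - p\<bar> < r" using assms(2) r by blast
    have "\<exists>a'. a' \<in> A - {p} \<and> \<bar>a' - p\<bar> < r"
    proof (cases "a = p")
      case True
      then obtain e where e: "e > 0" "ball p e \<subseteq> A" using a assms(3) openE by blast
      then have "p + min e r / 2 \<in> A" using r by (auto simp: dist_real_def min_def)
      then show ?thesis using e r by (intro exI[of _ "p + min e r / 2"]) (auto simp: min_def)
    qed (use a in auto)
    then obtain a' where "a' \<in> A - {p}" "\<bar>a' - p\<bar> < r" by blast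
    then have "(a', y) \<in> ball (p, y) r \<inter> ((A - {p}) \<times> UNIV)" by (simp add: dist_prod_def dist_real_def abs_minus_commute)
    then show ?thesis by blast
  qed
  have f: "filterlim fst (at p within A) (at (p, y) within (A - {p}) \<times> UNIV)"
    unfolding filterlim_at
  proof
    show "(fst \<longlongrightarrow> p) (at (p, y) within (A - {p}) \<times> UNIV)" by (auto intro!: tendsto_eq_intros)
    show "\<forall>\<^sub>F x in at (p, y) within (A - {p}) \<times> UNIV. fst x \<in> A \<and> fst x \<noteq> p"
      unfolding eventually_at_filter by (rule always_eventually) auto
  qed
  have "((\<lambda>q. F (fst q)) \<longlongrightarrow> l) (at (p, y) within (A - {p}) \<times> UNIV)"
    using filterlim_compose[OF assms(1) f] .
  then have "((\<lambda>q. (F (fst q) - snd q, fst q)) \<longlongrightarrow> (l - y, p)) (at (p, y) within (A - {p}) \<times> UNIV)"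
    by (auto intro!: tendsto_eq_intros)
  then show "(lienard_field F \<longlongrightarrow> (l - y, p)) (at (p, y) within (A - {p}) \<times> UNIV)"
    by (simp add: lienard_field_def case_prod_unfold)
qed

text \<open>The velocities on the two sides have first components \<open>l - y > 0 > r - y\<close>
  and the same second component p. The weight \<open>(y - r) / (l - r)\<close> is the one that makes
  the first component vanish.\<close>

lemma sliding_vector:
  assumes l: "(F \<longlongrightarrow> l) (at_left p)" and r: "(F \<longlongrightarrow> r) (at_right p)" and y: "r < y" "y < l"
  shows "(0, p) \<in> filippov_map (lienard_field F) (p, y)"
proof -
  have 1: "(l - y, p) \<in> filippov_map (lienard_field F) (p, y)"
  proof (rule lienard_tendsto_at_half[OF l])
    show "\<exists>a\<in>{..<p}. \<bar>a - p\<bar> < e" if "e > 0" for e using that by (intro bexI[of _ "p - e/2"]) auto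
  qed auto
  have 2: "(r - y, p) \<in> filippov_map (lienard_field F) (p, y)"
  proof (rule lienard_tendsto_at_half[OF r])
    show "\<exists>a\<in>{p<..}. \<bar>a - p\<bar> < e" if "e > 0" for e using that by (intro bexI[of _ "p + e/2"]) auto
  qed auto
  define a where "a = (y - r) / (l - r)"
  have a: "0 \<le> a" "0 \<le> 1 - a" using y by (simp_all add: a_def divide_le_eq)
  have "a * (l - r) = y - r" using y by (simp add: a_def)
  then have "a * (l - y) + (1 - a) * (r - y) = 0" by (simp add: algebra_simps)
  moreover have "a * p + (1 - a) * p = p" by (simp add: algebra_simps)
  moreover have "a *\<^sub>R (l - y, p) + (1 - a) *\<^sub>R (r - y, p) \<in> filippov_map (lienard_field F) (p, y)"
    using convexD[OF convex_filippov_map 1 2 a] by simp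
  ultimately show ?thesis by simp
qed

lemma sliding_arc:
  assumes p: "p > 0" and l: "(F \<longlongrightarrow> l) (at_left p)" and r: "(F \<longlongrightarrow> r) (at_right p)"
    and y: "r < y" "y \<le> y'" "y' \<le> l"
  shows "filippov_arc F (p, y) (p, y') ({p} \<times> {y..y'})"
proof (rule arc_ofI[where g = "\<lambda>t. (p, y + p * t)" and T = "(y' - y) / p" and L = "\<bar>p\<bar>" and S = "{}"])
  show "(\<lambda>t. (p, y + p * t)) ` {0..(y' - y) / p} = {p} \<times> {y..y'}"
  proof (intro equalityI subsetI)
    fix q assume "q \<in> {p} \<times> {y..y'}"
    then have "q = (p, y + p * ((snd q - y) / p))" "(snd q - y) / p \<in> {0..(y' - y) / p}"
      using p by (auto simp: divide_right_mono)
    then show "q \<in> (\<lambda>t. (p, y + p * t)) ` {0..(y' - y) / p}" by (metis (no_types, lifting) image_eqI)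
  qed (use p in \<open>auto simp: field_simps\<close>)
  show "\<bar>p\<bar>-lipschitz_on {0..(y' - y) / p} (\<lambda>t. (p, y + p * t))"
  proof (rule lipschitz_onI)
    fix s t
    have "p * s - p * t = p * (s - t)" by (simp add: algebra_simps)
    then show "dist (p, y + p * s) (p, y + p * t) \<le> \<bar>p\<bar> * dist s t" by (simp add: dist_prod_def dist_real_def abs_mult)
  qed simp
  fix t assume t: "0 < t" "t < (y' - y) / p"
  then have "p * t < y' - y" "0 < p * t" using p by (simp_all add: field_simps)
  then have "(0, p) \<in> filippov_map (lienard_field F) (p, y + p * t)" using y by (intro sliding_vector[OF l r]) auto
  moreover have "((\<lambda>t. (p, y + p * t)) has_vector_derivative (0, p)) (at t)"
    by (rule derivative_eq_intros has_vector_derivative_Pair refl | simp)+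
  ultimately show "\<exists>v. v \<in> filippov_map (lienard_field F) (p, y + p * t) \<and>
      ((\<lambda>t. (p, y + p * t)) has_vector_derivative v) (at t)" by blast
qed (use p y in auto)

text \<open>By forward uniqueness an orbit on a sliding segment must slide up to its top
  \<open>(p, left_lim F p)\<close>. Assigning p to the orbit is therefore injective into the finite
  set P.\<close>

lemma finite_sliding_periodic_orbits:
  assumes ds: "downward_system F P"
  shows "finite {\<Gamma>. periodic_orbit F \<Gamma> \<and> has_sliding F P \<Gamma>}" (is "finite ?S")
proof -
  obtain L where L: "one_sided_lipschitz L F" using ds by (rule downward_systemE)
  have ex: "\<exists>p\<in>P. (p, left_lim F p) \<in> \<Gamma>" if "\<Gamma> \<in> ?S" for \<Gamma>
  proof -
    have per: "periodic_orbit F \<Gamma>" using that by blast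
    have "has_sliding F P \<Gamma>" using that by blast
    then obtain p c d where *: "c < d" "{p} \<times> {c<..<d} \<subseteq> \<Gamma> \<inter> sliding_set F P"
      by (rule has_slidingE)
    define y where "y = (c + d) / 2"
    have y: "(p, y) \<in> \<Gamma> \<inter> sliding_set F P" using * by (auto simp: y_def)
    then have p: "p \<in> P" by (auto simp: sliding_set_def)
    have F: "(F \<longlongrightarrow> left_lim F p) (at_left p)" "(F \<longlongrightarrow> right_lim F p) (at_right p)" "right_lim F p \<le> left_lim F p" "p > 0"
      using ds p by (auto simp: downward_system_def)
    have "right_lim F p < y" "y < left_lim F p" using y F(3) by (auto simp: sliding_set_def)
    then have "filippov_arc F (p, y) (p, left_lim F p) ({p} \<times> {y..left_lim F p})"
      by (intro sliding_arc[OF F(4,1,2)]) auto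
    then have "{p} \<times> {y..left_lim F p} \<subseteq> \<Gamma>" using periodic_orbit_follow[OF L per] y by blast
    moreover have "(p, left_lim F p) \<in> {p} \<times> {y..left_lim F p}" using \<open>y < left_lim F p\<close> by simp
    ultimately show ?thesis using p by blast
  qed
  then obtain f where f: "\<And>\<Gamma>. \<Gamma> \<in> ?S \<Longrightarrow> f \<Gamma> \<in> P \<and> (f \<Gamma>, left_lim F (f \<Gamma>)) \<in> \<Gamma>" by metis
  have "inj_on f ?S"
    by (rule inj_onI) (metis (mono_tags, lifting) f mem_Collect_eq periodic_orbits_eq[OF L])
  moreover have "f ` ?S \<subseteq> P" using f by blast
  moreover have "finite P" using ds by (simp add: downward_system_def)
  ultimately show ?thesis using finite_imageD finite_subset by blast
qed

text \<open>The other sliding periodic orbits are finitely many compact sets disjoint from \<Gamma>,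
  so the complement of their union is the required neighbourhood.\<close>

lemma sliding_periodic_orbit_limit_cycle:
  assumes ds: "downward_system F P" and \<Gamma>: "periodic_orbit F \<Gamma>" "has_sliding F P \<Gamma>"
  shows "sliding_limit_cycle F P \<Gamma>"
  unfolding sliding_limit_cycle_def
proof (intro conjI \<Gamma>)
  obtain L where L: "one_sided_lipschitz L F" using ds by (rule downward_systemE)
  let ?S = "{\<Gamma>. periodic_orbit F \<Gamma> \<and> has_sliding F P \<Gamma>} - {\<Gamma>}"
  have "closed (\<Union>?S)"
    using finite_sliding_periodic_orbits[OF ds] by (intro closed_Union) (auto intro: compact_imp_closed periodic_orbit_compact)
  moreover have "\<Gamma> \<inter> \<Union>?S = {}" using periodic_orbits_eq[OF L \<Gamma>(1)] by blast
  moreover have "\<not> contains_nonsliding_arc F P (- \<Union>?S) \<Gamma>'" if "periodic_orbit F \<Gamma>' \<and> has_sliding F P \<Gamma>' \<and> \<Gamma>' \<noteq> \<Gamma>" for \<Gamma>'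
  proof
    assume "contains_nonsliding_arc F P (- \<Union>?S) \<Gamma>'"
    then obtain g s t where *: "periodic_solution F g" "\<Gamma>' = range g" "s < t" "g ` {s..t} \<subseteq> - \<Union>?S - sliding_set F P"
      unfolding contains_nonsliding_arc_def by (elim exE conjE) (rule that)
    have "g s \<in> g ` {s..t}" using *(3) by simp
    then have "g s \<notin> \<Union>?S" using *(4) by blast
    moreover have "g s \<in> \<Gamma>'" using *(2) by simp
    moreover have "\<Gamma>' \<in> ?S" using that by simp
    ultimately show False by blast
  qed
  ultimately show "\<exists>U. open U \<and> \<Gamma> - sliding_part F P \<Gamma> \<subseteq> U \<and>
        (\<forall>\<Gamma>'. periodic_orbit F \<Gamma>' \<and> has_sliding F P \<Gamma>' \<and> \<Gamma>' \<noteq> \<Gamma> \<longrightarrow> \<not> contains_nonsliding_arc F P U \<Gamma>')"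
    by (intro exI[of _ "- \<Union>?S"]) (auto simp: open_Compl)
qed

section \<open>Linear zones\<close>

text \<open>In a zone \<open>F x = c + 2 cos \<theta> x\<close> the first coordinate solves
  \<open>x'' - 2 cos \<theta> x' + x = 0\<close>; \<open>zone_cos\<close> and \<open>zone_sin\<close> are the solutions with
  initial values \<open>(x, x') = (1, 0)\<close> and \<open>(0, 1)\<close>.\<close>

definition zone_sin :: "real \<Rightarrow> real \<Rightarrow> real" where
  "zone_sin \<theta> t = exp (t * cos \<theta>) * sin (t * sin \<theta>) / sin \<theta>"

definition zone_cos :: "real \<Rightarrow> real \<Rightarrow> real" where
  "zone_cos \<theta> t = exp (t * cos \<theta>) * sin (\<theta> - t * sin \<theta>) / sin \<theta>"

lemma zone_0 [simp]: "zone_sin \<theta> 0 = 0" "0 < \<theta> \<Longrightarrow> \<theta> < pi \<Longrightarrow> zone_cos \<theta> 0 = 1"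
  using sin_gt_zero[of \<theta>] by (simp_all add: zone_sin_def zone_cos_def)

text \<open>The parameter covers the slopes \<open>2 * cos \<theta>\<close> strictly between -2 and
  2: the characteristic roots are exp(i \<theta>) and exp(-i \<theta>), so orbits rotate with
  angular speed sin \<theta>.\<close>

locale zone =
  fixes \<theta> :: real
  assumes \<theta>: "0 < \<theta>" "\<theta> < pi"
begin

abbreviation "S \<equiv> zone_sin \<theta>"
abbreviation "C \<equiv> zone_cos \<theta>"
abbreviation "\<sigma> \<equiv> 2 * cos \<theta>"
text \<open>\<open>h\<close> is the first positive zero of S, the duration of half a turn;
  \<open>t0\<close> is the first positive zero of C, the time from the nullcline to x = 0.\<close>

abbreviation "h \<equiv> pi / sin \<theta>"
abbreviation "t0 \<equiv> \<theta> / sin \<theta>"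

lemma sin_pos: "sin \<theta> > 0" using \<theta> by (rule sin_gt_zero)

lemma t0: "0 < t0" "t0 < h" "0 < h"
  using \<theta> sin_pos by (simp_all add: divide_strict_right_mono)

lemma S_deriv: "(S has_real_derivative C t + \<sigma> * S t) (at t)"
proof -
  have "(S has_real_derivative exp (t * cos \<theta>) * (cos \<theta> * sin (t * sin \<theta>) + cos (t * sin \<theta>) * sin \<theta>) / sin \<theta>) (at t)"
    unfolding zone_sin_def[abs_def] using sin_pos by (auto intro!: derivative_eq_intros simp: field_simps)
  moreover have "exp (t * cos \<theta>) * (cos \<theta> * sin (t * sin \<theta>) + cos (t * sin \<theta>) * sin \<theta>) / sin \<theta> = C t + \<sigma> * S t"
    using sin_pos by (simp add: zone_sin_def zone_cos_def sin_diff field_simps)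
  ultimately show ?thesis by simp
qed

lemma C_deriv: "(C has_real_derivative - S t) (at t)"
proof -
  have "(C has_real_derivative exp (t * cos \<theta>) * (cos \<theta> * sin (\<theta> - t * sin \<theta>) - cos (\<theta> - t * sin \<theta>) * sin \<theta>) / sin \<theta>) (at t)"
    unfolding zone_cos_def[abs_def] using sin_pos by (auto intro!: derivative_eq_intros simp: field_simps)
  moreover have "cos \<theta> * sin (\<theta> - t * sin \<theta>) - cos (\<theta> - t * sin \<theta>) * sin \<theta> = - sin (t * sin \<theta>)"
    using sin_diff[of "\<theta> - t * sin \<theta>" \<theta>] by (simp add: mult.commute)
  ultimately show ?thesis by (simp add: zone_sin_def)
qed

text \<open>Liouville's formula: the left side is the determinant of the fundamental matrix, since
  \<open>S' = C + \<sigma> S\<close> and \<open>C' = - S\<close>, and the trace of the zone is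
  \<open>2 * cos \<theta>\<close>.\<close>

lemma wronskian: "C t * (C t + \<sigma> * S t) + (S t)\<^sup>2 = exp (2 * t * cos \<theta>)"
proof -
  let ?u = "t * sin \<theta>"
  have e: "exp (t * cos \<theta>) * exp (t * cos \<theta>) = exp (2 * t * cos \<theta>)" by (simp add: exp_add[symmetric])
  have "sin (\<theta> - ?u) * (sin (\<theta> - ?u) + 2 * cos \<theta> * sin ?u) + (sin ?u)\<^sup>2
     = (sin \<theta>)\<^sup>2 * (cos ?u)\<^sup>2 - (cos \<theta>)\<^sup>2 * (sin ?u)\<^sup>2 + (sin ?u)\<^sup>2"
    by (simp add: sin_diff power2_eq_square algebra_simps)
  also have "\<dots> = (sin \<theta>)\<^sup>2"
    by (simp add: cos_squared_eq algebra_simps)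
  finally have *: "sin (\<theta> - ?u) * (sin (\<theta> - ?u) + 2 * cos \<theta> * sin ?u) + (sin ?u)\<^sup>2 = (sin \<theta>)\<^sup>2" .
  have "C t * (C t + \<sigma> * S t) + (S t)\<^sup>2 =
     exp (t * cos \<theta>) * exp (t * cos \<theta>) * (sin (\<theta> - ?u) * (sin (\<theta> - ?u) + 2 * cos \<theta> * sin ?u) + (sin ?u)\<^sup>2) / (sin \<theta>)\<^sup>2"
    using sin_pos by (simp add: zone_sin_def zone_cos_def power2_eq_square field_simps)
  then show ?thesis using * e sin_pos by simp
qed

lemma S_pos: "0 < t \<Longrightarrow> t < h \<Longrightarrow> S t > 0"
  using sin_pos sin_gt_zero[of "t * sin \<theta>"] by (simp add: zone_sin_def pos_less_divide_eq)

lemma at_h: "S h = 0" "C h = - exp (pi * cos \<theta> / sin \<theta>)"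
  using sin_pos by (simp_all add: zone_sin_def zone_cos_def sin_diff field_simps)

lemma C_t0: "C t0 = 0"
  using sin_pos by (simp add: zone_cos_def)

lemma S_t0: "S t0 = exp (\<theta> * cos \<theta> / sin \<theta>)"
  using sin_pos by (simp add: zone_sin_def)

lemma isCont_S [simp, continuous_intros]: "isCont S t" and isCont_C [simp, continuous_intros]: "isCont C t"
  using DERIV_isCont[OF S_deriv] DERIV_isCont[OF C_deriv] by auto

lemma continuous_on_S: "continuous_on A S" and continuous_on_C: "continuous_on A C"
  by (auto intro: continuous_at_imp_continuous_on)

lemma C_decreasing: "0 \<le> s \<Longrightarrow> s < t \<Longrightarrow> t \<le> h \<Longrightarrow> C t < C s"
proof (rule DERIV_neg_imp_decreasing_open[of s t])
  fix u assume *: "0 \<le> s" "s < t" "t \<le> h" "s < u" "u < t"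
  then show "\<exists>y. (C has_real_derivative y) (at u) \<and> y < 0"
    using C_deriv[of u] S_pos[of u] by (intro exI[of _ "- S u"]) auto
qed (auto intro: continuous_on_C)

lemma C_pos: "0 \<le> t \<Longrightarrow> t < t0 \<Longrightarrow> C t > 0"
  using C_decreasing[of t t0] t0 C_t0 by simp

text \<open>Divided by the exponential, the left side is \<open>zone_cos (pi - \<theta>)\<close>,
  the cosine solution of the reversed flow, which decreases from 1 on \<open>[0, h]\<close>.
  Together with \<open>0 \<le> p < q\<close> this fixes the sign of the derivative of
  \<open>strip_in\<close>.\<close>

lemma dS_le: 
  assumes t: "0 \<le> t" "t \<le> h"
  shows "C t + \<sigma> * S t \<le> exp (2 * t * cos \<theta>)"
proof -
  define k where "k s = exp (- s * cos \<theta>) * sin (\<theta> + s * sin \<theta>)" for s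
  have kd: "(k has_real_derivative - exp (- s * cos \<theta>) * sin (s * sin \<theta>)) (at s)" for s
  proof -
    have "(k has_real_derivative exp (- s * cos \<theta>) * (cos (\<theta> + s * sin \<theta>) * sin \<theta> - cos \<theta> * sin (\<theta> + s * sin \<theta>))) (at s)"
      unfolding k_def[abs_def] by (auto intro!: derivative_eq_intros simp: algebra_simps)
    moreover have "cos (\<theta> + s * sin \<theta>) * sin \<theta> - cos \<theta> * sin (\<theta> + s * sin \<theta>) = - sin (s * sin \<theta>)"
      using sin_diff[of \<theta> "\<theta> + s * sin \<theta>"] by (simp add: mult.commute)
    ultimately show ?thesis by simp
  qed
  have "k t \<le> k 0"
  proof (rule DERIV_nonpos_imp_nonincreasing[OF t(1)])
    fix s assume s: "0 \<le> s" "s \<le> t"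
    then have "s \<le> h" using t by simp
    then have "s * sin \<theta> \<le> pi" using sin_pos by (simp add: pos_le_divide_eq)
    then have "sin (s * sin \<theta>) \<ge> 0" using s sin_pos by (intro sin_ge_zero) auto
    then show "\<exists>y. (k has_real_derivative y) (at s) \<and> y \<le> 0"
      using kd[of s] by (intro exI[of _ "- exp (- s * cos \<theta>) * sin (s * sin \<theta>)"]) (auto intro: mult_nonpos_nonneg)
  qed
  then have "exp (2 * t * cos \<theta>) * k t \<le> exp (2 * t * cos \<theta>) * sin \<theta>" by (simp add: k_def)
  moreover have "exp (2 * t * cos \<theta>) * k t = exp (t * cos \<theta>) * sin (\<theta> + t * sin \<theta>)"
    by (simp add: k_def exp_add[symmetric] mult.assoc[symmetric])
  moreover have "exp (t * cos \<theta>) * sin (\<theta> + t * sin \<theta>) = (C t + \<sigma> * S t) * sin \<theta>"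
    using sin_pos by (simp add: zone_sin_def zone_cos_def sin_diff sin_add field_simps)
  ultimately show ?thesis using sin_pos by simp
qed

text \<open>Y is \<open>c + \<sigma> X - X'\<close>, as the first equation dictates. Membership in D
  is asked for interior times only, so arcs may begin and end on switching lines; b keeps the
  interior of the arc to the left of a vertical line.\<close>

lemma zone_arc:
  fixes F :: "real \<Rightarrow> real" and x0 v0 c b T :: real
  defines "X \<equiv> \<lambda>t. x0 * C t + v0 * S t"
  defines "Y \<equiv> \<lambda>t. c + x0 * (\<sigma> * C t + S t) - v0 * C t"
  assumes T: "0 \<le> T" and D: "open D" "\<And>x. x \<in> D \<Longrightarrow> F x = c + \<sigma> * x"
    and XD: "\<And>t. 0 < t \<Longrightarrow> t < T \<Longrightarrow> X t \<in> D \<and> X t < b"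
  shows "arc_of (\<lambda>q v. fst q < b \<and> isCont F (fst q) \<and> v = lienard_field F q)
     (X 0, Y 0) (X T, Y T) ((\<lambda>t. (X t, Y t)) ` {0..T})"
proof -
  let ?g = "\<lambda>t. (X t, Y t)"
  have Xd: "(X has_real_derivative c + \<sigma> * X t - Y t) (at t)" for t
    unfolding X_def Y_def by (auto intro!: derivative_eq_intros S_deriv C_deriv simp: algebra_simps)
  have Yd: "(Y has_real_derivative X t) (at t)" for t
    unfolding X_def Y_def by (auto intro!: derivative_eq_intros S_deriv C_deriv simp: algebra_simps)
  have gd: "(?g has_vector_derivative (c + \<sigma> * X t - Y t, X t)) (at t)" for t
    using has_vector_derivative_Pair[of X _ t UNIV Y] Xd Yd by (simp add: has_real_derivative_iff_has_vector_derivative)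
  have contX: "continuous_on A X" and contY: "continuous_on A Y" for A
    using DERIV_isCont[OF Xd] DERIV_isCont[OF Yd] by (auto intro: continuous_at_imp_continuous_on)
  have "bounded ((\<lambda>t. (c + \<sigma> * X t - Y t, X t)) ` {0..T})"
    by (intro compact_imp_bounded compact_continuous_image continuous_intros contX contY) simp
  then obtain B where B: "B > 0" "\<And>t. t \<in> {0..T} \<Longrightarrow> norm (c + \<sigma> * X t - Y t, X t) \<le> B"
    unfolding bounded_pos by blast
  have lip: "B-lipschitz_on {0..T} ?g"
  proof (rule bounded_derivative_imp_lipschitz)
    show "(?g has_derivative (\<lambda>s. s *\<^sub>R (c + \<sigma> * X t - Y t, X t))) (at t within {0..T})" for t
      using gd[of t] has_derivative_at_withinI unfolding has_vector_derivative_def by blast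
    show "onorm (\<lambda>s. s *\<^sub>R (c + \<sigma> * X t - Y t, X t)) \<le> B" if "t \<in> {0..T}" for t
    proof (rule onorm_le)
      fix s :: real
      show "norm (s *\<^sub>R (c + \<sigma> * X t - Y t, X t)) \<le> B * norm s"
        using B(2)[OF that] by (simp only: norm_scaleR real_norm_def mult.commute[of B] mult_left_mono abs_ge_zero)
    qed
  qed (use B in auto)
  show ?thesis
  proof (rule arc_ofI[OF T refl refl refl lip, where S = "{}"])
    fix t assume t: "0 < t" "t < T"
    then have "X t \<in> D" "X t < b" using XD by auto
    moreover have "isCont F (X t)"
    proof -
      have "isCont (\<lambda>x. c + \<sigma> * x) (X t)" by simp
      moreover have "\<forall>\<^sub>F x in nhds (X t). F x = c + \<sigma> * x"
        using D \<open>X t \<in> D\<close> eventually_nhds_in_open[of D "X t"] by (auto elim: eventually_mono)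
      ultimately show ?thesis using isCont_cong[of F "\<lambda>x. c + \<sigma> * x" "X t"] by simp
    qed
    moreover have "lienard_field F (X t, Y t) = (c + \<sigma> * X t - Y t, X t)" using D(2) \<open>X t \<in> D\<close> by (simp add: lienard_field_def)
    ultimately show "\<exists>v. (fst (X t, Y t) < b \<and> isCont F (fst (X t, Y t)) \<and> v = lienard_field F (X t, Y t)) \<and>
        (?g has_vector_derivative v) (at t)" using gd[of t] by auto
  qed simp
qed

section \<open>Transit through a vertical strip\<close>

context
  fixes c q p :: real
  assumes qp: "0 \<le> p" "p < q"
begin

text \<open>The orbit entering the strip between \<open>x = q\<close> and \<open>x = p\<close> at height \<open>c + \<sigma> q + w\<close> needs
  time \<open>t\<close> with \<open>strip_in t = w\<close> to cross it, and leaves it at height \<open>strip_out t\<close>.\<close>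

definition "strip_in t = (q * C t - p) / S t"

definition "strip_out t = c + (q * exp (2 * t * cos \<theta>) - p * C t) / S t"

lemma strip_in_deriv:
  assumes "0 < t" "t < h"
  shows "(strip_in has_real_derivative - (q * exp (2 * t * cos \<theta>) - p * (C t + \<sigma> * S t)) / (S t)\<^sup>2) (at t)"
proof -
  have "(strip_in has_real_derivative ((q * - S t) * S t - (q * C t - p) * (C t + \<sigma> * S t)) / (S t * S t)) (at t)"
    unfolding strip_in_def[abs_def] using S_pos[OF assms]
    by (auto intro!: derivative_eq_intros S_deriv C_deriv)
  moreover have "(q * - S t) * S t - (q * C t - p) * (C t + \<sigma> * S t) = - (q * exp (2 * t * cos \<theta>) - p * (C t + \<sigma> * S t))"
    unfolding wronskian[symmetric] by (simp add: power2_eq_square algebra_simps)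
  ultimately show ?thesis by (simp only: power2_eq_square)
qed

lemma strip_in_deriv_neg:
  assumes "0 < t" "t < h"
  shows "- (q * exp (2 * t * cos \<theta>) - p * (C t + \<sigma> * S t)) / (S t)\<^sup>2 < 0"
proof -
  have "p * (C t + \<sigma> * S t) \<le> p * exp (2 * t * cos \<theta>)" using dS_le[of t] assms qp by (intro mult_left_mono) auto
  also have "\<dots> < q * exp (2 * t * cos \<theta>)" using qp by simp
  finally show ?thesis using S_pos[OF assms] by (simp add: divide_neg_pos)
qed

lemma strip_in_decreasing:
  assumes "0 < s" "s < t" "t < h" shows "strip_in t < strip_in s"
proof (rule DERIV_neg_imp_decreasing[OF assms(2)])
  fix u assume "s \<le> u" "u \<le> t"
  then have "0 < u" "u < h" using assms by auto
  then show "\<exists>y. (strip_in has_real_derivative y) (at u) \<and> y < 0"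
    using strip_in_deriv strip_in_deriv_neg by blast
qed

lemma strip_in_inj: "inj_on strip_in {0<..<h}"
  by (rule inj_onI) (metis greaterThanLessThan_iff linorder_cases order_less_irrefl strip_in_decreasing)

lemma strip_out_deriv:
  assumes "0 < t" "t < h"
  shows "(strip_out has_real_derivative - exp (2 * t * cos \<theta>) * (q * C t - p) / (S t)\<^sup>2) (at t)"
proof -
  have "(strip_out has_real_derivative
      ((q * (exp (2 * t * cos \<theta>) * \<sigma>) + p * S t) * S t - (q * exp (2 * t * cos \<theta>) - p * C t) * (C t + \<sigma> * S t)) / (S t * S t)) (at t)"
    unfolding strip_out_def[abs_def] using S_pos[OF assms]
    by (auto intro!: derivative_eq_intros S_deriv C_deriv simp: algebra_simps)
  moreover have "(q * (exp (2 * t * cos \<theta>) * \<sigma>) + p * S t) * S t - (q * exp (2 * t * cos \<theta>) - p * C t) * (C t + \<sigma> * S t)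
     = - q * exp (2 * t * cos \<theta>) * C t + p * (C t * (C t + \<sigma> * S t) + (S t)\<^sup>2)"
    by (simp add: power2_eq_square algebra_simps)
  moreover have "\<dots> = - exp (2 * t * cos \<theta>) * (q * C t - p)" unfolding wronskian by (simp add: algebra_simps)
  ultimately show ?thesis by (simp only: power2_eq_square)
qed

text \<open>For entries on or above the nullcline a longer transit means a lower exit. With
  \<open>strip_in_decreasing\<close> this makes the transit map increasing. As C decreases, the
  condition at the later time t covers the whole interval.\<close>

lemma strip_out_decreasing:
  assumes "0 < s" "s < t" "t < h" "p \<le> q * C t" shows "strip_out t < strip_out s"
proof (rule DERIV_neg_imp_decreasing_open[OF assms(2)])
  fix u assume u: "s < u" "u < t"
  then have u': "0 < u" "u < h" using assms by auto
  have "q * C t < q * C u" using C_decreasing[of u t] u u' assms qp by simp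
  then have "- exp (2 * u * cos \<theta>) * (q * C u - p) / (S u)\<^sup>2 < 0"
    using assms(4) S_pos[OF u'] by (simp add: divide_neg_pos mult_neg_pos)
  then show "\<exists>y. (strip_out has_real_derivative y) (at u) \<and> y < 0" using strip_out_deriv[OF u'] by blast
next
  show "continuous_on {s..t} strip_out"
    using strip_out_deriv assms by (intro continuous_at_imp_continuous_on ballI DERIV_isCont[OF strip_out_deriv]) auto
qed

lemma strip_exit_time:
  obtains t1 where "0 < t1" "t1 \<le> t0" "q * C t1 = p"
proof -
  have "\<exists>t\<ge>0. t \<le> t0 \<and> C t = p / q"
    by (rule IVT2) (use qp t0 C_t0 \<theta> in \<open>auto simp: divide_le_eq\<close>)
  then obtain t where t: "0 \<le> t" "t \<le> t0" "C t = p / q" by blast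
  have "q * C t = p" using t(3) qp by simp
  moreover from this have "t \<noteq> 0" using qp \<theta> by auto
  ultimately show thesis using that[of t] t by simp
qed

text \<open>The equation is solved as \<open>q * C t - p - w * S t = 0\<close>, which has no
  singularity at t = 0, by the intermediate value theorem up to the zero \<open>t1\<close> of
  \<open>q * C t - p\<close>.\<close>

lemma strip_in_surj:
  assumes w: "w \<ge> 0"
  obtains t where "0 < t" "t \<le> t0" "strip_in t = w" "p \<le> q * C t"
proof -
  obtain t1 where t1: "0 < t1" "t1 \<le> t0" "q * C t1 = p" by (rule strip_exit_time)
  have St: "S t > 0" if "0 < t" "t \<le> t1" for t using S_pos that t1 t0 by simp
  have "\<exists>t\<ge>0. t \<le> t1 \<and> q * C t - p - w * S t = 0"
  proof (rule IVT2)
    show "q * C t1 - p - w * S t1 \<le> 0" using t1 w St[of t1] by simp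
    show "0 \<le> q * C 0 - p - w * S 0" using qp \<theta> by simp
    show "\<forall>t. 0 \<le> t \<and> t \<le> t1 \<longrightarrow> isCont (\<lambda>t. q * C t - p - w * S t) t"
      by (auto intro!: continuous_intros)
  qed (use t1 in auto)
  then obtain t where t: "0 \<le> t" "t \<le> t1" "q * C t - p - w * S t = 0" by blast
  have "t \<noteq> 0" using t(3) qp \<theta> by auto
  then have t': "0 < t" using t by simp
  show thesis
  proof
    show "strip_in t = w" using t(3) St[OF t' t(2)] by (simp add: strip_in_def field_simps)
    have "0 \<le> w * S t" using w St[OF t' t(2)] by simp
    then show "p \<le> q * C t" using t(3) by linarith
  qed (use t t' t1 in auto)
qed

lemma strip_arc:
  fixes t :: real
  assumes t: "0 < t" "t \<le> t0" and w: "strip_in t \<ge> 0"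
    and F: "\<And>x. p < x \<Longrightarrow> x < q \<Longrightarrow> F x = c + \<sigma> * x"
  defines "y \<equiv> c + \<sigma> * q + strip_in t"
  shows "\<exists>W. arc_of (\<lambda>z v. fst z < q \<and> isCont F (fst z) \<and> v = lienard_field F z) (q, y) (p, strip_out t) W \<and>
     (\<forall>z\<in>W. z = (q, y) \<or> z = (p, strip_out t) \<or> (p < fst z \<and> fst z < q \<and> c + \<sigma> * fst z < snd z))"
    and "y \<le> strip_out t" "strip_out t \<le> y + q * h" "c + \<sigma> * p < strip_out t"
proof -
  define w where "w = strip_in t"
  define X where "X s = q * C s + (- w) * S s" for s
  define Y where "Y s = c + q * (\<sigma> * C s + S s) - (- w) * C s" for s
  have th: "t < h" using t t0 by simp
  have w0: "w \<ge> 0" using assms(3) by (simp add: w_def)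
  have Xp: "X s - p = S s * (strip_in s - w)" if "0 < s" "s < h" for s
    using S_pos[OF that] by (simp add: X_def strip_in_def field_simps)
  have Xt: "X t = p" using Xp[OF t(1) th] by (simp add: w_def)
  have Xgt: "X s > p" if "0 < s" "s < t" for s
  proof -
    have "0 < S s * (strip_in s - w)"
      using strip_in_decreasing[of s t] that th S_pos[of s] by (simp add: w_def)
    then show ?thesis using Xp[of s] that th by simp
  qed
  \<comment> \<open>Eliminating w by the exit condition and applying the Wronskian identity turns
    \<open>Y t\<close> into \<open>strip_out t\<close>.\<close>
  have Yt: "Y t = strip_out t"
  proof -
    have "S t \<noteq> 0" using S_pos[OF t(1) th] by simp
    have "Y t = c + (q * (C t * (C t + \<sigma> * S t) + (S t)\<^sup>2) - p * C t) / S t"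
      using \<open>S t \<noteq> 0\<close> by (simp add: Y_def w_def strip_in_def field_simps power2_eq_square)
    then show ?thesis unfolding wronskian by (simp add: strip_out_def)
  qed
  have X0: "X 0 = q" "Y 0 = y" using \<theta> by (simp_all add: X_def Y_def y_def w_def)
  have Xd: "(X has_real_derivative c + \<sigma> * X s - Y s) (at s)" for s
    unfolding X_def Y_def by (auto intro!: derivative_eq_intros S_deriv C_deriv simp: algebra_simps)
  have Yd: "(Y has_real_derivative X s) (at s)" for s
    unfolding X_def Y_def by (auto intro!: derivative_eq_intros S_deriv C_deriv simp: algebra_simps)
  have above: "c + \<sigma> * X s < Y s" if s: "0 < s" "s \<le> t" for s
  proof -
    have Ss: "S s > 0" using S_pos s th by simp
    have Xs: "X s \<ge> 0" using Xgt[of s] Xt s qp by (cases "s = t") auto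
    have eq: "Y s - (c + \<sigma> * X s) = q * S s + w * (C s + \<sigma> * S s)"
      by (simp add: X_def Y_def algebra_simps)
    \<comment> \<open>This keeps the orbit above the nullcline. It is clear if S' is nonnegative.
      Otherwise multiply by S and replace \<open>w * S s\<close> by \<open>q * C s - X s\<close>:
      the Wronskian leaves a positive exponential minus a nonpositive term.\<close>
    have "q * S s + w * (C s + \<sigma> * S s) > 0"
    proof (cases "C s + \<sigma> * S s \<ge> 0")
      case True then show ?thesis using qp Ss w0 by (simp add: add_pos_nonneg)
    next
      case False
      have "S s * (q * S s + w * (C s + \<sigma> * S s)) = q * (C s * (C s + \<sigma> * S s) + (S s)\<^sup>2) - X s * (C s + \<sigma> * S s)"
        by (simp add: X_def power2_eq_square algebra_simps)
      also have "\<dots> = q * exp (2 * s * cos \<theta>) - X s * (C s + \<sigma> * S s)" unfolding wronskian ..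
      also have "\<dots> > 0"
      proof -
        have "X s * (C s + \<sigma> * S s) \<le> 0" using False Xs by (simp add: mult_nonneg_nonpos)
        moreover have "q * exp (2 * s * cos \<theta>) > 0" using qp by simp
        ultimately show ?thesis by linarith
      qed
      finally show ?thesis using Ss zero_less_mult_pos by blast
    qed
    then show ?thesis using eq by simp
  qed
  have Xlt: "X s < q" if s: "0 < s" "s \<le> t" for s
  proof -
    have "X s < X 0"
    proof (rule DERIV_neg_imp_decreasing_open[OF s(1)])
      fix u assume "0 < u" "u < s"
      then show "\<exists>y. (X has_real_derivative y) (at u) \<and> y < 0" using Xd[of u] above[of u] s by (intro exI[of _ "c + \<sigma> * X u - Y u"]) auto
    qed (use DERIV_isCont[OF Xd] in \<open>auto intro: continuous_at_imp_continuous_on\<close>)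
    then show ?thesis using X0 by simp
  qed
  have "arc_of (\<lambda>z v. fst z < q \<and> isCont F (fst z) \<and> v = lienard_field F z) (X 0, Y 0) (X t, Y t) ((\<lambda>s. (X s, Y s)) ` {0..t})"
    unfolding X_def Y_def
    by (rule zone_arc[where D = "{p<..<q}"]) (use t F Xgt Xlt in \<open>auto simp: X_def\<close>)
  moreover have "\<forall>z\<in>(\<lambda>s. (X s, Y s)) ` {0..t}. z = (q, y) \<or> z = (p, strip_out t) \<or> (p < fst z \<and> fst z < q \<and> c + \<sigma> * fst z < snd z)"
  proof (rule ballI, elim imageE)
    fix z s assume z: "z = (X s, Y s)" "s \<in> {0..t}"
    consider "s = 0" | "s = t" | "0 < s" "s < t" using z by force
    then show "z = (q, y) \<or> z = (p, strip_out t) \<or> (p < fst z \<and> fst z < q \<and> c + \<sigma> * fst z < snd z)"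
      using z X0 Xt Yt Xgt[of s] Xlt[of s] above[of s] by cases auto
  qed
  ultimately show "\<exists>W. arc_of (\<lambda>z v. fst z < q \<and> isCont F (fst z) \<and> v = lienard_field F z) (q, y) (p, strip_out t) W \<and>
     (\<forall>z\<in>W. z = (q, y) \<or> z = (p, strip_out t) \<or> (p < fst z \<and> fst z < q \<and> c + \<sigma> * fst z < snd z))"
    unfolding X0 Xt Yt by blast
  \<comment> \<open>Since Y' = X lies between 0 and q and the transit takes less than h, the gain in
    height is at most \<open>q * h\<close>, uniformly in the entry point.\<close>
  obtain s where s: "0 < s" "s < t" "Y t - Y 0 = (t - 0) * X s"
    using MVT2[OF t(1), of Y X] Yd by blast
  have "0 \<le> X s" "X s \<le> q" using Xgt[of s] Xlt[of s] s qp by auto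
  then have "0 \<le> t * X s" "t * X s \<le> h * q" using t(1) th mult_mono[of t h "X s" q] by simp_all
  then show "y \<le> strip_out t" "strip_out t \<le> y + q * h" using s(3) X0 Yt by (simp_all add: mult.commute)
  show "c + \<sigma> * p < strip_out t" using above[of t] t Xt Yt by simp
qed

end

end

section \<open>Real-analytic functions\<close>

text \<open>Defined through a holomorphic extension, so that inverse functions and isolated zeros
  can be taken from complex analysis.\<close>

definition real_analytic_at :: "(real \<Rightarrow> real) \<Rightarrow> real \<Rightarrow> bool" where
  "real_analytic_at f x \<longleftrightarrow> (\<exists>k. k analytic_on {complex_of_real x} \<and>
     (\<forall>\<^sub>F u in nhds x. k (complex_of_real u) = complex_of_real (f u)))"

lemma real_analytic_at_const: "real_analytic_at (\<lambda>x. c) x"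
  unfolding real_analytic_at_def by (rule exI[of _ "\<lambda>_. complex_of_real c"]) auto

lemma real_analytic_at_ident: "real_analytic_at (\<lambda>x. x) x"
  unfolding real_analytic_at_def by (rule exI[of _ "\<lambda>z. z"]) auto

lemma real_analytic_at_exp: "real_analytic_at exp x"
  unfolding real_analytic_at_def
  by (rule exI[of _ exp]) (auto simp: exp_of_real intro!: holomorphic_on_imp_analytic_at[of _ UNIV] holomorphic_intros)

lemma real_analytic_at_sin: "real_analytic_at sin x"
  unfolding real_analytic_at_def
  by (rule exI[of _ sin]) (auto simp: sin_of_real intro!: holomorphic_on_imp_analytic_at[of _ UNIV] holomorphic_intros)

lemma
  assumes "real_analytic_at f x" "real_analytic_at g x"
  shows real_analytic_at_add: "real_analytic_at (\<lambda>x. f x + g x) x"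
    and real_analytic_at_diff: "real_analytic_at (\<lambda>x. f x - g x) x"
    and real_analytic_at_mult: "real_analytic_at (\<lambda>x. f x * g x) x"
    and real_analytic_at_divide: "g x \<noteq> 0 \<Longrightarrow> real_analytic_at (\<lambda>x. f x / g x) x"
proof -
  obtain k l where k: "k analytic_on {complex_of_real x}" "\<forall>\<^sub>F u in nhds x. k (complex_of_real u) = complex_of_real (f u)"
    and l: "l analytic_on {complex_of_real x}" "\<forall>\<^sub>F u in nhds x. l (complex_of_real u) = complex_of_real (g u)"
    using assms unfolding real_analytic_at_def by blast
  have ev: "\<forall>\<^sub>F u in nhds x. k (complex_of_real u) = complex_of_real (f u) \<and> l (complex_of_real u) = complex_of_real (g u)"
    using k(2) l(2) by eventually_elim simp
  show "real_analytic_at (\<lambda>x. f x + g x) x" unfolding real_analytic_at_def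
    by (rule exI[of _ "\<lambda>z. k z + l z"]) (intro conjI analytic_on_add k l eventually_mono[OF ev], simp)
  show "real_analytic_at (\<lambda>x. f x - g x) x" unfolding real_analytic_at_def
    by (rule exI[of _ "\<lambda>z. k z - l z"]) (intro conjI analytic_on_diff k l eventually_mono[OF ev], simp)
  show "real_analytic_at (\<lambda>x. f x * g x) x" unfolding real_analytic_at_def
    by (rule exI[of _ "\<lambda>z. k z * l z"]) (intro conjI analytic_on_mult k l eventually_mono[OF ev], simp)
  assume "g x \<noteq> 0"
  moreover have "l (complex_of_real x) = complex_of_real (g x)" using l(2) by (rule eventually_nhds_x_imp_x)
  ultimately have "l (complex_of_real x) \<noteq> 0" by simp
  then show "real_analytic_at (\<lambda>x. f x / g x) x" unfolding real_analytic_at_def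
    by (intro exI[of _ "\<lambda>z. k z / l z"] conjI analytic_on_divide k l eventually_mono[OF ev]) auto
qed

lemma real_analytic_at_compose:
  assumes f: "real_analytic_at f x" and g: "real_analytic_at g (f x)"
  shows "real_analytic_at (\<lambda>x. g (f x)) x"
proof -
  obtain k where k: "k analytic_on {complex_of_real x}" "\<forall>\<^sub>F u in nhds x. k (complex_of_real u) = complex_of_real (f u)"
    using f unfolding real_analytic_at_def by blast
  obtain l where l: "l analytic_on {complex_of_real (f x)}" "\<forall>\<^sub>F u in nhds (f x). l (complex_of_real u) = complex_of_real (g u)"
    using g unfolding real_analytic_at_def by blast
  have kx: "k (complex_of_real x) = complex_of_real (f x)" using k(2) by (rule eventually_nhds_x_imp_x)
  have an: "(l \<circ> k) analytic_on {complex_of_real x}"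
    using k(1) l(1) kx by (intro analytic_on_compose) auto
  have "isCont k (complex_of_real x)" using k(1) analytic_at_imp_isCont by blast
  then have "((\<lambda>u. k (complex_of_real u)) \<longlongrightarrow> k (complex_of_real x)) (nhds x)"
    by (intro isCont_tendsto_compose[of _ k]) (auto intro!: tendsto_intros filterlim_ident)
  then have "((\<lambda>u. Re (k (complex_of_real u))) \<longlongrightarrow> Re (k (complex_of_real x))) (nhds x)" by (rule tendsto_Re)
  moreover have "\<forall>\<^sub>F u in nhds x. Re (k (complex_of_real u)) = f u" using k(2) by eventually_elim simp
  ultimately have "(f \<longlongrightarrow> Re (k (complex_of_real x))) (nhds x)" by (rule Lim_transform_eventually)
  then have "(f \<longlongrightarrow> f x) (nhds x)" using kx by simp
  then have "\<forall>\<^sub>F u in nhds x. l (complex_of_real (f u)) = complex_of_real (g (f u))"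
    using eventually_compose_filterlim[OF l(2)] by blast
  then have "\<forall>\<^sub>F u in nhds x. (l \<circ> k) (complex_of_real u) = complex_of_real (g (f u))"
    using k(2) by eventually_elim simp
  then show ?thesis using an unfolding real_analytic_at_def by blast
qed

lemmas real_analytic_at_exp' = real_analytic_at_compose[OF _ real_analytic_at_exp]

lemmas real_analytic_at_sin' = real_analytic_at_compose[OF _ real_analytic_at_sin]

text \<open>The extension has derivative D at the real point, hence a local holomorphic inverse;
  continuity of g keeps its values in the disc where that inverse is valid, which identifies the
  two.\<close>

lemma real_analytic_at_inverse_function:
  assumes f: "real_analytic_at f x" and d: "(f has_real_derivative D) (at x)" "D \<noteq> 0"
    and g: "isCont g (f x)" "g (f x) = x" "\<forall>\<^sub>F y in nhds (f x). f (g y) = y"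
  shows "real_analytic_at g (f x)"
proof -
  obtain k where k: "k analytic_on {complex_of_real x}" "\<forall>\<^sub>F u in nhds x. k (complex_of_real u) = complex_of_real (f u)"
    using f unfolding real_analytic_at_def by blast
  have kx: "k (complex_of_real x) = complex_of_real (f x)" using k(2) by (rule eventually_nhds_x_imp_x)
  obtain U where U: "open U" "complex_of_real x \<in> U" "k holomorphic_on U"
    using k(1) unfolding analytic_at by blast
  have kd: "(k has_field_derivative deriv k (complex_of_real x)) (at (complex_of_real x))"
    using U holomorphic_derivI by blast
  have "((\<lambda>u. k (complex_of_real u)) has_vector_derivative deriv k (complex_of_real x)) (at x)"
    using field_vector_diff_chain_at[of complex_of_real 1 x k "deriv k (complex_of_real x)"] kd
    by (simp add: o_def has_vector_derivative_of_real has_vector_derivative_real_field)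
  moreover have "((\<lambda>u. complex_of_real (f u)) has_vector_derivative complex_of_real D) (at x)"
    using d(1) by (rule has_vector_derivative_of_real)
  then have "((\<lambda>u. k (complex_of_real u)) has_vector_derivative complex_of_real D) (at x)"
  proof -
    assume *: "((\<lambda>u. complex_of_real (f u)) has_vector_derivative complex_of_real D) (at x)"
    obtain V where "open V" "x \<in> V" "\<And>u. u \<in> V \<Longrightarrow> k (complex_of_real u) = complex_of_real (f u)"
      using k(2) unfolding eventually_nhds by blast
    then show ?thesis using has_vector_derivative_transform_within_open[OF *, of V] by simp
  qed
  ultimately have "deriv k (complex_of_real x) = complex_of_real D" by (rule vector_derivative_unique_at)
  then have "deriv k (complex_of_real x) \<noteq> 0" using d(2) by simp
  then obtain r where r: "r > 0" "ball (complex_of_real x) r \<subseteq> U" "open (k ` ball (complex_of_real x) r)" "inj_on k (ball (complex_of_real x) r)"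
    using has_complex_derivative_locally_invertible[OF U(3,2,1)] by metis
  let ?B = "ball (complex_of_real x) r"
  obtain l where l: "l holomorphic_on (k ` ?B)" "\<And>z. z \<in> ?B \<Longrightarrow> l (k z) = z"
    using holomorphic_has_inverse[of k ?B] U(3) r by (metis holomorphic_on_subset open_ball)
  have "complex_of_real (f x) \<in> k ` ?B" using kx r(1) by (metis centre_in_ball image_eqI)
  then have "l analytic_on {complex_of_real (f x)}" using l(1) r(3) analytic_at by blast
  moreover have "\<forall>\<^sub>F y in nhds (f x). l (complex_of_real y) = complex_of_real (g y)"
  proof -
    have "(g \<longlongrightarrow> g (f x)) (nhds (f x))" using g(1) by (simp only: isCont_def tendsto_at_iff_tendsto_nhds)
    then have gt: "(g \<longlongrightarrow> x) (nhds (f x))" using g(2) by simp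
    have "\<forall>\<^sub>F y in nhds (f x). k (complex_of_real (g y)) = complex_of_real (f (g y))"
      using eventually_compose_filterlim[OF k(2) gt] .
    moreover have "\<forall>\<^sub>F y in nhds (f x). dist (g y) x < r" using gt r(1) tendstoD by blast
    ultimately show ?thesis using g(3)
    proof eventually_elim
      case (elim y)
      have "complex_of_real (g y) \<in> ?B" using elim(2) by (simp add: dist_commute)
      then have "l (k (complex_of_real (g y))) = complex_of_real (g y)" by (rule l(2))
      then show ?case using elim by simp
    qed
  qed
  ultimately show ?thesis unfolding real_analytic_at_def by blast
qed

text \<open>Zeros of the extension are isolated unless it vanishes on a whole disc.\<close>

lemma real_analytic_at_zero_cases:
  assumes "real_analytic_at f x"
  shows "(\<forall>\<^sub>F u in nhds x. f u = 0) \<or> (\<forall>\<^sub>F u in at x. f u \<noteq> 0)"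
proof -
  obtain k where k: "k analytic_on {complex_of_real x}" "\<forall>\<^sub>F u in nhds x. k (complex_of_real u) = complex_of_real (f u)"
    using assms unfolding real_analytic_at_def by blast
  have lim: "filterlim complex_of_real (at (complex_of_real x)) (at x)"
    unfolding filterlim_at by (auto intro!: tendsto_intros simp: eventually_at_filter)
  have k': "\<forall>\<^sub>F u in at x. k (complex_of_real u) = complex_of_real (f u)"
    using k(2) by (simp add: eventually_at_filter eventually_mono)
  obtain r where r: "r > 0" "k holomorphic_on ball (complex_of_real x) r"
    using k(1) unfolding analytic_on_def by blast
  show ?thesis
  proof (cases "\<forall>z\<in>ball (complex_of_real x) r. k z = 0")
    case True
    have "\<forall>\<^sub>F u in nhds x. dist u x < r" using r(1) eventually_nhds_metric by blast
    then have "\<forall>\<^sub>F u in nhds x. f u = 0" using k(2)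
    proof eventually_elim
      case (elim u)
      have "complex_of_real u \<in> ball (complex_of_real x) r"
        using elim(1) by (simp add: dist_commute)
      then have "k (complex_of_real u) = 0" using True by blast
      then show ?case using elim by simp
    qed
    then show ?thesis ..
  next
    case False
    then obtain b where b: "b \<in> ball (complex_of_real x) r" "k b \<noteq> 0" by blast
    have "\<forall>\<^sub>F z in at (complex_of_real x). k z \<noteq> 0"
    proof (cases "k (complex_of_real x) = 0")
      case True
      obtain e where "e > 0" "ball (complex_of_real x) e \<subseteq> ball (complex_of_real x) r"
        "\<And>z. z \<in> ball (complex_of_real x) e - {complex_of_real x} \<Longrightarrow> k z \<noteq> 0"
        using isolated_zeros[OF r(2) open_ball connected_ball _ True b] r(1) by (metis centre_in_ball)
      then show ?thesis unfolding eventually_at by (intro exI[of _ e]) (auto simp: dist_commute)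
    next
      case nz: False
      have "isCont k (complex_of_real x)" using k(1) analytic_at_imp_isCont by blast
      then show ?thesis using nz by (simp add: isCont_def tendsto_imp_eventually_ne)
    qed
    then have "\<forall>\<^sub>F u in at x. k (complex_of_real u) \<noteq> 0" using eventually_compose_filterlim[OF _ lim] by blast
    then have "\<forall>\<^sub>F u in at x. f u \<noteq> 0" using k' by eventually_elim auto
    then show ?thesis ..
  qed
qed

text \<open>If the zero x were not isolated, f would vanish near x; local vanishing is open and
  closed in \<open>[x, b]\<close>, contrary to \<open>f b \<noteq> 0\<close>. Working to the right
  of x allows analyticity to fail at a, as it may where an orbit meets the last switching line
  tangentially.\<close>

lemma real_analytic_isolated_zero:
  fixes f :: "real \<Rightarrow> real"
  assumes ab: "a < b" and cont: "continuous_on {a..b} f" and ra: "\<And>x. a < x \<Longrightarrow> x \<le> b \<Longrightarrow> real_analytic_at f x"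
    and sgn: "f a * f b < 0"
  obtains x where "a < x" "x < b" "f x = 0" "\<forall>\<^sub>F u in at x. f u \<noteq> 0"
proof -
  have "f a \<noteq> 0" "f b \<noteq> 0" using sgn by auto
  have "\<exists>x. a \<le> x \<and> x \<le> b \<and> f x = 0"
  proof (cases "f a < 0")
    case True
    then have "f b > 0" using sgn by (simp add: mult_less_0_iff)
    then show ?thesis using IVT'[of f a 0 b] True ab cont by auto
  next
    case False
    then have "f b < 0" "f a > 0" using sgn \<open>f a \<noteq> 0\<close> by (auto simp: mult_less_0_iff)
    then show ?thesis using IVT2'[of f b 0 a] ab cont by auto
  qed
  then obtain x where x: "a \<le> x" "x \<le> b" "f x = 0" by blast
  then have x': "a < x" "x < b" using \<open>f a \<noteq> 0\<close> \<open>f b \<noteq> 0\<close> by (auto simp: less_le)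
  have "\<not> (\<forall>\<^sub>F u in nhds x. f u = 0)"
  proof
    assume *: "\<forall>\<^sub>F u in nhds x. f u = 0"
    define A where "A = {u. \<forall>\<^sub>F v in nhds u. f v = 0}"
    have oA: "open A"
    proof (subst open_subopen, intro ballI)
      fix u assume "u \<in> A"
      then obtain V where "open V" "u \<in> V" "\<And>v. v \<in> V \<Longrightarrow> f v = 0" by (auto simp: A_def eventually_nhds)
      then show "\<exists>V. open V \<and> u \<in> V \<and> V \<subseteq> A" unfolding A_def eventually_nhds by blast
    qed
    \<comment> \<open>By the dichotomy, f either vanishes near a point of the interval or the point
      has a neighbourhood that is disjoint from A.\<close>
    have cover: "{x..b} \<subseteq> A \<union> interior (- A)"
    proof
      fix u assume u: "u \<in> {x..b}"
      then consider "u \<in> A" | "\<forall>\<^sub>F v in at u. f v \<noteq> 0"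
        using real_analytic_at_zero_cases[OF ra[of u]] x' by (auto simp: A_def)
      then show "u \<in> A \<union> interior (- A)"
      proof cases
        case 2
        then obtain e where e: "e > 0" "\<And>v. v \<noteq> u \<Longrightarrow> dist v u < e \<Longrightarrow> f v \<noteq> 0" by (auto simp: eventually_at)
        have "ball u e \<subseteq> - A"
        proof
          fix v assume v: "v \<in> ball u e"
          show "v \<in> - A"
          proof
            assume "v \<in> A"
            then have ev: "\<forall>\<^sub>F w in nhds v. f w = 0" by (simp add: A_def)
            moreover have "\<forall>\<^sub>F w in nhds v. w \<in> ball u e" using v by (intro eventually_nhds_in_open) auto
            ultimately have "\<forall>\<^sub>F w in nhds v. f w = 0 \<and> w \<in> ball u e" by eventually_elim simp
            then have "\<forall>\<^sub>F w in nhds v. w = u" using e(2) by (elim eventually_mono) (auto simp: dist_commute)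
            then have "\<forall>\<^sub>F w in at v. w = u" by (simp add: eventually_at_filter eventually_mono)
            moreover have "v = u" using \<open>\<forall>\<^sub>F w in nhds v. w = u\<close> by (rule eventually_nhds_x_imp_x)
            ultimately have "\<forall>\<^sub>F w in at v. False" by (auto simp: eventually_at_filter elim: eventually_mono)
            then show False by simp
          qed
        qed
        then show ?thesis using e(1) by (metis UnI2 centre_in_ball interior_maximal open_ball subsetD)
      qed simp
    qed
    have disj: "A \<inter> interior (- A) \<inter> {x..b} = {}" using interior_subset by blast
    have "x \<in> A \<inter> {x..b}" using * x' by (simp add: A_def)
    moreover have "b \<in> interior (- A) \<inter> {x..b}"
    proof -
      have "b \<notin> A" using \<open>f b \<noteq> 0\<close> eventually_nhds_x_imp_x by (auto simp: A_def)
      moreover have "b \<in> {x..b}" using x' by simp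
      ultimately show ?thesis using cover by blast
    qed
    ultimately show False using connectedD[OF connected_Icc oA open_interior disj cover] by blast
  qed
  then have "\<forall>\<^sub>F u in at x. f u \<noteq> 0" using real_analytic_at_zero_cases[OF ra[of x]] x' x by auto
  then show thesis using that x x' by blast
qed

section \<open>Transit maps\<close>

lemma continuous_image_nhds_decreasing:
  fixes f :: "real \<Rightarrow> real"
  assumes dec: "\<And>s t. a < s \<Longrightarrow> s < t \<Longrightarrow> t < b \<Longrightarrow> f t < f s"
    and cont: "\<And>t. a < t \<Longrightarrow> t < b \<Longrightarrow> isCont f t" and t: "a < t" "t < b"
  shows "\<forall>\<^sub>F y in nhds (f t). y \<in> f ` {a<..<b}"
proof -
  define s where "s = (a + t) / 2"
  define u where "u = (t + b) / 2"
  have su: "a < s" "s < t" "t < u" "u < b" using t by (simp_all add: s_def u_def)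
  have "f u < f t" "f t < f s" using dec[of t u] dec[of s t] su t by auto
  then have "\<forall>\<^sub>F y in nhds (f t). y \<in> {f u<..<f s}" by (intro eventually_nhds_in_open) auto
  then show ?thesis
  proof eventually_elim
    case (elim y)
    have "\<exists>x\<ge>s. x \<le> u \<and> f x = y"
      by (rule IVT2) (use elim su cont in auto)
    then show ?case using su by fastforce
  qed
qed

lemma decreasing_inverse_real_analytic:
  fixes f :: "real \<Rightarrow> real"
  assumes dec: "\<And>s t. a < s \<Longrightarrow> s < t \<Longrightarrow> t < b \<Longrightarrow> f t < f s"
    and der: "\<And>t. a < t \<Longrightarrow> t < b \<Longrightarrow> \<exists>D. (f has_real_derivative D) (at t) \<and> D \<noteq> 0"
    and ra: "\<And>t. a < t \<Longrightarrow> t < b \<Longrightarrow> real_analytic_at f t"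
    and g: "\<And>t. a < t \<Longrightarrow> t < b \<Longrightarrow> g (f t) = t" and t: "a < t" "t < b"
  shows "isCont g (f t)" "real_analytic_at g (f t)"
proof -
  have cont: "isCont f t" if "a < t" "t < b" for t using der[OF that] DERIV_isCont by blast
  show c: "isCont g (f t)"
  proof (rule isCont_inverse_function[of "min (t - a) (b - t) / 2" t g f])
    show "0 < min (t - a) (b - t) / 2" using t by simp
    fix z assume "\<bar>z - t\<bar> \<le> min (t - a) (b - t) / 2"
    then have "a < z" "z < b" using t by (auto simp: abs_if min_def split: if_splits)
    then show "g (f z) = z" "isCont f z" using g cont by auto
  qed
  obtain D where D: "(f has_real_derivative D) (at t)" "D \<noteq> 0" using der t by blast
  have "\<forall>\<^sub>F y in nhds (f t). y \<in> f ` {a<..<b}"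
    using dec cont t by (rule continuous_image_nhds_decreasing)
  then have "\<forall>\<^sub>F y in nhds (f t). f (g y) = y" by (rule eventually_mono) (use g in auto)
  then show "real_analytic_at g (f t)"
    using real_analytic_at_inverse_function[OF ra[OF t] D c] g t by simp
qed

context zone
begin

lemma real_analytic_at_S: "real_analytic_at S t"
  unfolding zone_sin_def[abs_def] using sin_pos
  by (intro real_analytic_at_divide real_analytic_at_mult real_analytic_at_const
      real_analytic_at_exp' real_analytic_at_sin' real_analytic_at_ident) simp

lemma real_analytic_at_C: "real_analytic_at C t"
  unfolding zone_cos_def[abs_def] using sin_pos
  by (intro real_analytic_at_divide real_analytic_at_mult real_analytic_at_const real_analytic_at_diff
      real_analytic_at_exp' real_analytic_at_sin' real_analytic_at_ident) simp

text \<open>The transit map is \<open>strip_out\<close> after the inverse of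
  \<open>strip_in\<close>, in terms of the excess w over the nullcline. \<open>strip_in\<close> is
  inverted on all of \<open>(0, h)\<close>, where it also takes negative values, so that the inverse
  is regular on both sides of w = 0.\<close>

lemma strip_map:
  assumes qp: "0 \<le> p" "p < q"
  obtains B where
    "\<And>w. w \<ge> 0 \<Longrightarrow> \<exists>t. 0 < t \<and> t \<le> t0 \<and> strip_in q p t = w \<and> B w = strip_out c q p t"
    "strict_mono_on {0..} B" "continuous_on {0..} B" "\<And>w. w > 0 \<Longrightarrow> real_analytic_at B w"
proof -
  let ?in = "strip_in q p" and ?out = "strip_out c q p"
  define k where "k = inv_into {0<..<h} ?in"
  define B where "B w = ?out (k w)" for w
  have k: "k (?in t) = t" if "0 < t" "t < h" for t
    unfolding k_def using strip_in_inj[OF qp] that by (intro inv_into_f_f) auto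
  have ra_in: "real_analytic_at ?in t" if "0 < t" "t < h" for t
    unfolding strip_in_def[OF qp, abs_def] using S_pos[OF that]
    by (intro real_analytic_at_divide real_analytic_at_mult real_analytic_at_const real_analytic_at_diff
        real_analytic_at_C real_analytic_at_S) simp
  have ra_out: "real_analytic_at ?out t" if "0 < t" "t < h" for t
    unfolding strip_out_def[OF qp, abs_def] using S_pos[OF that]
    by (intro real_analytic_at_divide real_analytic_at_mult real_analytic_at_const real_analytic_at_diff
        real_analytic_at_add real_analytic_at_C real_analytic_at_S real_analytic_at_exp' real_analytic_at_ident) simp
  have kra: "isCont k (?in t)" "real_analytic_at k (?in t)" if t: "0 < t" "t < h" for t
  proof -
    have d: "\<exists>D. (?in has_real_derivative D) (at t) \<and> D \<noteq> 0" if "0 < t" "t < h" for t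
      using strip_in_deriv[OF qp that] strip_in_deriv_neg[OF qp that] by (metis less_irrefl)
    note * = decreasing_inverse_real_analytic[of 0 h ?in k, OF strip_in_decreasing[OF qp] d ra_in k t]
    show "isCont k (?in t)" by (rule *(1))
    show "real_analytic_at k (?in t)" by (rule *(2))
  qed
  have ex: "\<exists>t. 0 < t \<and> t \<le> t0 \<and> ?in t = w \<and> B w = ?out t \<and> p \<le> q * C t \<and> k w = t" if "w \<ge> 0" for w
  proof -
    obtain t where t: "0 < t" "t \<le> t0" "?in t = w" "p \<le> q * C t" by (rule strip_in_surj[OF qp \<open>w \<ge> 0\<close>]) (rule that)
    have kw: "k w = t" using k[of t] t t0 by simp
    show ?thesis by (rule exI[of _ t]) (use t kw in \<open>simp add: B_def\<close>)
  qed
  show thesis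
  proof (rule that[of B])
    show "\<exists>t. 0 < t \<and> t \<le> t0 \<and> ?in t = w \<and> B w = ?out t" if "w \<ge> 0" for w using ex[OF that] by blast
    show "strict_mono_on {0..} B"
    proof (rule strict_mono_onI)
      fix v w :: real assume vw: "v \<in> {0..}" "w \<in> {0..}" "v < w"
      obtain s where s: "0 < s" "s \<le> t0" "?in s = v" "B v = ?out s" "p \<le> q * C s" using ex[of v] vw by auto
      obtain t where t: "0 < t" "t \<le> t0" "?in t = w" "B w = ?out t" "p \<le> q * C t" using ex[of w] vw by auto
      have "t < s"
      proof (rule ccontr)
        assume "\<not> t < s"
        then have "s < t" using vw s t by (cases "s = t") auto
        moreover have "t < h" using t(2) t0(2) by linarith
        ultimately have "?in t < ?in s" using strip_in_decreasing[OF qp s(1)] by blast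
        then show False using s t vw by simp
      qed
      then show "B v < B w" using strip_out_decreasing[OF qp t(1), of s c] s t t0 by simp
    qed
    have out: "isCont ?out t" if "0 < t" "t < h" for t using strip_out_deriv[OF qp that] DERIV_isCont by blast
    show "continuous_on {0..} B"
    proof (intro continuous_at_imp_continuous_on ballI)
      fix w :: real assume "w \<in> {0..}"
      then obtain t where t: "0 < t" "t \<le> t0" "?in t = w" "k w = t" using ex[of w] by auto
      then have "isCont k w" "isCont ?out (k w)" using kra(1)[of t] out[of t] t0 by auto
      then show "isCont B w" unfolding B_def by (rule isCont_o2)
    qed
    fix w :: real assume "w > 0"
    then obtain t where t: "0 < t" "t \<le> t0" "?in t = w" "k w = t" using ex[of w] by auto
    then have "real_analytic_at k w" "real_analytic_at ?out (k w)" using kra(2)[of t] ra_out[of t] t0 by auto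
    then show "real_analytic_at B w" unfolding B_def by (rule real_analytic_at_compose)
  qed
qed

text \<open>The orbit that touches \<open>x = \<xi>\<close> inside the zone needs time \<open>exit_time (p / \<xi>)\<close> to reach
  \<open>x = p\<close>, where it is \<open>rise p \<xi>\<close> above the value of \<open>F\<close>.\<close>

definition "exit_time u = inv_into {0..t0} C u"

definition "rise p \<xi> = \<xi> * S (exit_time (p / \<xi>))"

lemma exit_time:
  assumes "0 \<le> u" "u \<le> 1"
  shows "0 \<le> exit_time u" "exit_time u \<le> t0" "C (exit_time u) = u"
proof -
  have "\<exists>t\<ge>0. t \<le> t0 \<and> C t = u"
    by (rule IVT2) (use assms t0 C_t0 \<theta> in auto)
  then have "u \<in> C ` {0..t0}" by auto
  then show "0 \<le> exit_time u" "exit_time u \<le> t0" "C (exit_time u) = u"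
    unfolding exit_time_def using inv_into_into[of u C "{0..t0}"] f_inv_into_f[of u C "{0..t0}"] by auto
qed

lemma exit_time_C: "0 \<le> t \<Longrightarrow> t \<le> t0 \<Longrightarrow> exit_time (C t) = t"
  unfolding exit_time_def
proof (rule inv_into_f_f)
  show "inj_on C {0..t0}"
  proof (rule inj_onI)
    fix s t assume "s \<in> {0..t0}" "t \<in> {0..t0}" "C s = C t"
    then show "s = t" using C_decreasing[of s t] C_decreasing[of t s] t0 by (cases s t rule: linorder_cases) auto
  qed
qed auto

lemma C_image: "C ` {0..t0} = {0..1}"
proof (intro equalityI subsetI)
  fix u assume "u \<in> C ` {0..t0}"
  then obtain t where t: "0 \<le> t" "t \<le> t0" "u = C t" by auto
  then have "C t0 \<le> C t" "C t \<le> C 0"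
    using C_decreasing[of t t0] C_decreasing[of 0 t] t0 by (cases "t = t0"; cases "t = 0"; simp)+
  then show "u \<in> {0..1}" using t C_t0 \<theta> by simp
next
  fix u :: real assume "u \<in> {0..1}"
  then show "u \<in> C ` {0..t0}" using exit_time[of u] by (metis atLeastAtMost_iff image_eqI)
qed

lemma continuous_on_exit_time: "continuous_on {0..1} exit_time"
  using continuous_on_inv[of "{0..t0}" C exit_time] continuous_on_C exit_time_C by (simp add: C_image)

lemma exit_time_strict: "0 \<le> u \<Longrightarrow> u < v \<Longrightarrow> v \<le> 1 \<Longrightarrow> exit_time v < exit_time u"
  using exit_time[of u] exit_time[of v] C_decreasing[of "exit_time u" "exit_time v"] t0
  by (cases "exit_time u" "exit_time v" rule: linorder_cases) auto

text \<open>The end u = 1 is a genuine singularity: C' = -S vanishes at time 0, so the inverse has a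
  vertical tangent there. Hence \<open>rise p\<close> is treated as analytic only for
  \<open>\<xi> > p\<close>.\<close>

lemma real_analytic_at_exit_time:
  assumes u: "0 < u" "u < 1" shows "real_analytic_at exit_time u"
proof -
  have t: "0 < exit_time u" "exit_time u < t0" "C (exit_time u) = u"
    using exit_time[of u] u C_t0 \<theta> by (auto simp: less_le)
  have d: "\<exists>D. (C has_real_derivative D) (at t) \<and> D \<noteq> 0" if "0 < t" "t < t0" for t
    using C_deriv[of t] S_pos[of t] that t0 by (intro exI[of _ "- S t"]) auto
  have "real_analytic_at exit_time (C (exit_time u))"
    by (rule decreasing_inverse_real_analytic(2)[of 0 t0 C exit_time])
      (use C_decreasing t0 d real_analytic_at_C exit_time_C t in auto)
  then show ?thesis using t by simp
qed

lemma continuous_on_rise: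
  assumes p: "0 < p" shows "continuous_on {p..} (rise p)"
  unfolding rise_def[abs_def]
proof (intro continuous_intros continuous_on_compose2[OF continuous_on_S[of UNIV]] continuous_on_compose2[OF continuous_on_exit_time])
  show "(\<lambda>x. p / x) ` {p..} \<subseteq> {0..1}" using p by (auto simp: divide_le_eq)
qed (use p in auto)

lemma real_analytic_at_rise:
  assumes "0 < p" "p < \<xi>" shows "real_analytic_at (rise p) \<xi>"
proof -
  have "real_analytic_at exit_time (p / \<xi>)" using assms by (intro real_analytic_at_exit_time) auto
  moreover have "real_analytic_at (\<lambda>\<xi>. p / \<xi>) \<xi>"
    using assms by (intro real_analytic_at_divide real_analytic_at_const real_analytic_at_ident) auto
  ultimately have "real_analytic_at (\<lambda>\<xi>. exit_time (p / \<xi>)) \<xi>" using real_analytic_at_compose[of "\<lambda>\<xi>. p / \<xi>" \<xi> exit_time] by simp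
  then show ?thesis unfolding rise_def[abs_def]
    by (intro real_analytic_at_mult real_analytic_at_ident real_analytic_at_compose[OF _ real_analytic_at_S])
qed

lemma rise_start [simp]: "0 < p \<Longrightarrow> rise p p = 0"
  using exit_time_C[of 0] t0 \<theta> by (simp add: rise_def)

text \<open>Since \<open>\<xi> = p / C t\<close> at the exit time t, the rise is p times S/C, and
  the derivative of this quotient is the Wronskian over C^2.\<close>

lemma rise_strict_mono:
  assumes p: "0 < p" and "p \<le> \<xi>" "\<xi> < \<zeta>" shows "rise p \<xi> < rise p \<zeta>"
proof -
  define s where "s = exit_time (p / \<xi>)"
  define t where "t = exit_time (p / \<zeta>)"
  have u: "0 < p / \<zeta>" "p / \<zeta> < p / \<xi>" "p / \<xi> \<le> 1" using assms by (auto simp: frac_less2 divide_le_eq)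
  then have st: "s < t" unfolding s_def t_def by (intro exit_time_strict) auto
  have s: "0 \<le> s" "s \<le> t0" "C s = p / \<xi>" and t: "0 \<le> t" "t \<le> t0" "C t = p / \<zeta>"
    unfolding s_def t_def using exit_time[of "p / \<xi>"] exit_time[of "p / \<zeta>"] u by auto
  have "t < t0" using t u C_t0 by (auto simp: less_le)
  have "S s / C s < S t / C t"
  proof (rule DERIV_pos_imp_increasing[OF st])
    fix v assume v: "s \<le> v" "v \<le> t"
    then have Cv: "C v > 0" using C_pos[of v] s \<open>t < t0\<close> by simp
    have "((\<lambda>v. S v / C v) has_real_derivative ((C v + \<sigma> * S v) * C v - S v * - S v) / (C v * C v)) (at v)"
      using Cv by (intro DERIV_divide S_deriv C_deriv) simp
    moreover have "(C v + \<sigma> * S v) * C v - S v * - S v = exp (2 * v * cos \<theta>)"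
      unfolding wronskian[symmetric] by (simp add: power2_eq_square algebra_simps)
    ultimately show "\<exists>y. ((\<lambda>v. S v / C v) has_real_derivative y) (at v) \<and> y > 0"
      using Cv by (intro exI[of _ "((C v + \<sigma> * S v) * C v - S v * - S v) / (C v * C v)"]) simp
  qed
  then have "p * (S s / C s) < p * (S t / C t)" using p by (rule mult_strict_left_mono)
  moreover have "p * (S s / C s) = rise p \<xi>" "p * (S t / C t) = rise p \<zeta>"
    using s t u assms by (simp_all add: rise_def s_def[symmetric] t_def[symmetric] mult.commute)
  ultimately show ?thesis by simp
qed

text \<open>As \<open>p / \<xi>\<close> tends to 0 the exit time tends to \<open>t0\<close>, so the
  ratio tends to \<open>S t0\<close>: seen from far away, the line x = p is the y-axis.\<close>

lemma rise_asymptotic: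
  assumes p: "0 \<le> p" shows "((\<lambda>\<xi>. rise p \<xi> / \<xi>) \<longlongrightarrow> exp (\<theta> * cos \<theta> / sin \<theta>)) at_top"
proof -
  have "exit_time 0 = t0" using exit_time_C[of t0] C_t0 t0 by simp
  have lim: "((\<lambda>\<xi>. p / \<xi>) \<longlongrightarrow> 0) at_top"
    by (rule tendsto_divide_0[OF tendsto_const filterlim_at_top_imp_at_infinity[OF filterlim_ident]])
  have "(exit_time \<longlongrightarrow> exit_time 0) (at 0 within {0..1})"
    using continuous_on_exit_time by (simp add: continuous_on_def)
  moreover have ev: "\<forall>\<^sub>F \<xi> in at_top. p / \<xi> \<in> {0..1}"
    using eventually_gt_at_top[of "max p 0"] by eventually_elim (use p in \<open>auto simp: divide_le_eq\<close>)
  ultimately have "((\<lambda>\<xi>. exit_time (p / \<xi>)) \<longlongrightarrow> t0) at_top"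
    using continuous_within_tendsto_compose[of 0 "{0..1}" exit_time "\<lambda>\<xi>. p / \<xi>" at_top, OF _ ev lim]
    by (simp add: continuous_within \<open>exit_time 0 = t0\<close>)
  then have "((\<lambda>\<xi>. S (exit_time (p / \<xi>))) \<longlongrightarrow> S t0) at_top"
    by (rule isCont_tendsto_compose[OF isCont_S])
  moreover have "\<forall>\<^sub>F \<xi> in at_top. S (exit_time (p / \<xi>)) = rise p \<xi> / \<xi>"
    using eventually_gt_at_top[of 0] by eventually_elim (simp add: rise_def)
  ultimately show ?thesis unfolding S_t0 by (rule Lim_transform_eventually)
qed

end

section \<open>Descending arcs\<close>

text \<open>The abscissa of z itself is exempt, as F takes an intermediate value at a jump. The
  uniform margin e makes both one-sided limits strictly smaller than the ordinate.\<close>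

definition strictly_above :: "(real \<Rightarrow> real) \<Rightarrow> real \<times> real \<Rightarrow> bool" where
  "strictly_above G z \<longleftrightarrow> (\<exists>e>0. \<forall>x. x \<noteq> fst z \<and> \<bar>x - fst z\<bar> < e \<longrightarrow> G x + e < snd z)"

abbreviation ode_arc :: "(real \<Rightarrow> real) \<Rightarrow> real \<Rightarrow> real \<times> real \<Rightarrow> real \<times> real \<Rightarrow> (real \<times> real) set \<Rightarrow> bool" where
  "ode_arc G b \<equiv> arc_of (\<lambda>z v. fst z < b \<and> isCont G (fst z) \<and> v = lienard_field G z)"

text \<open>The invariant passed on from node to node. The bound K makes the part of the plane left
  of p negligible for orbits from far away; analyticity stops short of Y, at which the orbit may be
  tangent to x = p.\<close>

definition descent :: "(real \<Rightarrow> real) \<Rightarrow> real \<Rightarrow> real \<Rightarrow> (real \<Rightarrow> real) \<Rightarrow> bool" where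
  "descent G p Y A \<longleftrightarrow> 0 \<le> p \<and>
     (\<forall>y\<ge>Y. \<exists>W. ode_arc G p (p, y) (0, A y) W \<and>
        (\<forall>z\<in>W. z = (p, y) \<or> 0 \<le> fst z \<and> fst z < p \<and> strictly_above G z) \<and>
        (\<forall>z\<in>W. fst z = 0 \<longrightarrow> z = (0, A y))) \<and>
     strict_mono_on {Y..} A \<and> continuous_on {Y..} A \<and> (\<forall>y>Y. real_analytic_at A y) \<and>
     (\<exists>K. \<forall>y\<ge>Y. y \<le> A y \<and> A y \<le> y + K)"

lemma strictly_above_isCont:
  assumes "isCont G (fst z)" "G (fst z) < snd z" shows "strictly_above G z"
proof -
  define e where "e = (snd z - G (fst z)) / 2"
  have e: "e > 0" using assms(2) by (simp add: e_def)
  then obtain d where d: "d > 0" "\<And>x. \<bar>x - fst z\<bar> < d \<Longrightarrow> \<bar>G x - G (fst z)\<bar> < e"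
    using assms(1) unfolding continuous_at_eps_delta by (metis dist_real_def)
  show ?thesis unfolding strictly_above_def
  proof (intro exI[of _ "min d e"] conjI allI impI)
    fix x assume "x \<noteq> fst z \<and> \<bar>x - fst z\<bar> < min d e"
    then have "\<bar>G x - G (fst z)\<bar> < e" using d by simp
    then have "G x < G (fst z) + e" by linarith
    also have "G (fst z) + e = snd z - e" by (simp add: e_def field_simps)
    finally show "G x + min d e < snd z" by linarith
  qed (use d e in auto)
qed

lemma strictly_above_cong:
  assumes "\<And>x. x < b \<Longrightarrow> G x = G' x" "fst z < b" "strictly_above G z" shows "strictly_above G' z"
proof -
  obtain e where e: "e > 0" "\<And>x. x \<noteq> fst z \<Longrightarrow> \<bar>x - fst z\<bar> < e \<Longrightarrow> G x + e < snd z"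
    using assms(3) unfolding strictly_above_def by blast
  show ?thesis unfolding strictly_above_def
  proof (intro exI[of _ "min e (b - fst z)"] conjI allI impI)
    fix x assume x: "x \<noteq> fst z \<and> \<bar>x - fst z\<bar> < min e (b - fst z)"
    then have "x < b" by linarith
    then show "G' x + min e (b - fst z) < snd z" using e(2)[of x] x assms(1)[of x] by linarith
  qed (use e assms in auto)
qed

lemma ode_arc_cong:
  assumes eq: "\<And>x. x < b \<Longrightarrow> G x = G' x" and arc: "ode_arc G b p r W"
  shows "ode_arc G' b p r W"
proof (rule arc_of_mono[OF arc])
  fix z v assume *: "fst z < b \<and> isCont G (fst z) \<and> v = lienard_field G z"
  have "\<forall>\<^sub>F x in nhds (fst z). x \<in> {..<b}" using * by (intro eventually_nhds_in_open) auto
  then have "\<forall>\<^sub>F x in nhds (fst z). G x = G' x" by eventually_elim (simp add: eq)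
  then have "isCont G' (fst z)" using * isCont_cong by blast
  then show "fst z < b \<and> isCont G' (fst z) \<and> v = lienard_field G' z"
    using * eq by (simp add: lienard_field_def case_prod_unfold)
qed

lemma ode_arc_weaken: "ode_arc G b p r W \<Longrightarrow> b \<le> b' \<Longrightarrow> ode_arc G b' p r W"
  by (erule arc_of_mono) auto

lemma ode_arc_filippov_arc: "ode_arc G b p r W \<Longrightarrow> filippov_arc G p r W"
  by (erule arc_of_mono) (simp add: filippov_map_isCont isCont_lienard_field)

lemma descent_cong:
  assumes eq: "\<And>x. x < p \<Longrightarrow> G x = G' x" and d: "descent G p Y A"
  shows "descent G' p Y A"
proof -
  have "\<exists>W. ode_arc G' p (p, y) (0, A y) W \<and>
        (\<forall>z\<in>W. z = (p, y) \<or> 0 \<le> fst z \<and> fst z < p \<and> strictly_above G' z) \<and> (\<forall>z\<in>W. fst z = 0 \<longrightarrow> z = (0, A y))"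
    if "y \<ge> Y" for y
  proof -
    obtain W where W: "ode_arc G p (p, y) (0, A y) W" "\<forall>z\<in>W. z = (p, y) \<or> 0 \<le> fst z \<and> fst z < p \<and> strictly_above G z"
      "\<forall>z\<in>W. fst z = 0 \<longrightarrow> z = (0, A y)" using d \<open>y \<ge> Y\<close> unfolding descent_def by blast
    have arc: "ode_arc G' p (p, y) (0, A y) W"
      by (rule ode_arc_cong[of p G G', OF _ W(1)]) (rule eq)
    have "strictly_above G' z" if "fst z < p" "strictly_above G z" for z
      by (rule strictly_above_cong[of p G G', OF _ that]) (rule eq)
    then have "\<forall>z\<in>W. z = (p, y) \<or> 0 \<le> fst z \<and> fst z < p \<and> strictly_above G' z" using W(2) by blast
    then show ?thesis by (intro exI[of _ W] conjI arc W(3))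
  qed
  then have "\<forall>y\<ge>Y. \<exists>W. ode_arc G' p (p, y) (0, A y) W \<and>
        (\<forall>z\<in>W. z = (p, y) \<or> 0 \<le> fst z \<and> fst z < p \<and> strictly_above G' z) \<and> (\<forall>z\<in>W. fst z = 0 \<longrightarrow> z = (0, A y))"
    by (intro allI impI)
  with d show ?thesis unfolding descent_def by (elim conjE) (intro conjI)
qed

lemma descentD:
  assumes "descent G p Y A"
  shows "0 \<le> p" "strict_mono_on {Y..} A" "continuous_on {Y..} A" "\<And>y. y > Y \<Longrightarrow> real_analytic_at A y"
    "\<exists>K. \<forall>y\<ge>Y. y \<le> A y \<and> A y \<le> y + K"
proof -
  note d = assms[unfolded descent_def]
  from d show "0 \<le> p" by (elim conjE)
  from d show "strict_mono_on {Y..} A" by (elim conjE)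
  from d show "continuous_on {Y..} A" by (elim conjE)
  from d show "real_analytic_at A y" if "y > Y" for y using that by (elim conjE) simp
  from d show "\<exists>K. \<forall>y\<ge>Y. y \<le> A y \<and> A y \<le> y + K" by (elim conjE)
qed

lemma descent_mono:
  assumes d: "descent G p Y A" and Y: "Y \<le> Y'"
  shows "descent G p Y' A"
proof -
  note sm = descentD(2)[OF d] and co = descentD(3)[OF d]
  obtain K where K: "\<forall>y\<ge>Y. y \<le> A y \<and> A y \<le> y + K" using descentD(5)[OF d] ..
  have "strict_mono_on {Y'..} A" using sm Y by (simp add: strict_mono_on_def)
  moreover have "continuous_on {Y'..} A" using co Y by (rule_tac continuous_on_subset) auto
  moreover have "\<exists>K. \<forall>y\<ge>Y'. y \<le> A y \<and> A y \<le> y + K" using K Y by (intro exI[of _ K]) simp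
  ultimately show ?thesis using d Y unfolding descent_def by (elim conjE) (intro conjI allI impI; simp)
qed

lemma descent_id:
  assumes "isCont G 0" "G 0 = 0" shows "descent G 0 0 (\<lambda>y. y)"
  unfolding descent_def
proof (intro conjI allI impI)
  show "\<exists>W. ode_arc G 0 (0, y) (0, y) W \<and> (\<forall>z\<in>W. z = (0, y) \<or> 0 \<le> fst z \<and> fst z < 0 \<and> strictly_above G z) \<and> (\<forall>z\<in>W. fst z = 0 \<longrightarrow> z = (0, y))" for y
    by (rule exI[of _ "{(0, y)}"]) (auto intro: arc_of_refl)
  show "\<exists>K. \<forall>y\<ge>0. y \<le> y \<and> y \<le> y + (K::real)" by (rule exI[of _ 0]) simp
qed (auto intro: real_analytic_at_ident strict_mono_onI)

text \<open>The transit through the new strip is put in front of A. The new threshold is the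
  nullcline on x = q; the orbit starting there is tangent to x = q and arrives lowest on x = p, so
  it is the one that must clear the old threshold. \<open>clear\<close> takes care of the junction
  on x = p, where G may jump.\<close>

lemma (in zone) descent_strip:
  assumes d: "descent G p Y A" and clear: "\<And>y. Y < y \<Longrightarrow> strictly_above G (p, y)"
    and G: "\<And>x. p < x \<Longrightarrow> x < q \<Longrightarrow> G x = c + \<sigma> * x"
    and pq: "p < q" and Y: "Y < c + \<sigma> * p + rise p q"
  obtains B where "descent G q (c + \<sigma> * q) B" "B (c + \<sigma> * q) = A (c + \<sigma> * p + rise p q)"
proof -
  have p: "0 \<le> p" and A: "\<And>y. y \<ge> Y \<Longrightarrow> \<exists>W. ode_arc G p (p, y) (0, A y) W \<and>
        (\<forall>z\<in>W. z = (p, y) \<or> 0 \<le> fst z \<and> fst z < p \<and> strictly_above G z) \<and> (\<forall>z\<in>W. fst z = 0 \<longrightarrow> z = (0, A y))"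
    and Amono: "strict_mono_on {Y..} A" and Acont: "continuous_on {Y..} A" and Ara: "\<And>y. y > Y \<Longrightarrow> real_analytic_at A y"
    and "\<exists>K. \<forall>y\<ge>Y. y \<le> A y \<and> A y \<le> y + K"
    using d unfolding descent_def by blast+
  then obtain K where K: "\<And>y. y \<ge> Y \<Longrightarrow> y \<le> A y \<and> A y \<le> y + K" by blast
  obtain M where M: "\<And>w. w \<ge> 0 \<Longrightarrow> \<exists>t. 0 < t \<and> t \<le> t0 \<and> strip_in q p t = w \<and> M w = strip_out c q p t"
    "strict_mono_on {0..} M" "continuous_on {0..} M" "\<And>w. w > 0 \<Longrightarrow> real_analytic_at M w"
    using strip_map[OF p pq, of c] by metis
  \<comment> \<open>Excess 0 is the orbit tangent to x = q, whose exit height is given by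
    \<open>rise\<close>; the Wronskian identity reduces one formula to the other.\<close>
  have M0: "M 0 = c + \<sigma> * p + rise p q"
  proof -
    obtain t where t: "0 < t" "t \<le> t0" "strip_in q p t = 0" "M 0 = strip_out c q p t" using M(1)[of 0] by auto
    have St: "S t > 0" using S_pos[of t] t t0 by simp
    have Ct: "q * C t = p" using t(3) St by (simp add: strip_in_def[OF p pq])
    then have "C t = p / q" using pq p by (simp add: field_simps)
    then have "exit_time (p / q) = t" using exit_time_C[of t] t by simp
    then have r: "rise p q = q * S t" by (simp add: rise_def)
    have "q * exp (2 * t * cos \<theta>) - p * C t = q * C t * (C t + \<sigma> * S t) + q * (S t)\<^sup>2 - p * C t"
      unfolding wronskian[symmetric] by (simp add: algebra_simps)
    also have "\<dots> = S t * (\<sigma> * p + q * S t)" unfolding Ct by (simp add: power2_eq_square algebra_simps)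
    finally show ?thesis using t(4) St r by (simp add: strip_out_def[OF p pq])
  qed
  have MY: "Y < M w" if "w \<ge> 0" for w
    using that M0 Y strict_mono_onD[OF M(2), of 0 w] by (cases "w = 0") auto
  define g where "g y = y - (c + \<sigma> * q)" for y
  define B where "B y = A (M (g y))" for y
  have g0: "g y \<ge> 0" if "y \<ge> c + \<sigma> * q" for y using that by (simp add: g_def)
  show thesis
  proof (rule that[of B])
    show "B (c + \<sigma> * q) = A (c + \<sigma> * p + rise p q)" by (simp add: B_def g_def M0)
    show "descent G q (c + \<sigma> * q) B"
      unfolding descent_def
    proof (intro conjI allI impI)
      show "0 \<le> q" using p pq by simp
      show "strict_mono_on {c + \<sigma> * q..} B"
      proof (rule strict_mono_onI)
        fix y y' assume y: "y \<in> {c + \<sigma> * q..}" "y' \<in> {c + \<sigma> * q..}" "y < y'"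
        then have "M (g y) < M (g y')" using g0 by (intro strict_mono_onD[OF M(2)]) (auto simp: g_def)
        then show "B y < B y'" unfolding B_def using MY[of "g y"] MY[of "g y'"] g0 y
          by (intro strict_mono_onD[OF Amono]) auto
      qed
      show "continuous_on {c + \<sigma> * q..} B"
        unfolding B_def
      proof (rule continuous_on_compose2[OF Acont], rule continuous_on_compose2[OF M(3)])
        show "continuous_on {c + \<sigma> * q..} g" unfolding g_def by (intro continuous_intros)
        show "g ` {c + \<sigma> * q..} \<subseteq> {0..}" using g0 by auto
        show "(\<lambda>y. M (g y)) ` {c + \<sigma> * q..} \<subseteq> {Y..}" using MY g0 by (force intro: less_imp_le)
      qed
      show "real_analytic_at B y" if "y > c + \<sigma> * q" for y
      proof -
        have "real_analytic_at g y" unfolding g_def by (intro real_analytic_at_diff real_analytic_at_ident real_analytic_at_const)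
        moreover have "g y > 0" using that by (simp add: g_def)
        ultimately have "real_analytic_at (\<lambda>y. M (g y)) y" using M(4) real_analytic_at_compose[of g y M] by simp
        then show ?thesis unfolding B_def using Ara MY[of "g y"] \<open>g y > 0\<close> real_analytic_at_compose[of "\<lambda>y. M (g y)" y A] by simp
      qed
      have strip: "\<exists>W. ode_arc G q (q, y) (p, M (g y)) W \<and>
          (\<forall>z\<in>W. z = (q, y) \<or> z = (p, M (g y)) \<or> (p < fst z \<and> fst z < q \<and> c + \<sigma> * fst z < snd z))"
        and bd: "y \<le> M (g y)" "M (g y) \<le> y + q * h" if y: "y \<ge> c + \<sigma> * q" for y
      proof -
        obtain t where t: "0 < t" "t \<le> t0" "strip_in q p t = g y" "M (g y) = strip_out c q p t" using M(1)[OF g0[OF y]] by auto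
        have eq: "c + \<sigma> * q + strip_in q p t = y" using t(3) by (simp add: g_def)
        have nn: "strip_in q p t \<ge> 0" using t(3) g0[OF y] by simp
        note * = strip_arc[OF p pq t(1,2) nn, where F = G and c = c, unfolded eq t(4)[symmetric]]
        show "\<exists>W. ode_arc G q (q, y) (p, M (g y)) W \<and>
          (\<forall>z\<in>W. z = (q, y) \<or> z = (p, M (g y)) \<or> (p < fst z \<and> fst z < q \<and> c + \<sigma> * fst z < snd z))"
          using *(1) G by blast
        show "y \<le> M (g y)" "M (g y) \<le> y + q * h" using *(2,3) G by blast+
      qed
      show "\<exists>K. \<forall>y\<ge>c + \<sigma> * q. y \<le> B y \<and> B y \<le> y + K"
      proof (intro exI[of _ "q * h + K"] allI impI)
        fix y assume y: "c + \<sigma> * q \<le> y"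
        then show "y \<le> B y \<and> B y \<le> y + (q * h + K)"
          unfolding B_def using bd[OF y] K[of "M (g y)"] MY[OF g0[OF y]] by linarith
      qed
      fix y assume y: "c + \<sigma> * q \<le> y"
      obtain V where V: "ode_arc G q (q, y) (p, M (g y)) V"
          "\<And>z. z \<in> V \<Longrightarrow> z = (q, y) \<or> z = (p, M (g y)) \<or> (p < fst z \<and> fst z < q \<and> c + \<sigma> * fst z < snd z)"
        using strip[OF y] by blast
      have MYy: "Y < M (g y)" using MY[OF g0[OF y]] .
      then obtain W where W: "ode_arc G p (p, M (g y)) (0, B y) W"
        "\<And>z. z \<in> W \<Longrightarrow> z = (p, M (g y)) \<or> 0 \<le> fst z \<and> fst z < p \<and> strictly_above G z" "\<And>z. z \<in> W \<Longrightarrow> fst z = 0 \<Longrightarrow> z = (0, B y)"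
        using A[of "M (g y)"] unfolding B_def by (meson less_imp_le)
      have arc: "ode_arc G q (q, y) (0, B y) (V \<union> W)"
        using V(1) ode_arc_weaken[OF W(1)] pq by (intro arc_of_trans[of _ "(q, y)" "(p, M (g y))"]) auto
      have ab: "strictly_above G z" if "p < fst z" "fst z < q" "c + \<sigma> * fst z < snd z" for z
      proof (rule strictly_above_isCont)
        have "\<forall>\<^sub>F x in nhds (fst z). x \<in> {p<..<q}" using that by (intro eventually_nhds_in_open) auto
        then have "\<forall>\<^sub>F x in nhds (fst z). G x = c + \<sigma> * x" by eventually_elim (simp add: G)
        then show "isCont G (fst z)" using isCont_cong[of G "\<lambda>x. c + \<sigma> * x"] by simp
        show "G (fst z) < snd z" using that G by simp
      qed
      have 1: "\<forall>z\<in>V \<union> W. z = (q, y) \<or> 0 \<le> fst z \<and> fst z < q \<and> strictly_above G z"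
      proof
        fix z assume "z \<in> V \<union> W"
        then consider "z = (q, y)" | "z = (p, M (g y))" | "p < fst z" "fst z < q" "c + \<sigma> * fst z < snd z"
           | "0 \<le> fst z" "fst z < p" "strictly_above G z" using V(2) W(2) by blast
        then show "z = (q, y) \<or> 0 \<le> fst z \<and> fst z < q \<and> strictly_above G z"
          by cases (use p pq clear[OF MYy] ab in auto)
      qed
      have 2: "\<forall>z\<in>V \<union> W. fst z = 0 \<longrightarrow> z = (0, B y)"
      proof (intro ballI impI)
        fix z assume z: "z \<in> V \<union> W" "fst z = 0"
        show "z = (0, B y)"
        proof (cases "z \<in> W")
          case True
          show ?thesis by (rule W(3)[OF True z(2)])
        next
          case False
          then have "z = (p, M (g y))" using V(2)[of z] z p pq by auto
          then have "z \<in> W" using arc_of_image(3)[OF W(1)] by simp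
          then show ?thesis using False by blast
        qed
      qed
      show "\<exists>W. ode_arc G q (q, y) (0, B y) W \<and>
        (\<forall>z\<in>W. z = (q, y) \<or> 0 \<le> fst z \<and> fst z < q \<and> strictly_above G z) \<and> (\<forall>z\<in>W. fst z = 0 \<longrightarrow> z = (0, B y))"
        by (intro exI[of _ "V \<union> W"] conjI arc 1 2)
    qed
  qed
qed

section \<open>Periodic orbits around the origin\<close>

lemma zone_60: "zone (pi / 3)"
  by unfold_locales auto

text \<open>Ratio of the distances from the origin after and before the half turn in x < 0, where
  the slope is 1 = 2 cos(pi/3).\<close>

definition left_factor :: real where
  "left_factor = exp (pi * cos (pi / 3) / sin (pi / 3))"

lemma left_factor_pos: "left_factor > 0"
  by (simp add: left_factor_def)

lemma left_arc:
  assumes F: "\<And>x. x < 0 \<Longrightarrow> F x = x" and y: "y > 0"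
  shows "\<exists>W. ode_arc F 0 (0, y) (0, - (left_factor * y)) W \<and>
    (\<forall>z\<in>W. z = (0, y) \<or> z = (0, - (left_factor * y)) \<or> fst z < 0)"
proof -
  interpret zone "pi / 3" by (rule zone_60)
  define X where "X t = 0 * C t + (- y) * S t" for t
  define Y where "Y t = 0 + 0 * (\<sigma> * C t + S t) - (- y) * C t" for t
  have X: "X t < 0" if "0 < t" "t < h" for t using S_pos[OF that] y by (simp add: X_def)
  have arc: "ode_arc F 0 (X 0, Y 0) (X h, Y h) ((\<lambda>t. (X t, Y t)) ` {0..h})"
    unfolding X_def Y_def
    by (rule zone_arc[where D = "{..<0}"]) (use t0 F X in \<open>auto simp: X_def cos_60\<close>)
  have ends: "X 0 = 0" "Y 0 = y" "X h = 0" "Y h = - (left_factor * y)"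
    using \<theta> at_h by (simp_all add: X_def Y_def left_factor_def)
  have "\<forall>z\<in>(\<lambda>t. (X t, Y t)) ` {0..h}. z = (0, y) \<or> z = (0, - (left_factor * y)) \<or> fst z < 0"
  proof (rule ballI, elim imageE)
    fix z t assume z: "z = (X t, Y t)" "t \<in> {0..h}"
    consider "t = 0" | "t = h" | "0 < t" "t < h" using z by force
    then show "z = (0, y) \<or> z = (0, - (left_factor * y)) \<or> fst z < 0"
      using z ends X[of t] by cases auto
  qed
  then show ?thesis using arc unfolding ends by blast
qed

lemma has_vector_derivative_snd:
  assumes "(g has_vector_derivative v) (at t)"
  shows "((\<lambda>t. snd (g t)) has_real_derivative snd v) (at t)"
  using bounded_linear.has_vector_derivative[OF bounded_linear_snd assms]
  by (simp add: has_real_derivative_iff_has_vector_derivative)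

text \<open>Integrated form of y' = x, obtained from the monotonicity lemma since the equation holds
  only almost everywhere. The sign s treats both half planes at once.\<close>

lemma filippov_on_snd_affine:
  assumes g: "filippov_on F g a b" and s: "s = 1 \<or> s = (-1::real)" and ab: "a < b"
    and m: "m \<ge> 0" "\<And>t. a < t \<Longrightarrow> t < b \<Longrightarrow> m \<le> s * fst (g t)"
  shows "s * snd (g a) + m * (b - a) \<le> s * snd (g b)"
proof -
  define k where "k t = m * t - s * snd (g t)" for t
  obtain N where N: "negligible N" "\<And>t. a < t \<Longrightarrow> t < b \<Longrightarrow> t \<notin> N \<Longrightarrow>
      \<exists>v\<in>filippov_map (lienard_field F) (g t). (g has_vector_derivative v) (at t)"
    using g by (auto simp: filippov_on_def)
  have acg: "absolutely_continuous_fun_on {a..b} g" using g by (simp add: filippov_on_def)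
  have ack: "absolutely_continuous_fun_on {a..b} k"
  proof (rule absolutely_continuous_fun_on_dominated[OF acg absolutely_continuous_fun_on_const[of _ "0::real"], of "m + 1"])
    show "0 \<le> m + 1" using m by simp
    fix u v
    have "norm (k v - k u) \<le> m * \<bar>v - u\<bar> + \<bar>snd (g v) - snd (g u)\<bar>"
    proof -
      have "k v - k u = m * (v - u) - s * (snd (g v) - snd (g u))" by (simp add: k_def algebra_simps)
      then have "norm (k v - k u) \<le> \<bar>m * (v - u)\<bar> + \<bar>s * (snd (g v) - snd (g u))\<bar>" by (simp only: real_norm_def abs_triangle_ineq4)
      moreover have "\<bar>m * (v - u)\<bar> = m * \<bar>v - u\<bar>" using m by (simp add: abs_mult)
      moreover have "\<bar>s * (snd (g v) - snd (g u))\<bar> = \<bar>snd (g v) - snd (g u)\<bar>" using s by (auto simp: abs_mult)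
      ultimately show ?thesis by simp
    qed
    also have "\<bar>snd (g v) - snd (g u)\<bar> \<le> norm (g v - g u)" by (metis norm_snd_le prod.collapse real_norm_def snd_diff)
    also have "m * \<bar>v - u\<bar> + norm (g v - g u) \<le> (m + 1) * (norm (g v - g u) + norm (0 - 0 :: real) + \<bar>v - u\<bar>)"
      using m by (simp add: algebra_simps)
    finally show "norm (k v - k u) \<le> (m + 1) * (norm (g v - g u) + norm (0 - 0 :: real) + \<bar>v - u\<bar>)" by simp
  qed
  have "k b \<le> k a"
  proof (rule absolutely_continuous_nonincreasing[OF less_imp_le[OF ab] ack N(1)])
    fix t assume t: "a < t" "t < b" "t \<notin> N"
    then obtain v where v: "v \<in> filippov_map (lienard_field F) (g t)" "(g has_vector_derivative v) (at t)" using N(2) by blast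
    have "snd v = fst (g t)" using v(1) by (rule filippov_map_lienard_snd)
    then have "((\<lambda>t. snd (g t)) has_real_derivative fst (g t)) (at t)" using has_vector_derivative_snd[OF v(2)] by simp
    then have "(k has_real_derivative m - s * fst (g t)) (at t)"
      unfolding k_def by (auto intro!: derivative_eq_intros)
    then show "\<exists>D\<le>0. (k has_real_derivative D) (at t)" using m(2)[OF t(1,2)] by (intro exI[of _ "m - s * fst (g t)"]) simp
  qed
  then show ?thesis by (simp add: k_def algebra_simps)
qed

lemma periodic_solution_continuous:
  assumes "periodic_solution F g" shows "isCont g t"
proof -
  have "absolutely_continuous_fun_on {t - 1..t + 1} g"
    using assms by (simp add: periodic_solution_def filippov_solution_def)
  then have "continuous_on {t - 1..t + 1} g" by (rule absolutely_continuous_fun_on_imp_continuous)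
  then show ?thesis by (rule continuous_on_interior) simp
qed

text \<open>The second coordinate is a primitive of the first one, so its minimum is attained on the
  y-axis.\<close>

lemma periodic_orbit_meets_bottom:
  assumes ds: "downward_system F P" and per: "periodic_orbit F \<Gamma>"
  shows "\<exists>w>0. (0, - w) \<in> \<Gamma>"
proof -
  obtain L where L: "one_sided_lipschitz L F" using ds by (rule downward_systemE)
  have F: "F x = x" if "x \<le> 0" for x using ds that by (simp add: downward_system_def)
  obtain g where g: "periodic_solution F g" "\<Gamma> = range g" using per by (auto simp: periodic_orbit_def)
  then have sol: "filippov_solution (lienard_field F) g" by (simp add: periodic_solution_def)
  have on: "filippov_on F g a b" for a b using filippov_solution_imp_on[OF sol] .
  have "compact \<Gamma>" "\<Gamma> \<noteq> {}" using periodic_orbit_compact[OF per] g by auto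
  then have "compact (snd ` \<Gamma>)" "snd ` \<Gamma> \<noteq> {}" by (auto intro!: compact_continuous_image continuous_intros)
  then obtain y where "y \<in> snd ` \<Gamma>" "\<forall>u\<in>snd ` \<Gamma>. y \<le> u" using compact_attains_inf by blast
  then obtain t where "snd (g t) = y" using g(2) by blast
  then have t: "snd (g t) \<le> snd (g u)" for u using \<open>\<forall>u\<in>snd ` \<Gamma>. y \<le> u\<close> g(2) by blast
  have x0: "fst (g t) = 0"
  proof (rule ccontr)
    assume "fst (g t) \<noteq> 0"
    define s where "s = sgn (fst (g t))"
    define m where "m = \<bar>fst (g t)\<bar> / 2"
    have s: "s = 1 \<or> s = -1" and m: "m > 0" "s * fst (g t) = 2 * m" 
      using \<open>fst (g t) \<noteq> 0\<close> by (auto simp: s_def m_def sgn_if)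
    have "isCont (\<lambda>u. s * fst (g u)) t" using periodic_solution_continuous[OF g(1)] by (intro continuous_intros) auto
    then obtain d where d: "d > 0" "\<And>u. \<bar>u - t\<bar> < d \<Longrightarrow> \<bar>s * fst (g u) - s * fst (g t)\<bar> < m"
      unfolding continuous_at_eps_delta dist_real_def using m(1) by (metis (no_types, lifting))
    then have ge: "m \<le> s * fst (g u)" if "\<bar>u - t\<bar> < d" for u using that m(2) by (fastforce simp: abs_less_iff)
    from s show False
    proof
      assume s: "s = 1"
      have "s * snd (g (t - d / 2)) + m * (t - (t - d / 2)) \<le> s * snd (g t)"
        by (rule filippov_on_snd_affine[OF on]) (use s m d ge in auto)
      moreover have "m * (t - (t - d / 2)) > 0" using m(1) d(1) by simp
      ultimately have "snd (g (t - d / 2)) < snd (g t)" unfolding s by linarith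
      then show False using t[of "t - d / 2"] by simp
    next
      assume s: "s = -1"
      have "s * snd (g t) + m * ((t + d / 2) - t) \<le> s * snd (g (t + d / 2))"
        by (rule filippov_on_snd_affine[OF on]) (use s m d ge in auto)
      moreover have "m * ((t + d / 2) - t) > 0" using m(1) d(1) by simp
      ultimately have "snd (g (t + d / 2)) < snd (g t)" unfolding s by linarith
      then show False using t[of "t + d / 2"] by simp
    qed
  qed
  define y where "y = snd (g t)"
  have gt: "g t = (0, y)" using x0 by (simp add: y_def prod_eq_iff)
  then have y\<Gamma>: "(0, y) \<in> \<Gamma>" using g(2) by (metis rangeI)
  have ymin: "y \<le> u" if "(0, u) \<in> \<Gamma>" for u
    using that t g(2) unfolding y_def by (metis imageE snd_conv)
  \<comment> \<open>A positive minimum is excluded by following the left half turn to a negative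
    ordinate; a zero minimum would put the orbit at the equilibrium, where uniqueness and
    periodicity make it constant.\<close>
  consider "y < 0" | "y > 0" | "y = 0" by linarith
  then show ?thesis
  proof cases
    case 1 then show ?thesis using y\<Gamma> by (intro exI[of _ "- y"]) simp
  next
    case 2
    obtain W where W: "ode_arc F 0 (0, y) (0, - (left_factor * y)) W" using left_arc[of F y] F 2 by auto
    have "W \<subseteq> \<Gamma>" using periodic_orbit_follow[OF L per y\<Gamma> ode_arc_filippov_arc[OF W]] .
    then have "(0, - (left_factor * y)) \<in> \<Gamma>" using arc_of_image(4)[OF W] by blast
    then have "y \<le> - (left_factor * y)" by (rule ymin)
    moreover have "left_factor * y > 0" using 2 left_factor_pos by simp
    ultimately show ?thesis using 2 by simp
  next
    case 3
    have "0 \<notin> P" using ds by (auto simp: downward_system_def)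
    then have "isCont F 0" using ds by (simp add: downward_system_def)
    then have "lienard_field F (0, 0) \<in> filippov_map (lienard_field F) (0, 0)"
      by (intro filippov_map_isCont isCont_lienard_field) simp
    then have z: "0 \<in> filippov_map (lienard_field F) (0, 0)" using F[of 0] by (simp add: lienard_field_def zero_prod_def)
    have const: "filippov_on F (\<lambda>_. (0, 0)) 0 u" for u
      unfolding filippov_on_def
      by (intro conjI absolutely_continuous_fun_on_const exI[of _ "{}"] allI impI bexI[OF _ z] has_vector_derivative_const) simp
    have pos: "g (u + t) = (0, 0)" if "u \<ge> 0" for u
    proof -
      have "(0, 0) = g (u + t)"
        by (rule filippov_unique[OF L that const filippov_on_shift[OF on]]) (use gt 3 in simp)
      then show ?thesis by simp
    qed
    obtain T where T: "T > 0" "\<And>t. g (t + T) = g t" using g(1) by (auto simp: periodic_solution_def)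
    have "g u = (0, 0)" for u
    proof -
      have Tn: "g (u + real n * T) = g u" for n
      proof (induction n)
        case (Suc n)
        have "g (u + real (Suc n) * T) = g ((u + real n * T) + T)" by (simp add: algebra_simps)
        then show ?case using Suc T(2) by simp
      qed simp
      obtain n :: nat where "(t - u) / T < real n" using reals_Archimedean2 by blast
      then have "0 \<le> u + real n * T - t" using T(1) by (simp add: field_simps)
      from pos[OF this] Tn[of n] show ?thesis by simp
    qed
    then show ?thesis using g(1) by (auto simp: periodic_solution_def)
  qed
qed

text \<open>A periodic orbit inside the neighbourhood \<open>U\<close> meets the negative y-axis only near the fixed
  point \<open>z r = T r\<close> of the return map \<open>z s \<mapsto> T s\<close>. The set of its intersection points there is
  compact and invariant, hence contains the only fixed point.\<close>

lemma isolated_periodic_orbit: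
  fixes z T :: "real \<Rightarrow> real"
  assumes L: "one_sided_lipschitz L F"
    and bottom: "\<And>\<Gamma>. periodic_orbit F \<Gamma> \<Longrightarrow> \<exists>w>0. (0, - w) \<in> \<Gamma>"
    and r: "a < r" "r < b" "z r = T r" "\<And>s. s \<in> {a..b} \<Longrightarrow> z s = T s \<Longrightarrow> s = r"
    and cont: "continuous_on {a..b} z" "continuous_on {a..b} T"
    and mono: "strict_mono_on {a..b} z" "strict_mono_on {a..b} T" and pos: "0 < z a" "0 < T a"
    and arcs: "\<And>s. s \<in> {a..b} \<Longrightarrow> \<exists>W. filippov_arc F (0, - z s) (0, - T s) W"
    and \<Gamma>: "periodic_orbit F \<Gamma>" "(0, - z r) \<in> \<Gamma>" "\<And>w. w \<ge> 0 \<Longrightarrow> (0, - w) \<in> \<Gamma> \<Longrightarrow> w = z r"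
  shows "\<exists>U. open U \<and> \<Gamma> \<subseteq> U \<and> (\<forall>\<Gamma>'. periodic_orbit F \<Gamma>' \<and> \<Gamma>' \<noteq> \<Gamma> \<longrightarrow> \<not> \<Gamma>' \<subseteq> U)"
proof -
  \<comment> \<open>U omits the closed negative y-axis outside the window between
    \<open>- z b\<close> and \<open>- z a\<close>, the origin included. \<Gamma> stays in U because
    it meets this half axis only in \<open>- z r\<close>.\<close>
  define U where "U = - ({0::real} \<times> ({..- z b} \<union> {- z a..0}))"
  have zab: "z a < z r" "z r < z b" using strict_mono_onD[OF mono(1)] r(1,2) by simp_all
  have "open U" unfolding U_def by (intro open_Compl closed_Times closed_Un) auto
  moreover have "\<Gamma> \<subseteq> U"
  proof
    fix q assume q: "q \<in> \<Gamma>"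
    show "q \<in> U"
    proof (rule ccontr)
      assume "q \<notin> U"
      then have *: "fst q = 0" "snd q \<le> - z b \<or> - z a \<le> snd q \<and> snd q \<le> 0" by (auto simp: U_def)
      then have "snd q \<le> 0" using zab pos by auto
      then have "- snd q = z r" using \<Gamma>(3)[of "- snd q"] q *(1) by (simp add: prod_eq_iff) (metis prod.collapse)
      then show False using * zab by auto
    qed
  qed
  moreover have "\<not> \<Gamma>' \<subseteq> U" if per: "periodic_orbit F \<Gamma>'" and ne: "\<Gamma>' \<noteq> \<Gamma>" for \<Gamma>'
  proof
    assume sub: "\<Gamma>' \<subseteq> U"
    define K where "K = {s\<in>{a..b}. (0, - z s) \<in> \<Gamma>'}"
    have rK: "r \<notin> K" using periodic_orbits_eq[OF L per \<Gamma>(1)] \<Gamma>(2) ne by (auto simp: K_def)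
    have inU: "\<exists>s\<in>{a..b}. z s = w" if "w > 0" "(0, - w) \<in> \<Gamma>'" for w
    proof -
      have "(0, - w) \<in> U" using sub that by blast
      then have "z a < w" "w < z b" using that(1) by (auto simp: U_def)
      then show ?thesis using IVT'[of z a w b] cont(1) r by auto
    qed
    \<comment> \<open>The arc from a point of K leads to a further point on the negative y-axis; as
      \<Gamma>' stays in U, this point lies in the window again.\<close>
    have inv: "\<exists>k'\<in>K. z k' = T k" if "k \<in> K" for k
    proof -
      obtain W where W: "filippov_arc F (0, - z k) (0, - T k) W" using arcs[of k] \<open>k \<in> K\<close> by (auto simp: K_def)
      have "(0, - z k) \<in> \<Gamma>'" using \<open>k \<in> K\<close> by (simp add: K_def)
      then have "W \<subseteq> \<Gamma>'" using periodic_orbit_follow[OF L per _ W] by blast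
      then have *: "(0, - T k) \<in> \<Gamma>'" using arc_of_image(4)[OF W] by blast
      have "T a \<le> T k" using \<open>k \<in> K\<close> strict_mono_onD[OF mono(2), of a k] by (cases "k = a") (auto simp: K_def)
      then obtain s where "s \<in> {a..b}" "z s = T k" using inU[of "T k"] * pos by auto
      then show ?thesis using * by (auto simp: K_def)
    qed
    obtain w where w: "w > 0" "(0, - w) \<in> \<Gamma>'" using bottom[OF per] by blast
    then obtain k where k: "k \<in> K" using inU[OF w] by (auto simp: K_def)
    have "closed \<Gamma>'" using periodic_orbit_compact[OF per] by (rule compact_imp_closed)
    then have "closed ({a..b} \<inter> (\<lambda>s. (0, - z s)) -` \<Gamma>')"
      by (intro continuous_closed_preimage continuous_intros cont) auto
    moreover have "K = {a..b} \<inter> (\<lambda>s. (0, - z s)) -` \<Gamma>'" by (auto simp: K_def)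
    ultimately have cK: "closed K" by simp
    have le: "s \<le> s'" if "s \<in> {a..b}" "s' \<in> {a..b}" "z s \<le> z s'" for s s'
      using strict_mono_onD[OF mono(1), of s' s] that by force
    have zle: "z s \<le> z s'" if "s \<in> {a..b}" "s' \<in> {a..b}" "s \<le> s'" for s s'
      using strict_mono_onD[OF mono(1), of s s'] that by (cases "s = s'") auto
    have Tle: "T s \<le> T s'" if "s \<in> {a..b}" "s' \<in> {a..b}" "s \<le> s'" for s s'
      using strict_mono_onD[OF mono(2), of s s'] that by (cases "s = s'") auto
    \<comment> \<open>Both sides of r are invariant, because z and T increase and
      \<open>z r = T r\<close>. On either side the least element of J does not move down and the
      greatest does not move up, so z - T vanishes between them; the zero must be r, but J lies
      strictly on one side of r.\<close>
    have no_fix: False if J: "J \<noteq> {}" "J \<subseteq> K" "closed J" "J = K \<inter> {r..} \<or> J = K \<inter> {..r}" for J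
    proof -
      have Jab: "J \<subseteq> {a..b}" using J(2) by (auto simp: K_def)
      have "compact J" using J(3) Jab by (metis bounded_closed_interval bounded_subset compact_eq_bounded_closed)
      then obtain m M where m: "m \<in> J" "\<And>s. s \<in> J \<Longrightarrow> m \<le> s" and M: "M \<in> J" "\<And>s. s \<in> J \<Longrightarrow> s \<le> M"
        using compact_attains_inf[of J] compact_attains_sup[of J] J(1) by metis
      have invJ: "\<exists>k'\<in>J. z k' = T k" if k: "k \<in> J" for k
      proof -
        obtain k' where k': "k' \<in> K" "z k' = T k" using inv J(2) k by blast
        have ab: "k \<in> {a..b}" "k' \<in> {a..b}" "r \<in> {a..b}" using k Jab k' r by (auto simp: K_def)
        have "k' \<in> J"
          using J(4)
        proof
          assume *: "J = K \<inter> {r..}"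
          then have "z r \<le> z k'" using Tle[of r k] ab k k' r(3) by auto
          then show ?thesis using le[of r k'] ab * k' by auto
        next
          assume *: "J = K \<inter> {..r}"
          then have "z k' \<le> z r" using Tle[of k r] ab k k' r(3) by auto
          then show ?thesis using le[of k' r] ab * k' by auto
        qed
        then show ?thesis using k' by blast
      qed
      have "z m \<le> T m" using invJ[OF m(1)] m(2) zle Jab m(1) by (metis subsetD)
      moreover have "T M \<le> z M" using invJ[OF M(1)] M(2) zle Jab M(1) by (metis subsetD)
      moreover have mM: "m \<le> M" using m(2) M(1) by blast
      moreover have "continuous_on {m..M} (\<lambda>s. z s - T s)"
      proof -
        have "{m..M} \<subseteq> {a..b}" using m(1) M(1) Jab by auto
        then show ?thesis using cont by (intro continuous_intros) (auto intro: continuous_on_subset)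
      qed
      ultimately obtain s where s: "m \<le> s" "s \<le> M" "z s - T s = 0"
        using IVT'[of "\<lambda>s. z s - T s" m 0 M] by auto
      have "m \<in> {a..b}" "M \<in> {a..b}" using m(1) M(1) Jab by blast+
      then have "s = r" using r(4)[of s] s by simp
      moreover have "m \<noteq> r" "M \<noteq> r" using m(1) M(1) J(2) rK by auto
      ultimately have "m < r" "r < M" using s by auto
      then show False using J(4) m(1) M(1) by auto
    qed
    have "closed (K \<inter> {r..})" "closed (K \<inter> {..r})" using cK by (auto intro: closed_Int)
    moreover have "K \<inter> {r..} \<noteq> {} \<or> K \<inter> {..r} \<noteq> {}" using k by (metis IntI atLeast_iff atMost_iff empty_iff linorder_le_cases)
    ultimately show False using no_fix by (metis Int_lower1)
  qed
  ultimately show ?thesis by blast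
qed

section \<open>Crossing limit cycles through the outermost zone\<close>

lemma strictly_above_origin:
  assumes "isCont G 0" "G 0 = 0" "strictly_above G (0, y)" shows "y > 0"
proof -
  obtain e where e: "e > 0" "\<And>x. x \<noteq> 0 \<Longrightarrow> \<bar>x\<bar> < e \<Longrightarrow> G x + e < y" using assms(3) by (auto simp: strictly_above_def)
  have "(G \<longlongrightarrow> 0) (at 0)" using assms(1,2) by (simp add: isCont_def)
  moreover have "\<forall>\<^sub>F x in at 0. G x \<le> y - e"
    unfolding eventually_at by (intro exI[of _ e]) (use e in \<open>force simp: dist_real_def\<close>)
  ultimately have "0 \<le> y - e" using tendsto_upperbound by (metis at_neq_bot)
  then show ?thesis using e(1) by simp
qed

lemma descent_arc:
  assumes "descent G p Y A" "Y \<le> y"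
  obtains W where "ode_arc G p (p, y) (0, A y) W"
    "\<And>z. z \<in> W \<Longrightarrow> z = (p, y) \<or> 0 \<le> fst z \<and> fst z < p \<and> strictly_above G z"
    "\<And>z. z \<in> W \<Longrightarrow> fst z = 0 \<Longrightarrow> z = (0, A y)"
proof -
  have "\<forall>y\<ge>Y. \<exists>W. ode_arc G p (p, y) (0, A y) W \<and>
        (\<forall>z\<in>W. z = (p, y) \<or> 0 \<le> fst z \<and> fst z < p \<and> strictly_above G z) \<and>
        (\<forall>z\<in>W. fst z = 0 \<longrightarrow> z = (0, A y))"
    using assms(1) unfolding descent_def by (elim conjE)
  with assms(2) obtain W where W: "ode_arc G p (p, y) (0, A y) W"
        "\<forall>z\<in>W. z = (p, y) \<or> 0 \<le> fst z \<and> fst z < p \<and> strictly_above G z"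
        "\<forall>z\<in>W. fst z = 0 \<longrightarrow> z = (0, A y)" by blast
  show thesis by (rule that[OF W(1)]) (use W(2,3) in simp_all)
qed

lemma descent_pos:
  assumes "descent G q Y A" "q > 0" "isCont G 0" "G 0 = 0" "Y \<le> y" shows "A y > 0"
proof -
  obtain W where W: "ode_arc G q (q, y) (0, A y) W"
    "\<And>z. z \<in> W \<Longrightarrow> z = (q, y) \<or> 0 \<le> fst z \<and> fst z < q \<and> strictly_above G z"
    by (rule descent_arc[OF assms(1,5)]) (rule that; assumption)
  have "(0, A y) \<in> W" using arc_of_image(4)[OF W(1)] .
  then have "strictly_above G (0, A y)" using W(2)[of "(0, A y)"] assms(2) by simp
  then show ?thesis by (rule strictly_above_origin[OF assms(3,4)])
qed

lemma ode_arc_reflect: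
  assumes "ode_arc (\<lambda>x. - F x) b p r W"
  shows "ode_arc F b (reflect r) (reflect p) (reflect ` W)"
proof (rule arc_of_reflect[OF assms])
  fix q v assume *: "fst q < b \<and> isCont (\<lambda>x. - F x) (fst q) \<and> v = lienard_field (\<lambda>x. - F x) q"
  have "isCont F (fst q)" using isCont_minus[of _ "\<lambda>x. - F x"] * by fastforce
  then show "fst (reflect q) < b \<and> isCont F (fst (reflect q)) \<and> (- fst v, snd v) = lienard_field F (reflect q)"
    using * by (simp add: reflect_def lienard_field_def case_prod_unfold)
qed

text \<open>The margin in \<open>strictly_above\<close> survives the passage to the one-sided
  limits; this is what places an intersection point in the crossing set.\<close>

lemma strictly_above_crossing:
  assumes F: "(F \<longlongrightarrow> l) (at_left x)" "(F \<longlongrightarrow> r) (at_right x)"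
  shows "strictly_above F (x, y) \<Longrightarrow> max l r < y"
    and "strictly_above (\<lambda>x. - F x) (x, - y) \<Longrightarrow> y < min l r"
proof -
  have near: "\<forall>\<^sub>F u in at_left x. u \<noteq> x \<and> \<bar>u - x\<bar> < e" "\<forall>\<^sub>F u in at_right x. u \<noteq> x \<and> \<bar>u - x\<bar> < e" if "e > 0" for e
    unfolding eventually_at using that by (auto simp: dist_real_def)
  show "max l r < y" if "strictly_above F (x, y)"
  proof -
    obtain e where e: "e > 0" "\<And>u. u \<noteq> x \<Longrightarrow> \<bar>u - x\<bar> < e \<Longrightarrow> F u + e < y" using \<open>strictly_above F (x, y)\<close> by (auto simp: strictly_above_def)
    have "\<forall>\<^sub>F u in at_left x. F u \<le> y - e"
      using near(1)[OF e(1)] by eventually_elim (use e(2) in force)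
    moreover have "\<forall>\<^sub>F u in at_right x. F u \<le> y - e"
      using near(2)[OF e(1)] by eventually_elim (use e(2) in force)
    ultimately have "l \<le> y - e" "r \<le> y - e" using F tendsto_upperbound by (metis trivial_limit_at_left_real trivial_limit_at_right_real)+
    then show ?thesis using e(1) by simp
  qed
  show "y < min l r" if above: "strictly_above (\<lambda>x. - F x) (x, - y)"
  proof -
    obtain e where e: "e > 0" "\<forall>u. u \<noteq> x \<and> \<bar>u - x\<bar> < e \<longrightarrow> - F u + e < - y"
      using above unfolding strictly_above_def fst_conv snd_conv by (elim exE conjE) (rule that)
    have "\<forall>\<^sub>F u in at_left x. y + e \<le> F u"
      using near(1)[OF e(1)] by eventually_elim (use e(2) in force)
    moreover have "\<forall>\<^sub>F u in at_right x. y + e \<le> F u"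
      using near(2)[OF e(1)] by eventually_elim (use e(2) in force)
    ultimately have "y + e \<le> l" "y + e \<le> r" using F tendsto_lowerbound by (metis trivial_limit_at_left_real trivial_limit_at_right_real)+
    then show ?thesis using e(1) by simp
  qed
qed

text \<open>The gain of A is bounded, so after division by \<xi> only the rise in the outer zone
  remains.\<close>

lemma descent_asymptotic:
  assumes d: "descent G p Y A" and r: "((\<lambda>\<xi>. r \<xi> / \<xi>) \<longlongrightarrow> E) at_top" and E: "E > 0"
  shows "((\<lambda>\<xi>. A (f + r \<xi>) / \<xi>) \<longlongrightarrow> E) at_top" "filterlim r at_top at_top"
proof -
  have "filterlim (\<lambda>\<xi>. (r \<xi> / \<xi>) * \<xi>) at_top at_top"
    by (rule filterlim_tendsto_pos_mult_at_top[OF r E filterlim_ident])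
  moreover have "\<forall>\<^sub>F \<xi> in at_top. (r \<xi> / \<xi>) * \<xi> = r \<xi>" using eventually_gt_at_top[of 0] by eventually_elim simp
  ultimately show fl: "filterlim r at_top at_top" using filterlim_cong[OF refl refl, of "\<lambda>\<xi>. (r \<xi> / \<xi>) * \<xi>" r at_top] by simp
  obtain K where K: "\<forall>y\<ge>Y. y \<le> A y \<and> A y \<le> y + K" using descentD(5)[OF d] ..
  have ev: "\<forall>\<^sub>F \<xi> in at_top. Y \<le> f + r \<xi>"
    using fl[unfolded filterlim_at_top, rule_format, of "Y - f"] by eventually_elim simp
  have z: "((\<lambda>\<xi>. a / \<xi>) \<longlongrightarrow> 0) at_top" for a :: real
    by (rule tendsto_divide_0[OF tendsto_const filterlim_at_top_imp_at_infinity[OF filterlim_ident]])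
  show "((\<lambda>\<xi>. A (f + r \<xi>) / \<xi>) \<longlongrightarrow> E) at_top"
  proof (rule tendsto_sandwich)
    show "((\<lambda>\<xi>. f / \<xi> + r \<xi> / \<xi>) \<longlongrightarrow> E) at_top" using tendsto_add[OF z r] by simp
    show "((\<lambda>\<xi>. (f + K) / \<xi> + r \<xi> / \<xi>) \<longlongrightarrow> E) at_top" using tendsto_add[OF z r] by simp
    show "\<forall>\<^sub>F \<xi> in at_top. f / \<xi> + r \<xi> / \<xi> \<le> A (f + r \<xi>) / \<xi>"
      using ev eventually_gt_at_top[of 0]
    proof eventually_elim
      case (elim \<xi>)
      then show ?case using K by (simp add: add_divide_distrib[symmetric] divide_right_mono)
    qed
    show "\<forall>\<^sub>F \<xi> in at_top. A (f + r \<xi>) / \<xi> \<le> (f + K) / \<xi> + r \<xi> / \<xi>"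
      using ev eventually_gt_at_top[of 0]
    proof eventually_elim
      case (elim \<xi>)
      then have "A (f + r \<xi>) \<le> f + K + r \<xi>" using K by force
      then show ?case using elim by (simp add: add_divide_distrib[symmetric] divide_right_mono)
    qed
  qed
qed

text \<open>In this locale \<open>p\<close> is the last abscissa of \<open>P\<close>. The orbit through the point \<open>(\<xi>, F \<xi>)\<close> of the
  nullcline comes from \<open>(0, - lower \<xi>)\<close> and goes to \<open>(0, upper \<xi>)\<close>; the left half plane maps the
  latter to \<open>(0, - left_factor * upper \<xi>)\<close>.\<close>

locale outer_zone = zone +
  fixes F :: "real \<Rightarrow> real" and P :: "real set" and p c Y :: real and A B :: "real \<Rightarrow> real"
  assumes ds: "downward_system F P" and P_le: "P \<subseteq> {..p}"
    and F_outer: "\<And>x. p < x \<Longrightarrow> F x = c + \<sigma> * x"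
    and dA: "descent F p Y A" and clearA: "\<And>y. Y < y \<Longrightarrow> strictly_above F (p, y)"
    and dB: "descent (\<lambda>x. - F x) p (- (c + \<sigma> * p)) B"
    and clearB: "\<And>y. - (c + \<sigma> * p) < y \<Longrightarrow> strictly_above (\<lambda>x. - F x) (p, y)"
begin

text \<open>The reflected system has slope \<open>- \<sigma> = 2 * cos (pi - \<theta>)\<close> in
  the outer zone.\<close>

sublocale refl: zone "pi - \<theta>"
  by unfold_locales (use \<theta> in auto)

text \<open>The ordinate on x = p of the orbit leaving \<open>(\<xi>, F \<xi>)\<close>;
  \<open>depth\<close> is minus the ordinate on x = p of the orbit arriving there.\<close>

definition "height \<xi> = c + \<sigma> * p + rise p \<xi>"

definition "depth \<xi> = - (c + \<sigma> * p) + refl.rise p \<xi>"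

definition "upper \<xi> = A (height \<xi>)"

definition "lower \<xi> = B (depth \<xi>)"

text \<open>Distance from the origin before one turn minus distance after it: a positive value means
  that the turn leads inwards.\<close>

definition "displacement \<xi> = lower \<xi> - left_factor * upper \<xi>"

lemma p_nonneg: "0 \<le> p" using descentD(1)[OF dA] .

lemma isCont_0: "isCont F 0" and F_0: "F 0 = 0"
proof -
  have "0 \<notin> P" using ds by (auto simp: downward_system_def)
  then show "isCont F 0" "F 0 = 0" using ds by (simp_all add: downward_system_def)
qed

lemma descents_at:
  assumes \<xi>: "p < \<xi>" "Y < height \<xi>" "- (c + \<sigma> * p) < depth \<xi>"
  obtains A' B' where "descent F \<xi> (F \<xi>) A'" "A' (F \<xi>) = upper \<xi>"
    "descent (\<lambda>x. - F x) \<xi> (- F \<xi>) B'" "B' (- F \<xi>) = lower \<xi>"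
proof -
  have F\<xi>: "F \<xi> = c + \<sigma> * \<xi>" using F_outer \<xi> by simp
  obtain A' where A': "descent F \<xi> (c + \<sigma> * \<xi>) A'" "A' (c + \<sigma> * \<xi>) = A (c + \<sigma> * p + rise p \<xi>)"
    by (rule descent_strip[OF dA clearA F_outer \<xi>(1) \<xi>(2)[unfolded height_def]])
  have G: "- F x = - c + refl.\<sigma> * x" if "p < x" "x < \<xi>" for x using F_outer that by simp
  have Z: "- (c + \<sigma> * p) < - c + refl.\<sigma> * p + refl.rise p \<xi>" using \<xi>(3) by (simp add: depth_def)
  obtain B' where B': "descent (\<lambda>x. - F x) \<xi> (- c + refl.\<sigma> * \<xi>) B'" 
    "B' (- c + refl.\<sigma> * \<xi>) = B (- c + refl.\<sigma> * p + refl.rise p \<xi>)"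
    by (rule refl.descent_strip[OF dB clearB G \<xi>(1) Z])
  show thesis
    by (rule that[of A' B']) (use A' B' in \<open>simp_all add: F\<xi> upper_def lower_def height_def depth_def algebra_simps\<close>)
qed

lemma turn_arc:
  assumes \<xi>: "p < \<xi>" "Y < height \<xi>" "- (c + \<sigma> * p) < depth \<xi>"
  obtains W where "filippov_arc F (0, - lower \<xi>) (0, upper \<xi>) W" "(\<xi>, F \<xi>) \<in> W" "upper \<xi> > 0" "lower \<xi> > 0"
    "\<And>w. w \<in> W \<Longrightarrow> w = (\<xi>, F \<xi>) \<or> 0 \<le> fst w \<and> (strictly_above F w \<or> strictly_above (\<lambda>x. - F x) (reflect w))"
    "\<And>w. w \<in> W \<Longrightarrow> fst w = 0 \<Longrightarrow> w = (0, - lower \<xi>) \<or> w = (0, upper \<xi>)"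
proof -
  obtain A' B' where A': "descent F \<xi> (F \<xi>) A'" "A' (F \<xi>) = upper \<xi>"
    and B': "descent (\<lambda>x. - F x) \<xi> (- F \<xi>) B'" "B' (- F \<xi>) = lower \<xi>" using descents_at[OF \<xi>] .
  have \<xi>0: "\<xi> > 0" using p_nonneg \<xi> by simp
  obtain V where V: "ode_arc F \<xi> (\<xi>, F \<xi>) (0, upper \<xi>) V"
    "\<And>z. z \<in> V \<Longrightarrow> z = (\<xi>, F \<xi>) \<or> 0 \<le> fst z \<and> fst z < \<xi> \<and> strictly_above F z"
    "\<And>z. z \<in> V \<Longrightarrow> fst z = 0 \<Longrightarrow> z = (0, upper \<xi>)"
    by (rule descent_arc[OF A'(1) order_refl, unfolded A'(2)]) (rule that; assumption)
  obtain W where W: "ode_arc (\<lambda>x. - F x) \<xi> (\<xi>, - F \<xi>) (0, lower \<xi>) W"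
    "\<And>z. z \<in> W \<Longrightarrow> z = (\<xi>, - F \<xi>) \<or> 0 \<le> fst z \<and> fst z < \<xi> \<and> strictly_above (\<lambda>x. - F x) z"
    "\<And>z. z \<in> W \<Longrightarrow> fst z = 0 \<Longrightarrow> z = (0, lower \<xi>)"
    by (rule descent_arc[OF B'(1) order_refl, unfolded B'(2)]) (rule that; assumption)
  have W': "ode_arc F \<xi> (0, - lower \<xi>) (\<xi>, F \<xi>) (reflect ` W)"
    using ode_arc_reflect[OF W(1)] by (simp add: reflect_def)
  have rr: "reflect (reflect w) = w" for w by (simp add: reflect_def)
  show thesis
  proof (rule that[of "reflect ` W \<union> V"])
    show "filippov_arc F (0, - lower \<xi>) (0, upper \<xi>) (reflect ` W \<union> V)"
      using ode_arc_filippov_arc[OF arc_of_trans[OF W' V(1)]] .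
    show "(\<xi>, F \<xi>) \<in> reflect ` W \<union> V" using arc_of_image(3)[OF V(1)] by simp
    show "upper \<xi> > 0" using descent_pos[OF A'(1) \<xi>0 isCont_0 F_0 order_refl] A'(2) by simp
    have "isCont (\<lambda>x. - F x) 0" using isCont_0 by (intro continuous_intros)
    then show "lower \<xi> > 0" using descent_pos[OF B'(1) \<xi>0 _ _ order_refl] F_0 B'(2) by simp
    show "w = (\<xi>, F \<xi>) \<or> 0 \<le> fst w \<and> (strictly_above F w \<or> strictly_above (\<lambda>x. - F x) (reflect w))"
      if "w \<in> reflect ` W \<union> V" for w
    proof (cases "w \<in> V")
      case True then show ?thesis using V(2) by blast
    next
      case False
      then obtain u where "u \<in> W" "w = reflect u" using \<open>w \<in> reflect ` W \<union> V\<close> by blast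
      then show ?thesis using W(2)[of u] rr[of u] by (auto simp: reflect_def)
    qed
    show "w = (0, - lower \<xi>) \<or> w = (0, upper \<xi>)" if "w \<in> reflect ` W \<union> V" "fst w = 0" for w
    proof (cases "w \<in> V")
      case True then show ?thesis using V(3) that by blast
    next
      case False
      then obtain u where "u \<in> W" "w = reflect u" using \<open>w \<in> reflect ` W \<union> V\<close> by blast
      then show ?thesis using W(3)[of u] \<open>fst w = 0\<close> by (auto simp: reflect_def)
    qed
  qed
qed

lemma height_mono: "0 < p \<Longrightarrow> p \<le> \<xi> \<Longrightarrow> \<xi> < \<zeta> \<Longrightarrow> height \<xi> < height \<zeta>"
  using rise_strict_mono by (simp add: height_def)

lemma depth_mono: "0 < p \<Longrightarrow> p \<le> \<xi> \<Longrightarrow> \<xi> < \<zeta> \<Longrightarrow> depth \<xi> < depth \<zeta>"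
  using refl.rise_strict_mono by (simp add: depth_def)

lemma depth_ge: "0 < p \<Longrightarrow> p \<le> \<xi> \<Longrightarrow> - (c + \<sigma> * p) \<le> depth \<xi>"
proof -
  assume "0 < p" "p \<le> \<xi>"
  then have "0 \<le> refl.rise p \<xi>"
    using refl.rise_strict_mono[of p p \<xi>] refl.rise_start[of p] by (cases "p < \<xi>") auto
  then show ?thesis by (simp add: depth_def)
qed

lemma depth_gt: "0 < p \<Longrightarrow> p < \<xi> \<Longrightarrow> - (c + \<sigma> * p) < depth \<xi>"
  using refl.rise_strict_mono[of p p \<xi>] refl.rise_start[of p] by (simp add: depth_def)

section \<open>Regularity of the displacement, and cycles at its zeros\<close>

context
  fixes \<xi>1 :: real
  assumes p: "0 < p" and \<xi>1: "p \<le> \<xi>1" "Y \<le> height \<xi>1"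
begin

lemma height_ge: "\<xi>1 \<le> \<xi> \<Longrightarrow> Y \<le> height \<xi>"
  using height_mono[of \<xi>1 \<xi>] p \<xi>1 by (cases "\<xi>1 = \<xi>") auto

lemma height_gt: "\<xi>1 < \<xi> \<Longrightarrow> Y < height \<xi>"
  using height_mono[of \<xi>1 \<xi>] p \<xi>1 by auto

lemma continuous_on_upper: "continuous_on {\<xi>1..} upper"
  unfolding upper_def[abs_def]
proof (rule continuous_on_compose2[OF descentD(3)[OF dA]])
  show "continuous_on {\<xi>1..} height" unfolding height_def[abs_def]
    by (intro continuous_intros continuous_on_subset[OF continuous_on_rise[OF p]]) (use \<xi>1 in auto)
qed (use height_ge in auto)

lemma continuous_on_lower: "continuous_on {\<xi>1..} lower"
  unfolding lower_def[abs_def]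
proof (rule continuous_on_compose2[OF descentD(3)[OF dB]])
  show "continuous_on {\<xi>1..} depth" unfolding depth_def[abs_def]
    by (intro continuous_intros continuous_on_subset[OF refl.continuous_on_rise[OF p]]) (use \<xi>1 in auto)
qed (use depth_ge p \<xi>1 in auto)

lemma strict_mono_on_upper: "strict_mono_on {\<xi>1..} upper"
proof (rule strict_mono_onI)
  fix \<xi> \<zeta> assume *: "\<xi> \<in> {\<xi>1..}" "\<zeta> \<in> {\<xi>1..}" "\<xi> < \<zeta>"
  then show "upper \<xi> < upper \<zeta>" unfolding upper_def
    using height_mono[of \<xi> \<zeta>] p \<xi>1 height_ge by (intro strict_mono_onD[OF descentD(2)[OF dA]]) auto
qed

lemma strict_mono_on_lower: "strict_mono_on {\<xi>1..} lower"
proof (rule strict_mono_onI)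
  fix \<xi> \<zeta> assume *: "\<xi> \<in> {\<xi>1..}" "\<zeta> \<in> {\<xi>1..}" "\<xi> < \<zeta>"
  then show "lower \<xi> < lower \<zeta>" unfolding lower_def
    using depth_mono[of \<xi> \<zeta>] depth_ge p \<xi>1 by (intro strict_mono_onD[OF descentD(2)[OF dB]]) auto
qed

lemma real_analytic_at_displacement:
  assumes "\<xi>1 < \<xi>" shows "real_analytic_at displacement \<xi>"
proof -
  have "real_analytic_at height \<xi>" unfolding height_def[abs_def]
    by (intro real_analytic_at_add real_analytic_at_const real_analytic_at_rise) (use p \<xi>1 assms in auto)
  then have "real_analytic_at upper \<xi>" unfolding upper_def[abs_def]
    using real_analytic_at_compose[of height \<xi> A] descentD(4)[OF dA height_gt[OF assms]] by simp
  moreover have "real_analytic_at depth \<xi>" unfolding depth_def[abs_def]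
    by (intro real_analytic_at_add real_analytic_at_const refl.real_analytic_at_rise) (use p \<xi>1 assms in auto)
  then have "real_analytic_at lower \<xi>" unfolding lower_def[abs_def]
    using real_analytic_at_compose[of depth \<xi> B] descentD(4)[OF dB depth_gt[of \<xi>]] p \<xi>1 assms by simp
  ultimately show ?thesis unfolding displacement_def[abs_def]
    by (intro real_analytic_at_diff real_analytic_at_mult real_analytic_at_const)
qed

lemma crossing_limit_cycle_exists:
  assumes pP: "p \<in> P" and \<xi>2: "\<xi>1 < \<xi>2" and sgn: "displacement \<xi>1 * displacement \<xi>2 < 0"
  obtains \<Gamma> q where "crossing_limit_cycle F P \<Gamma>" "q \<in> \<Gamma>" "p < fst q"
proof -
  obtain L where L: "one_sided_lipschitz L F" using ds by (rule downward_systemE)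
  have contd: "continuous_on {\<xi>1..\<xi>2} displacement" unfolding displacement_def[abs_def]
    by (intro continuous_intros continuous_on_subset[OF continuous_on_upper] continuous_on_subset[OF continuous_on_lower]) auto
  obtain \<xi> where \<xi>: "\<xi>1 < \<xi>" "\<xi> < \<xi>2" "displacement \<xi> = 0" "\<forall>\<^sub>F u in at \<xi>. displacement u \<noteq> 0"
    by (rule real_analytic_isolated_zero[OF \<xi>2 contd real_analytic_at_displacement sgn])
  obtain e where e: "e > 0" "\<And>u. u \<noteq> \<xi> \<Longrightarrow> \<bar>u - \<xi>\<bar> < e \<Longrightarrow> displacement u \<noteq> 0"
    using \<xi>(4) unfolding eventually_at dist_real_def by auto
  \<comment> \<open>The closed interval of radius \<delta> around \<xi> stays to the right of
    \<open>\<xi>1\<close> and contains no further zero of the displacement.\<close>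
  define \<delta> where "\<delta> = min e (\<xi> - \<xi>1) / 2"
  have \<delta>: "\<delta> > 0" "\<delta> < e" "\<delta> < \<xi> - \<xi>1" using e(1) \<xi>(1) by (auto simp: \<delta>_def min_def field_simps)
  define a where "a = \<xi> - \<delta>"
  define b where "b = \<xi> + \<delta>"
  have ab: "\<xi>1 < a" "a < \<xi>" "\<xi> < b" using \<delta> by (auto simp: a_def b_def)
  have F: "F x = x" if "x < 0" for x using ds that by (simp add: downward_system_def)
  have turn: "p < s" "Y < height s" "- (c + \<sigma> * p) < depth s" if "\<xi>1 < s" for s
    using that height_gt depth_gt[of s] p \<xi>1 by auto
  have arcs: "\<exists>W. filippov_arc F (0, - lower s) (0, - (left_factor * upper s)) W" if s: "\<xi>1 < s" for s
  proof -
    obtain V where V: "filippov_arc F (0, - lower s) (0, upper s) V" "upper s > 0" by (rule turn_arc[OF turn[OF s]]) (rule that; assumption)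
    obtain W where "ode_arc F 0 (0, upper s) (0, - (left_factor * upper s)) W" using left_arc[of F "upper s"] F V(2) by auto
    then show ?thesis using arc_of_trans[OF V(1)] ode_arc_filippov_arc by blast
  qed
  obtain V where V: "filippov_arc F (0, - lower \<xi>) (0, upper \<xi>) V" "(\<xi>, F \<xi>) \<in> V" "upper \<xi> > 0" "lower \<xi> > 0"
    "\<And>w. w \<in> V \<Longrightarrow> w = (\<xi>, F \<xi>) \<or> 0 \<le> fst w \<and> (strictly_above F w \<or> strictly_above (\<lambda>x. - F x) (reflect w))"
    "\<And>w. w \<in> V \<Longrightarrow> fst w = 0 \<Longrightarrow> w = (0, - lower \<xi>) \<or> w = (0, upper \<xi>)"
    by (rule turn_arc[OF turn[OF \<xi>(1)]]) (rule that; assumption)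
  obtain W where W: "ode_arc F 0 (0, upper \<xi>) (0, - (left_factor * upper \<xi>)) W"
    "\<forall>z\<in>W. z = (0, upper \<xi>) \<or> z = (0, - (left_factor * upper \<xi>)) \<or> fst z < 0"
    using left_arc[of F "upper \<xi>"] F V(3) by auto
  have fp: "left_factor * upper \<xi> = lower \<xi>" using \<xi>(3) by (simp add: displacement_def)
  define \<Gamma> where "\<Gamma> = V \<union> W"
  have closed_arc: "filippov_arc F (0, - lower \<xi>) (0, - lower \<xi>) \<Gamma>"
    unfolding \<Gamma>_def using arc_of_trans[OF V(1) ode_arc_filippov_arc[OF W(1)]] by (simp add: fp)
  have \<xi>0: "\<xi> > 0" "p < \<xi>" using p \<xi>1 \<xi>(1) by auto
  have q: "(\<xi>, F \<xi>) \<in> \<Gamma>" using V(2) by (simp add: \<Gamma>_def)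
  have per: "periodic_orbit F \<Gamma>"
    by (rule closed_arc_periodic_orbit[OF closed_arc q]) (use \<xi>0 in simp)
  have start: "(0, - lower \<xi>) \<in> \<Gamma>" using arc_of_image(3)[OF closed_arc] .
  \<comment> \<open>Points over P lie to the left of \<xi>, hence differ from the turning point, so
    they are strictly above or strictly below the graph.\<close>
  have lines: "w \<in> crossing_set F P" if w: "w \<in> \<Gamma>" "fst w \<in> P" for w
  proof -
    have x: "0 < fst w" "fst w \<le> p" using w(2) P_le ds by (auto simp: downward_system_def)
    have "w \<in> V" using w(1) W(2) x by (auto simp: \<Gamma>_def)
    then have *: "strictly_above F w \<or> strictly_above (\<lambda>x. - F x) (reflect w)" using V(5)[of w] x \<xi>0 by auto
    have lim: "(F \<longlongrightarrow> left_lim F (fst w)) (at_left (fst w))" "(F \<longlongrightarrow> right_lim F (fst w)) (at_right (fst w))"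
      using ds w(2) by (auto simp: downward_system_def)
    have "snd w < min (left_lim F (fst w)) (right_lim F (fst w)) \<or> max (left_lim F (fst w)) (right_lim F (fst w)) < snd w"
      using * strictly_above_crossing[OF lim, of "snd w"] by (auto simp: reflect_def)
    then show ?thesis using w(2) by (cases w) (auto simp: crossing_set_def)
  qed
  \<comment> \<open>The orbit is connected and joins x = 0 to x = \<xi>, so it meets the line x = p
    in between.\<close>
  have "\<exists>y. (p, y) \<in> \<Gamma>"
  proof -
    have "connected (fst ` \<Gamma>)" using arc_of_image(2)[OF closed_arc] by (intro connected_continuous_image continuous_intros)
    moreover have "0 \<in> fst ` \<Gamma>" "\<xi> \<in> fst ` \<Gamma>" using start q by force+
    ultimately have "p \<in> fst ` \<Gamma>" using connectedD_interval[of "fst ` \<Gamma>" 0 \<xi> p] p \<xi>0 by auto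
    then show ?thesis by force
  qed
  then obtain y where "(p, y) \<in> \<Gamma>" by blast
  then have "has_crossing F P \<Gamma>" using lines[of "(p, y)"] pP by (auto simp: has_crossing_def)
  moreover have "\<Gamma> \<inter> switching_lines P \<subseteq> crossing_set F P" using lines by (auto simp: switching_lines_def)
  moreover have "\<exists>U. open U \<and> \<Gamma> \<subseteq> U \<and> (\<forall>\<Gamma>'. periodic_orbit F \<Gamma>' \<and> \<Gamma>' \<noteq> \<Gamma> \<longrightarrow> \<not> \<Gamma>' \<subseteq> U)"
  proof (rule isolated_periodic_orbit[OF L periodic_orbit_meets_bottom[OF ds], of a \<xi> b lower "\<lambda>s. left_factor * upper s"])
    have sub: "{a..b} \<subseteq> {\<xi>1..}" using ab by auto
    show "s = \<xi>" if "s \<in> {a..b}" "lower s = left_factor * upper s" for s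
    proof (rule ccontr)
      assume "s \<noteq> \<xi>"
      moreover have "\<bar>s - \<xi>\<bar> < e" using that(1) \<delta>(2) by (auto simp: a_def b_def abs_less_iff)
      ultimately show False using e(2)[of s] that(2) by (simp add: displacement_def)
    qed
    show "continuous_on {a..b} lower" "continuous_on {a..b} (\<lambda>s. left_factor * upper s)"
      using continuous_on_subset[OF continuous_on_lower sub] continuous_on_subset[OF continuous_on_upper sub]
      by (auto intro: continuous_intros)
    show "strict_mono_on {a..b} lower" 
      using strict_mono_on_lower sub unfolding strict_mono_on_def by blast
    have "strict_mono_on {a..b} upper"
      using strict_mono_on_upper sub unfolding strict_mono_on_def by blast
    then show "strict_mono_on {a..b} (\<lambda>s. left_factor * upper s)"
      using left_factor_pos by (simp add: strict_mono_on_def)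
    obtain V' where "filippov_arc F (0, - lower a) (0, upper a) V'" "upper a > 0" "lower a > 0"
      by (rule turn_arc[OF turn[OF ab(1)]]) (rule that; assumption)
    then show "0 < lower a" "0 < left_factor * upper a" using left_factor_pos by simp_all
    show "\<exists>W. filippov_arc F (0, - lower s) (0, - (left_factor * upper s)) W" if "s \<in> {a..b}" for s
      using arcs[of s] that ab by simp
    show "w = lower \<xi>" if w: "w \<ge> 0" "(0, - w) \<in> \<Gamma>" for w
    proof -
      have "(0, - w) \<in> V \<Longrightarrow> (0, - w) = (0, - lower \<xi>) \<or> (0, - w) = (0, upper \<xi>)" using V(6)[of "(0, - w)"] by simp
      moreover have "(0, - w) \<in> W \<Longrightarrow> (0, - w) = (0, - lower \<xi>) \<or> (0, - w) = (0, upper \<xi>)" using W(2) fp by fastforce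
      ultimately show ?thesis using w V(3) by (auto simp: \<Gamma>_def)
    qed
  qed (use ab per start fp in auto)
  ultimately have "crossing_limit_cycle F P \<Gamma>" using per unfolding crossing_limit_cycle_def by blast
  then show thesis using that[OF _ q] \<xi>0 by simp
qed

end

section \<open>The sign of the displacement at infinity\<close>

lemma displacement_asymptotic:
  "((\<lambda>\<xi>. displacement \<xi> / \<xi>) \<longlongrightarrow>
     exp ((pi - \<theta>) * cos (pi - \<theta>) / sin (pi - \<theta>)) - left_factor * exp (\<theta> * cos \<theta> / sin \<theta>)) at_top"
proof -
  have "((\<lambda>\<xi>. upper \<xi> / \<xi>) \<longlongrightarrow> exp (\<theta> * cos \<theta> / sin \<theta>)) at_top"
    unfolding upper_def height_def by (rule descent_asymptotic(1)[OF dA rise_asymptotic[OF p_nonneg]]) simp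
  moreover have "((\<lambda>\<xi>. lower \<xi> / \<xi>) \<longlongrightarrow> exp ((pi - \<theta>) * cos (pi - \<theta>) / sin (pi - \<theta>))) at_top"
    unfolding lower_def depth_def by (rule descent_asymptotic(1)[OF dB refl.rise_asymptotic[OF p_nonneg]]) simp
  ultimately have "((\<lambda>\<xi>. lower \<xi> / \<xi> - left_factor * (upper \<xi> / \<xi>)) \<longlongrightarrow>
     exp ((pi - \<theta>) * cos (pi - \<theta>) / sin (pi - \<theta>)) - left_factor * exp (\<theta> * cos \<theta> / sin \<theta>)) at_top"
    by (intro tendsto_intros)
  then show ?thesis by (simp add: displacement_def diff_divide_distrib)
qed

text \<open>A positive factor is split off, which leaves the comparison of the exponents - pi cot
  \<theta> and pi cot(pi/3).\<close>

lemma displacement_exponents: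
  "exp ((pi - \<theta>) * cos (pi - \<theta>) / sin (pi - \<theta>)) - left_factor * exp (\<theta> * cos \<theta> / sin \<theta>) =
   exp (\<theta> * cos \<theta> / sin \<theta>) * (exp (- (pi * cos \<theta> / sin \<theta>)) - exp (pi * cos (pi / 3) / sin (pi / 3)))"
proof -
  have "(pi - \<theta>) * cos (pi - \<theta>) / sin (pi - \<theta>) = \<theta> * cos \<theta> / sin \<theta> + - (pi * cos \<theta> / sin \<theta>)"
    using sin_pos by (simp add: field_simps)
  then show ?thesis by (simp only: left_factor_def exp_add algebra_simps)
qed

text \<open>The half turns on the right and on the left contribute the exponents pi cot \<theta> and
  pi cot(pi/3); far orbits spiral outwards when the sum is positive. The sign s treats both
  directions at once.\<close>

lemma displacement_sign:
  assumes "s = 1 \<or> s = (-1::real)"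
    and "s * (cos (pi / 3) / sin (pi / 3) + cos \<theta> / sin \<theta>) > 0"
  shows "\<forall>\<^sub>F \<xi> in at_top. s * displacement \<xi> < 0"
proof -
  let ?E = "exp ((pi - \<theta>) * cos (pi - \<theta>) / sin (pi - \<theta>)) - left_factor * exp (\<theta> * cos \<theta> / sin \<theta>)"
  let ?u = "cos (pi / 3) / sin (pi / 3)" and ?v = "cos \<theta> / sin \<theta>"
  have "s * (exp (- (pi * cos \<theta> / sin \<theta>)) - exp (pi * cos (pi / 3) / sin (pi / 3))) < 0"
    using assms(1)
  proof
    assume s: "s = 1"
    have "pi * (?u + ?v) > 0" using assms(2) s by simp
    then have "- (pi * ?v) < pi * ?u" by (simp add: algebra_simps)
    then show ?thesis using s by simp
  next
    assume s: "s = -1"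
    have "pi * (?u + ?v) < 0" using assms(2) s by (intro mult_pos_neg) auto
    then have "pi * ?u < - (pi * ?v)" by (simp add: algebra_simps)
    then show ?thesis using s by simp
  qed
  then have "exp (\<theta> * cos \<theta> / sin \<theta>) *
      (s * (exp (- (pi * cos \<theta> / sin \<theta>)) - exp (pi * cos (pi / 3) / sin (pi / 3)))) < 0"
    by (rule mult_pos_neg[OF exp_gt_zero])
  then have "s * ?E < 0" unfolding displacement_exponents by (simp only: mult.left_commute)
  moreover have "((\<lambda>\<xi>. s * (displacement \<xi> / \<xi>)) \<longlongrightarrow> s * ?E) at_top"
    using displacement_asymptotic by (intro tendsto_intros)
  ultimately have "\<forall>\<^sub>F \<xi> in at_top. s * (displacement \<xi> / \<xi>) < 0" using order_tendstoD(2) by blast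
  then show ?thesis using eventually_gt_at_top[of 0]
  proof eventually_elim
    case (elim \<xi>)
    then have "(s * displacement \<xi>) / \<xi> < 0" by simp
    then show ?case using elim(2) by (simp add: divide_less_0_iff)
  qed
qed

lemma height_depth_at_top: "filterlim height at_top at_top" "filterlim depth at_top at_top"
proof -
  have "filterlim (rise p) at_top at_top" by (rule descent_asymptotic(2)[OF dA rise_asymptotic[OF p_nonneg]]) simp
  then show "filterlim height at_top at_top" unfolding height_def[abs_def] by (rule filterlim_tendsto_add_at_top[OF tendsto_const])
  have "filterlim (refl.rise p) at_top at_top" by (rule descent_asymptotic(2)[OF dB refl.rise_asymptotic[OF p_nonneg]]) simp
  then show "filterlim depth at_top at_top" unfolding depth_def[abs_def] by (rule filterlim_tendsto_add_at_top[OF tendsto_const])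
qed

end

section \<open>Adding a node\<close>

text \<open>Positive part and unit step at q, written with the absolute value and \<open>sgn\<close>
  so that the sum keeps the required normal form; k is the change of slope and J the height of the
  drop.\<close>

definition add_node :: "(real \<Rightarrow> real) \<Rightarrow> real \<Rightarrow> real \<Rightarrow> real \<Rightarrow> real \<Rightarrow> real" where
  "add_node F q k J x = F x + k / 2 * (x - q + \<bar>x - q\<bar>) - J / 2 * (1 + sgn (x - q))"

lemma add_node_simps:
  "x < q \<Longrightarrow> add_node F q k J x = F x"
  "q < x \<Longrightarrow> add_node F q k J x = F x + k * (x - q) - J"
  by (simp_all add: add_node_def)

lemma add_node_limits:
  assumes "isCont F q"
  shows "(add_node F q k J \<longlongrightarrow> F q) (at_left q)" "(add_node F q k J \<longlongrightarrow> F q - J) (at_right q)"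
proof -
  have F: "(F \<longlongrightarrow> F q) (at_left q)" "(F \<longlongrightarrow> F q) (at_right q)"
    using assms by (simp_all add: isCont_def filterlim_at_split)
  have "\<forall>\<^sub>F x in at_left q. F x = add_node F q k J x"
    unfolding eventually_at by (intro exI[of _ 1]) (simp add: add_node_simps)
  with F(1) show "(add_node F q k J \<longlongrightarrow> F q) (at_left q)" by (rule Lim_transform_eventually)
  have "((\<lambda>x. F x + k * (x - q) - J) \<longlongrightarrow> F q + k * (q - q) - J) (at_right q)"
    by (intro tendsto_intros F(2))
  then have "((\<lambda>x. F x + k * (x - q) - J) \<longlongrightarrow> F q - J) (at_right q)" by simp
  moreover have "\<forall>\<^sub>F x in at_right q. F x + k * (x - q) - J = add_node F q k J x"
    unfolding eventually_at by (intro exI[of _ 1]) (simp add: add_node_simps)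
  ultimately show "(add_node F q k J \<longlongrightarrow> F q - J) (at_right q)" by (rule Lim_transform_eventually)
qed

lemma strictly_aboveI:
  assumes l: "(G \<longlongrightarrow> l) (at_left q)" "l < y" and r: "(G \<longlongrightarrow> r) (at_right q)" "r < y"
  shows "strictly_above G (q, y)"
proof -
  define e where "e = min (y - l) (y - r) / 2"
  have e: "e > 0" "l < y - e" "r < y - e" using l(2) r(2) by (auto simp: e_def min_def field_simps)
  obtain d1 where d1: "d1 > 0" "\<And>x. x < q \<Longrightarrow> dist x q < d1 \<Longrightarrow> G x < y - e"
    using order_tendstoD(2)[OF l(1) e(2)] unfolding eventually_at by (metis lessThan_iff less_irrefl)
  obtain d2 where d2: "d2 > 0" "\<And>x. q < x \<Longrightarrow> dist x q < d2 \<Longrightarrow> G x < y - e"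
    using order_tendstoD(2)[OF r(1) e(3)] unfolding eventually_at by (metis greaterThan_iff less_irrefl)
  show ?thesis unfolding strictly_above_def
  proof (intro exI[of _ "min e (min d1 d2)"] conjI allI impI)
    fix x assume x: "x \<noteq> fst (q, y) \<and> \<bar>x - fst (q, y)\<bar> < min e (min d1 d2)"
    then have "G x < y - e" using d1(2)[of x] d2(2)[of x] by (cases "x < q") (auto simp: dist_real_def)
    then show "G x + min e (min d1 d2) < snd (q, y)" by simp
  qed (use e d1 d2 in simp)
qed

lemma one_sided_lipschitz_add_node:
  assumes L: "one_sided_lipschitz L F" and J: "J \<ge> 0"
  shows "one_sided_lipschitz (L + \<bar>k\<bar>) (add_node F q k J)"
  unfolding one_sided_lipschitz_def
proof (intro conjI allI impI)
  show "0 \<le> L + \<bar>k\<bar>" using L by (simp add: one_sided_lipschitz_def)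
  fix x y :: real assume xy: "x < y"
  have 1: "F y - F x \<le> L * (y - x)" using L xy by (simp add: one_sided_lipschitz_def)
  define a where "a = (y - q + \<bar>y - q\<bar>) - (x - q + \<bar>x - q\<bar>)"
  have "0 \<le> a" "a \<le> 2 * (y - x)" using xy by (auto simp: a_def abs_if)
  then have "k / 2 * a \<le> \<bar>k\<bar> / 2 * (2 * (y - x))" by (intro mult_mono) auto
  then have 2: "k / 2 * a \<le> \<bar>k\<bar> * (y - x)" by (simp add: algebra_simps)
  have "sgn (x - q) \<le> sgn (y - q)" using xy by (auto simp: sgn_if)
  then have 3: "J / 2 * (1 + sgn (x - q)) \<le> J / 2 * (1 + sgn (y - q))" using J by (intro mult_left_mono) auto
  have "add_node F q k J y - add_node F q k J x =
      (F y - F x) + k / 2 * a - (J / 2 * (1 + sgn (y - q)) - J / 2 * (1 + sgn (x - q)))"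
    unfolding add_node_def a_def by (simp add: algebra_simps)
  also have "\<dots> \<le> L * (y - x) + \<bar>k\<bar> * (y - x)" using 1 2 3 by linarith
  finally show "add_node F q k J y - add_node F q k J x \<le> (L + \<bar>k\<bar>) * (y - x)" by (simp add: algebra_simps)
qed

lemma downward_system_add_node:
  assumes ds: "downward_system F P" and q: "P \<subseteq> {..<q}" "0 < q" and J: "J \<ge> 0"
  shows "downward_system (add_node F q k J) (insert q P)"
  unfolding downward_system_def
proof (intro conjI allI impI ballI)
  let ?G = "add_node F q k J"
  show "finite (insert q P)" "insert q P \<subseteq> {0<..}" using ds q by (auto simp: downward_system_def)
  obtain L where L: "one_sided_lipschitz L F" using ds by (rule downward_systemE)
  show "\<exists>L. one_sided_lipschitz L ?G" using one_sided_lipschitz_add_node[OF L J] by blast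
  show "?G x = x" if "x \<le> 0" for x using that q ds by (simp add: add_node_simps downward_system_def)
  show "isCont ?G x" if "x \<notin> insert q P" for x
  proof -
    have "isCont F x" using that ds by (simp add: downward_system_def)
    then show ?thesis unfolding add_node_def[abs_def] by (intro continuous_intros) (use that in auto)
  qed
  have "q \<notin> P" using q by auto
  then have Fq: "isCont F q" using ds by (simp add: downward_system_def)
  note lq = add_node_limits[OF Fq, of k J]
  fix p assume p: "p \<in> insert q P"
  have eq: "?G x = F x" if "x < q" for x using that by (rule add_node_simps)
  have "(?G \<longlongrightarrow> left_lim ?G p) (at_left p) \<and> (?G \<longlongrightarrow> right_lim ?G p) (at_right p) \<and> right_lim ?G p \<le> left_lim ?G p"
  proof (cases "p = q")
    case True
    then show ?thesis using lq left_lim_eqI[OF lq(1)] right_lim_eqI[OF lq(2)] J by simp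
  next
    case False
    then have pP: "p \<in> P" "p < q" using p q by auto
    then have F: "(F \<longlongrightarrow> left_lim F p) (at_left p)" "(F \<longlongrightarrow> right_lim F p) (at_right p)" "right_lim F p \<le> left_lim F p"
      using ds by (auto simp: downward_system_def)
    have "\<forall>\<^sub>F x in nhds p. x \<in> {..<q}" using pP by (intro eventually_nhds_in_open) auto
    then have "\<forall>\<^sub>F x in nhds p. F x = ?G x" by eventually_elim (simp add: eq)
    then have ev: "\<forall>\<^sub>F x in at_left p. F x = ?G x" "\<forall>\<^sub>F x in at_right p. F x = ?G x"
      by (auto simp: eventually_at_filter elim: eventually_mono)
    show ?thesis
      using Lim_transform_eventually[OF F(1) ev(1)] Lim_transform_eventually[OF F(2) ev(2)] F(3)
        lim_cong_below[of q ?G F, OF eq pP(2)] by simp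
  qed
  then show "(?G \<longlongrightarrow> left_lim ?G p) (at_left p)" "(?G \<longlongrightarrow> right_lim ?G p) (at_right p)" "right_lim ?G p \<le> left_lim ?G p"
    by auto
qed

lemma jump_at_cong_below:
  assumes "\<And>x. x < b \<Longrightarrow> F x = G x" "p < b"
  shows "jump_at F p \<longleftrightarrow> jump_at G p"
  unfolding jump_at_def using lim_cong_below[OF assms] by simp

lemma fold_at_cong_below:
  assumes eq: "\<And>x. x < b \<Longrightarrow> F x = G x" and p: "p < b"
  shows "fold_at F p \<longleftrightarrow> fold_at G p"
proof -
  have "\<forall>\<^sub>F x in nhds p. x \<in> {..<b}" using p by (intro eventually_nhds_in_open) auto
  then have ev: "\<forall>\<^sub>F x in nhds p. F x = G x" by eventually_elim (simp add: eq)
  have "isCont F p \<longleftrightarrow> isCont G p" by (rule isCont_cong[OF ev])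
  moreover have "(F has_real_derivative l) (at p within S) \<longleftrightarrow> (G has_real_derivative l) (at p within S)" for l S
    by (rule has_field_derivative_cong_eventually) (use ev eq p in \<open>auto simp: eventually_at_filter elim: eventually_mono\<close>)
  ultimately show ?thesis unfolding fold_at_def by simp
qed

lemma isCont_not_jump: "isCont F p \<Longrightarrow> \<not> jump_at F (p::real)"
  using left_lim_eqI[of F "F p" p] right_lim_eqI[of F "F p" p]
  by (simp add: jump_at_def isCont_def filterlim_at_split)

section \<open>The system with one more node\<close>

context outer_zone
begin

lemma P_pos: "P \<subseteq> {0<..}" using ds by (simp add: downward_system_def)

lemma isCont_outer: "p < x \<Longrightarrow> isCont F x"
  using ds P_le by (force simp: downward_system_def)

lemma jump_add_node:
  assumes q: "p < q"
  shows "jump_at (add_node F q k J) q \<longleftrightarrow> J \<noteq> 0"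
  using left_lim_eqI[OF add_node_limits(1)[OF isCont_outer[OF q]]] right_lim_eqI[OF add_node_limits(2)[OF isCont_outer[OF q]]]
  by (simp add: jump_at_def)

lemma fold_add_node:
  assumes q: "p < q" and k: "k \<noteq> 0"
  shows "fold_at (add_node F q k J) q \<longleftrightarrow> J = 0"
proof
  assume "fold_at (add_node F q k J) q"
  then have "\<not> jump_at (add_node F q k J) q" by (intro isCont_not_jump) (simp add: fold_at_def)
  then show "J = 0" using jump_add_node[OF q] by blast
next
  assume J: "J = 0"
  let ?G = "add_node F q k 0"
  have Gq: "?G q = F q" by (simp add: add_node_def)
  have "isCont ?G q"
    using add_node_limits[OF isCont_outer[OF q], of k 0] Gq by (simp add: isCont_def filterlim_at_split)
  moreover have "(?G has_real_derivative \<sigma>) (at q within {..q})"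
  proof (rule has_field_derivative_transform_within[of "\<lambda>x. c + \<sigma> * x" _ _ _ "q - p"])
    show "((\<lambda>x. c + \<sigma> * x) has_real_derivative \<sigma>) (at q within {..q})" by (auto intro!: derivative_eq_intros)
    show "c + \<sigma> * x = ?G x" if "x \<in> {..q}" "dist x q < q - p" for x
      using that F_outer[of x] Gq q by (cases "x = q") (auto simp: add_node_simps dist_real_def)
  qed (use q in auto)
  then have "(?G has_real_derivative \<sigma>) (at_left q)" by (rule has_field_derivative_subset) auto
  moreover have "(?G has_real_derivative \<sigma> + k) (at q within {q..})"
  proof (rule has_field_derivative_transform_within[of "\<lambda>x. c + \<sigma> * x + k * (x - q)" _ _ _ 1])
    show "((\<lambda>x. c + \<sigma> * x + k * (x - q)) has_real_derivative \<sigma> + k) (at q within {q..})" by (auto intro!: derivative_eq_intros)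
    show "c + \<sigma> * x + k * (x - q) = ?G x" if "x \<in> {q..}" for x
      using that F_outer[of x] Gq q by (cases "x = q") (auto simp: add_node_simps)
  qed auto
  then have "(?G has_real_derivative \<sigma> + k) (at_right q)" by (rule has_field_derivative_subset) auto
  ultimately show "fold_at (add_node F q k J) q" unfolding fold_at_def J using k by (intro conjI exI[of _ \<sigma>] exI[of _ "\<sigma> + k"]) simp_all
qed

text \<open>The new constant makes the zones match at q up to the drop J. Above the graph the
  threshold on the new line is \<open>F q\<close>; below the graph orbits must cross under the right
  limit \<open>F q - J\<close>, whence \<open>descent_mono\<close>. The gap between the two levels
  is the sliding segment.\<close>

lemma outer_zone_add_node:
  assumes \<theta>': "zone \<theta>'" "2 * cos \<theta>' = \<sigma> + k" and J: "J \<ge> 0"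
    and q: "p < q"
    and A': "descent F q (F q) A'" and B': "descent (\<lambda>x. - F x) q (- F q) B'"
  shows "outer_zone \<theta>' (add_node F q k J) (insert q P) q (c - k * q - J) (F q) A' B'"
proof -
  let ?G = "add_node F q k J"
  interpret n: zone \<theta>' by (rule \<theta>')
  have q0: "0 < q" using q p_nonneg by simp
  have Fq: "F q = c + \<sigma> * q" using F_outer q by simp
  have end_val: "(c - k * q - J) + 2 * cos \<theta>' * q = F q - J" unfolding \<theta>'(2) Fq by (simp add: algebra_simps)
  note lq = add_node_limits[OF isCont_outer[OF q], of k J]
  have mlq: "((\<lambda>x. - ?G x) \<longlongrightarrow> - F q) (at_left q)" "((\<lambda>x. - ?G x) \<longlongrightarrow> - (F q - J)) (at_right q)"
    using lq by (intro tendsto_minus; simp)+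
  show ?thesis
  proof (unfold_locales, goal_cases)
    case 1 show ?case using ds P_le q q0 J by (intro downward_system_add_node) auto
  next
    case 2 show ?case using P_le q by auto
  next
    case (3 x)
    then have "F x = c + \<sigma> * x" using F_outer q by simp
    then show ?case using 3 unfolding \<theta>'(2) by (simp add: add_node_simps algebra_simps)
  next
    case 4 show ?case by (rule descent_cong[OF _ A']) (simp add: add_node_simps)
  next
    case (5 y) then show ?case using J by (intro strictly_aboveI[OF lq(1) _ lq(2)]) auto
  next
    case 6
    have "descent (\<lambda>x. - ?G x) q (- F q) B'" by (rule descent_cong[OF _ B']) (simp add: add_node_simps)
    then show ?case by (rule descent_mono) (use end_val J in simp)
  next
    case (7 y)
    then have "- (F q - J) < y" using end_val by simp
    then show ?case using J by (intro strictly_aboveI[OF mlq(1) _ mlq(2)]) auto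
  qed
qed

text \<open>All requirements hold for every sufficiently large q; M serves to place the node beyond
  the cycles already found.\<close>

lemma far_abscissa:
  assumes s: "s = 1 \<or> s = (-1::real)" "s * (cos (pi / 3) / sin (pi / 3) + cos \<theta> / sin \<theta>) > 0"
  obtains q A' B' where "p < q" "M < q" "descent F q (F q) A'" "descent (\<lambda>x. - F x) q (- F q) B'"
    "s * (B' (- F q) - left_factor * A' (F q)) < 0"
proof -
  have "\<forall>\<^sub>F q in at_top. p < q \<and> M < q \<and> Y < height q \<and> - (c + \<sigma> * p) < depth q \<and> s * displacement q < 0"
    using height_depth_at_top displacement_sign[OF s] unfolding filterlim_at_top_dense
    by (intro eventually_conj) (auto intro: eventually_gt_at_top)
  then obtain q where q: "p < q" "M < q" "Y < height q" "- (c + \<sigma> * p) < depth q" "s * displacement q < 0"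
    using eventually_happens'[OF trivial_limit_at_top_linorder] by blast
  obtain A' B' where AB: "descent F q (F q) A'" "A' (F q) = upper q"
    "descent (\<lambda>x. - F x) q (- F q) B'" "B' (- F q) = lower q" by (rule descents_at[OF q(1,3,4)])
  show thesis by (rule that[OF q(1,2) AB(1,3)]) (use q(5) AB in \<open>simp add: displacement_def\<close>)
qed

end

text \<open>The orbit through \<open>(q, F q)\<close> does not see the new zone, so the displacement
  at q keeps the sign it had before the fold, while the sign at infinity has been reversed. A cycle
  that is not contained in x < q differs from all earlier ones.\<close>

lemma fold_step:
  assumes oz: "outer_zone \<theta> F P p c Y A B" and \<theta>': "zone \<theta>'" "cos \<theta>' \<noteq> cos \<theta>"
    and s: "s = 1 \<or> s = (-1::real)" "s * (cos (pi / 3) / sin (pi / 3) + cos \<theta> / sin \<theta>) > 0"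
      "- s * (cos (pi / 3) / sin (pi / 3) + cos \<theta>' / sin \<theta>') > 0"
  obtains q k c' Y' A' B' \<Gamma> where "p < q" "M < q" "k \<noteq> 0"
    "outer_zone \<theta>' (add_node F q k 0) (insert q P) q c' Y' A' B'"
    "crossing_limit_cycle (add_node F q k 0) (insert q P) \<Gamma>" "\<not> \<Gamma> \<subseteq> {w. fst w < q}"
proof -
  interpret old: outer_zone \<theta> F P p c Y A B by (rule oz)
  obtain q A' B' where q: "p < q" "M < q" "descent F q (F q) A'" "descent (\<lambda>x. - F x) q (- F q) B'"
    "s * (B' (- F q) - left_factor * A' (F q)) < 0" by (rule old.far_abscissa[OF s(1,2)])
  define k where "k = 2 * cos \<theta>' - 2 * cos \<theta>"
  have k: "k \<noteq> 0" using \<theta>'(2) by (simp add: k_def)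
  define c' where "c' = c - k * q"
  have nz: "outer_zone \<theta>' (add_node F q k 0) (insert q P) q c' (F q) A' B'"
    using old.outer_zone_add_node[OF \<theta>'(1) _ _ q(1,3,4), of k 0] by (simp add: k_def c'_def)
  interpret new: outer_zone \<theta>' "add_node F q k 0" "insert q P" q c' "F q" A' B' by (rule nz)
  have q0: "0 < q" using q(1) old.p_nonneg by simp
  have Fq: "c' + 2 * cos \<theta>' * q = F q" using old.F_outer[OF q(1)] by (simp add: c'_def k_def algebra_simps)
  have hq: "new.height q = F q" "new.depth q = - F q"
    using Fq q0 new.rise_start new.refl.rise_start by (simp_all add: new.height_def new.depth_def)
  have sq: "s * new.displacement q < 0" using q(5) by (simp add: new.displacement_def new.upper_def new.lower_def hq)
  have "\<forall>\<^sub>F \<xi> in at_top. - s * new.displacement \<xi> < 0 \<and> q < \<xi>"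
    using new.displacement_sign[of "- s"] s eventually_gt_at_top[of q] by (intro eventually_conj) auto
  then obtain \<xi> where \<xi>: "- s * new.displacement \<xi> < 0" "q < \<xi>" using eventually_happens'[OF trivial_limit_at_top_linorder] by blast
  have "(s * new.displacement q) * (- s * new.displacement \<xi>) > 0" using sq \<xi>(1) by (rule mult_neg_neg)
  then have "new.displacement q * new.displacement \<xi> < 0" using s(1) by auto
  then obtain \<Gamma> w where \<Gamma>: "crossing_limit_cycle (add_node F q k 0) (insert q P) \<Gamma>" "w \<in> \<Gamma>" "q < fst w"
    using new.crossing_limit_cycle_exists[OF q0 order_refl _ _ \<xi>(2)] hq by auto
  show thesis by (rule that[OF q(1,2) k nz \<Gamma>(1)]) (use \<Gamma> in force)
qed

text \<open>The jump is so high that the grazing orbit of the old system returns into the sliding segment,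
  which gives the sliding cycle; the orbit crossing just above the segment is pushed inwards and far
  away orbits outwards, which gives the crossing cycle.\<close>

lemma jump_step:
  assumes oz: "outer_zone \<theta> F P p c Y A B"
    and s: "cos (pi / 3) / sin (pi / 3) + cos \<theta> / sin \<theta> > 0"
  obtains q J c' Y' A' B' \<Gamma> \<Gamma>' where "p < q" "M < q" "J > 0"
    "outer_zone \<theta> (add_node F q 0 J) (insert q P) q c' Y' A' B'"
    "crossing_limit_cycle (add_node F q 0 J) (insert q P) \<Gamma>" "\<not> \<Gamma> \<subseteq> {w. fst w < q}"
    "periodic_orbit (add_node F q 0 J) \<Gamma>'" "has_sliding (add_node F q 0 J) (insert q P) \<Gamma>'" "\<not> \<Gamma>' \<subseteq> {w. fst w < q}"
proof -
  interpret old: outer_zone \<theta> F P p c Y A B by (rule oz)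
  obtain q A' B' where q: "p < q" "M < q" and A': "descent F q (F q) A'" and B': "descent (\<lambda>x. - F x) q (- F q) B'"
    and neg: "1 * (B' (- F q) - left_factor * A' (F q)) < 0" by (rule old.far_abscissa[of 1]) (use s in auto)
  have q0: "0 < q" using q(1) old.p_nonneg by simp
  \<comment> \<open>The orbit leaving \<open>(q, F q)\<close> arrives on the negative y-axis at
    \<open>- w\<close>; the v found next is minus the ordinate at which it returns to x = q.\<close>
  define w where "w = left_factor * A' (F q)"
  have "\<exists>v>- F q. B' v = w"
  proof -
    obtain K where K: "\<forall>y\<ge>- F q. y \<le> B' y \<and> B' y \<le> y + K" using descentD(5)[OF B'] ..
    define u where "u = max w (- F q)"
    have "w \<le> B' u" using K unfolding u_def by (meson max.cobounded1 max.cobounded2 order_trans)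
    moreover have "continuous_on {- F q..u} B'" using descentD(3)[OF B'] by (rule continuous_on_subset) auto
    moreover have "B' (- F q) < w" using neg by (simp add: w_def)
    moreover have "- F q \<le> u" unfolding u_def by simp
    ultimately obtain v where "- F q \<le> v" "v \<le> u" "B' v = w" using IVT'[of B' "- F q" w u] by auto
    moreover from this have "v \<noteq> - F q" using \<open>B' (- F q) < w\<close> by auto
    ultimately show ?thesis by (intro exI[of _ v]) simp
  qed
  then obtain v where v: "- F q < v" "B' v = w" by blast
  \<comment> \<open>The right limit at q becomes \<open>F q - J = - v - 1\<close>, one below the
    return point \<open>- v\<close>, which therefore lies inside the sliding segment.\<close>
  define J where "J = F q + v + 1"
  have J: "J > 0" using v by (simp add: J_def)
  define G where "G = add_node F q 0 J"
  define c' where "c' = c - J"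
  have nz: "outer_zone \<theta> G (insert q P) q c' (F q) A' B'"
    unfolding G_def c'_def using old.outer_zone_add_node[OF old.zone_axioms _ _ q(1) A' B', of 0 J] J by simp
  interpret new: outer_zone \<theta> G "insert q P" q c' "F q" A' B' by (rule nz)
  have Fq: "c' + 2 * cos \<theta> * q = F q - J" using old.F_outer[OF q(1)] by (simp add: c'_def)
  have hq: "new.height q = F q - J" using Fq q0 old.rise_start by (simp add: new.height_def)
  \<comment> \<open>The orbit through \<open>(\<xi>1, G \<xi>1)\<close> passes x = q exactly at the
    top of the sliding segment, the lowest height from which the descent is available.\<close>
  obtain \<xi>1 where \<xi>1: "q \<le> \<xi>1" "new.height \<xi>1 = F q"
  proof -
    have "\<forall>\<^sub>F u in at_top. q < u \<and> F q < new.height u"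
      using new.height_depth_at_top(1) unfolding filterlim_at_top_dense
      by (intro eventually_conj) (auto intro: eventually_gt_at_top)
    then obtain u where u: "q < u" "F q < new.height u"
      using eventually_happens'[OF trivial_limit_at_top_linorder] by blast
    have "continuous_on {q..u} new.height" unfolding new.height_def[abs_def]
      by (intro continuous_intros continuous_on_subset[OF old.continuous_on_rise[OF q0]]) auto
    then obtain x where "q \<le> x" "new.height x = F q" using IVT'[of new.height q "F q" u] u hq J by auto
    then show thesis by (rule that)
  qed
  have d1: "new.displacement \<xi>1 > 0"
  proof -
    \<comment> \<open>The same orbit came in at or below the bottom of the sliding segment, hence
      deeper than v, while its upper part left of q is that of the orbit from
      \<open>(q, F q)\<close>: it starts farther out than it returns.\<close>
    have "v < new.depth \<xi>1" using new.depth_ge[OF q0 \<xi>1(1)] Fq by (simp add: J_def)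
    then have "B' v < B' (new.depth \<xi>1)" using v by (intro strict_mono_onD[OF descentD(2)[OF B']]) auto
    then show ?thesis using v by (simp add: new.displacement_def new.upper_def new.lower_def \<xi>1(2) w_def)
  qed
  have "\<forall>\<^sub>F \<xi> in at_top. 1 * new.displacement \<xi> < 0 \<and> \<xi>1 < \<xi>"
    using new.displacement_sign[of 1] s eventually_gt_at_top[of \<xi>1] by (intro eventually_conj) auto
  then obtain \<xi>2 where \<xi>2: "new.displacement \<xi>2 < 0" "\<xi>1 < \<xi>2" 
    using eventually_happens'[OF trivial_limit_at_top_linorder] by fastforce
  obtain \<Gamma> z where \<Gamma>: "crossing_limit_cycle G (insert q P) \<Gamma>" "z \<in> \<Gamma>" "q < fst z"
    using new.crossing_limit_cycle_exists[OF q0 \<xi>1(1) _ _ \<xi>2(2)] \<xi>1(2) mult_pos_neg[OF d1 \<xi>2(1)] by auto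
  have dA: "descent G q (F q) A'" by (rule new.dA)
  have dB: "descent (\<lambda>x. - G x) q (- F q) B'" unfolding G_def by (rule descent_cong[OF _ B']) (simp add: add_node_simps)
  obtain V where V: "ode_arc G q (q, F q) (0, A' (F q)) V" by (rule descent_arc[OF dA order_refl])
  obtain W where W: "ode_arc (\<lambda>x. - G x) q (q, v) (0, B' v) W"
    by (rule descent_arc[OF dB less_imp_le[OF v(1)]]) (rule that; assumption)
  have W': "ode_arc G q (0, - w) (q, - v) (reflect ` W)" using ode_arc_reflect[OF W] v(2) by (simp add: reflect_def)
  have A'_pos: "A' (F q) > 0" using descent_pos[OF dA q0 new.isCont_0 new.F_0 order_refl] .
  have "G x = x" if "x < 0" for x using new.ds that by (simp add: downward_system_def)
  then obtain U where U: "ode_arc G 0 (0, A' (F q)) (0, - w) U" using left_arc[of G "A' (F q)"] A'_pos unfolding w_def by auto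
  note lq = add_node_limits[OF old.isCont_outer[OF q(1)], of 0 J, folded G_def]
  define \<Sigma> where "\<Sigma> = {q} \<times> {- v..F q}"
  have \<Sigma>: "filippov_arc G (q, - v) (q, F q) \<Sigma>"
    unfolding \<Sigma>_def using sliding_arc[OF q0 lq] v(1) by (simp add: J_def)
  \<comment> \<open>From the top of the segment over the upper arc, through the left half plane and
    the lower arc, and back up along the segment.\<close>
  define \<Gamma>' where "\<Gamma>' = ((V \<union> U) \<union> reflect ` W) \<union> \<Sigma>"
  have "filippov_arc G (q, F q) (q, F q) \<Gamma>'" unfolding \<Gamma>'_def
    by (intro arc_of_trans[OF arc_of_trans[OF arc_of_trans[OF ode_arc_filippov_arc[OF V] ode_arc_filippov_arc[OF U]]
        ode_arc_filippov_arc[OF W']] \<Sigma>])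
  moreover have "(q, - v) \<in> \<Gamma>'" using v(1) by (simp add: \<Gamma>'_def \<Sigma>_def)
  ultimately have per: "periodic_orbit G \<Gamma>'" using v(1) by (intro closed_arc_periodic_orbit[of G "(q, F q)" \<Gamma>' "(q, - v)"]) auto
  have "{q} \<times> {- v<..<F q} \<subseteq> \<Gamma>' \<inter> sliding_set G (insert q P)"
    using v(1) left_lim_eqI[OF lq(1)] right_lim_eqI[OF lq(2)] by (auto simp: \<Gamma>'_def \<Sigma>_def sliding_set_def J_def)
  moreover have "- v < F q" using v(1) by simp
  ultimately have "{q} \<times> {- v<..<F q} \<subseteq> sliding_part G (insert q P) \<Gamma>'"
    unfolding sliding_part_def by (intro Union_upper CollectI exI[of _ q] exI[of _ "- v"] exI[of _ "F q"] conjI refl)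
  then have sl: "has_sliding G (insert q P) \<Gamma>'" using \<open>- v < F q\<close> unfolding has_sliding_def by auto
  have out: "\<not> \<Gamma> \<subseteq> {w. fst w < q}" "\<not> \<Gamma>' \<subseteq> {w. fst w < q}" using \<Gamma> \<open>(q, - v) \<in> \<Gamma>'\<close> by force+
  show thesis by (rule that[OF q J nz[unfolded G_def] \<Gamma>(1)[unfolded G_def] out(1) per[unfolded G_def] sl[unfolded G_def] out(2)])
qed

section \<open>Construction of the system\<close>

lemma pwl_add_node:
  assumes "F = pwl_function n a b A B X"
  shows "add_node F q k J = pwl_function (Suc n) (a + k / 2) (b - k / 2 * q - J / 2)
    (A(Suc n := k / 2)) (B(Suc n := - J / 2)) (X(Suc n := q))"
proof
  fix x
  have "(\<Sum>i=1..n. (A(Suc n := k / 2)) i * \<bar>x - (X(Suc n := q)) i\<bar>) = (\<Sum>i=1..n. A i * \<bar>x - X i\<bar>)"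
    "(\<Sum>i=1..n. (B(Suc n := - J / 2)) i * sgn (x - (X(Suc n := q)) i)) = (\<Sum>i=1..n. B i * sgn (x - X i))"
    by (rule sum.cong; simp)+
  then show "add_node F q k J x = pwl_function (Suc n) (a + k / 2) (b - k / 2 * q - J / 2)
    (A(Suc n := k / 2)) (B(Suc n := - J / 2)) (X(Suc n := q)) x"
    unfolding assms add_node_def pwl_function_def by (simp add: algebra_simps)
qed

text \<open>\<open>s = 1\<close> if far away orbits spiral outwards, \<open>s = - 1\<close> if they spiral inwards.\<close>

definition slope_angle :: "real \<Rightarrow> real" where
  "slope_angle s = (if s = 1 then pi / 3 else 3 * pi / 4)"

lemma slope_angle_zone: "zone (slope_angle s)"
  unfolding slope_angle_def by unfold_locales (use pi_gt_zero in auto)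

text \<open>cot(pi/3) = 1/sqrt 3 while cot(3 pi/4) = -1, so the two choices give sums of opposite
  sign.\<close>

lemma slope_angle_sign:
  assumes "s = 1 \<or> s = (-1::real)"
  shows "s * (cos (pi / 3) / sin (pi / 3) + cos (slope_angle s) / sin (slope_angle s)) > 0"
proof -
  have e: "3 * pi / 4 = pi - pi / 4" by simp
  have "cos (3 * pi / 4) / sin (3 * pi / 4) = - 1"
    unfolding e cos_pi_minus sin_pi_minus cos_45 sin_45 by simp
  moreover have "1 < sqrt 3" by simp
  then have "1 / sqrt 3 < 1" by (simp add: divide_less_eq)
  ultimately show ?thesis using assms by (auto simp: slope_angle_def cos_60 sin_60)
qed

text \<open>The induction invariant. The sign s fixes the slope of the last zone and thereby which
  step may follow; for sliding orbits only existence is recorded, because their isolation is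
  automatic in the final system.\<close>

definition construction :: "nat \<Rightarrow> nat \<Rightarrow> real \<Rightarrow> (real \<Rightarrow> real) \<Rightarrow> (nat \<Rightarrow> real) \<Rightarrow> bool" where
  "construction n m s F X \<longleftrightarrow>
     (\<exists>p c Y A B. outer_zone (slope_angle s) F (X ` {1..n}) p c Y A B) \<and>
     (\<exists>a b A B. F = pwl_function n a b A B X \<and> (\<forall>i\<in>{1..n}. (A i)\<^sup>2 + (B i)\<^sup>2 \<noteq> 0)) \<and>
     strict_mono_on {1..n} X \<and> m \<le> n \<and>
     card {i\<in>{1..n}. jump_at F (X i)} = m \<and> card {i\<in>{1..n}. fold_at F (X i)} = n - m \<and>
     (\<exists>C D. finite C \<and> finite D \<and> n \<le> card C \<and> m \<le> card D \<and>
        (\<forall>\<Gamma>\<in>C. crossing_limit_cycle F (X ` {1..n}) \<Gamma>) \<and>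
        (\<forall>\<Gamma>\<in>D. periodic_orbit F \<Gamma> \<and> has_sliding F (X ` {1..n}) \<Gamma>))"

text \<open>The linear system with slope 1 is an unstable focus without nodes, so s = 1, the sign
  that the jump step asks for.\<close>

lemma construction_0: "construction 0 0 1 (\<lambda>x. x) X"
proof -
  interpret zone "pi / 3" by (rule zone_60)
  have "outer_zone (pi / 3) (\<lambda>x. x) {} 0 0 0 (\<lambda>y. y) (\<lambda>y. y)"
  proof (unfold_locales, goal_cases)
    case 1 show ?case by (auto simp: downward_system_def one_sided_lipschitz_def intro!: exI[of _ 1])
  next
    case 3 show ?case by (simp add: cos_60)
  next
    case 4 show ?case by (rule descent_id) simp_all
  next
    case (5 y) then show ?case by (intro strictly_above_isCont) simp_all
  next
    case 6
    have "descent (\<lambda>x::real. - x) 0 0 (\<lambda>y. y)" by (rule descent_id) simp_all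
    then show ?case by simp
  next
    case (7 y) then show ?case by (intro strictly_above_isCont) simp_all
  qed simp_all
  then have oz: "outer_zone (slope_angle 1) (\<lambda>x. x) (X ` {1..0}) 0 0 0 (\<lambda>y. y) (\<lambda>y. y)"
    by (simp add: slope_angle_def)
  have pwl: "(\<lambda>x. x) = pwl_function 0 1 0 (\<lambda>_. 0) (\<lambda>_. 0) X" by (simp add: pwl_function_def fun_eq_iff)
  show ?thesis unfolding construction_def
  proof (intro conjI)
    show "\<exists>p c Y A B. outer_zone (slope_angle 1) (\<lambda>x. x) (X ` {1..0}) p c Y A B" using oz by blast
    show "\<exists>a b A B. (\<lambda>x. x) = pwl_function 0 a b A B X \<and> (\<forall>i\<in>{1..0}. (A i)\<^sup>2 + (B i)\<^sup>2 \<noteq> 0)"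
      by (intro exI conjI, rule pwl) simp
    show "strict_mono_on {1..0} X" by (simp add: strict_mono_on_def)
  qed (auto intro!: exI[of _ "{}"])
qed

text \<open>Common bookkeeping of both steps, with j = 1 for a jump and j = 0 for a fold. The orbits
  already found lie in x < q, where F is unchanged; the new ones do not, so they are different from
  them.\<close>

lemma construction_extend:
  assumes old: "construction n m s F X" and oz: "outer_zone (slope_angle s) F (X ` {1..n}) p c Y A B" and q: "p < q"
    and C: "finite C" "n \<le> card C" "\<And>\<Gamma>. \<Gamma> \<in> C \<Longrightarrow> crossing_limit_cycle F (X ` {1..n}) \<Gamma> \<and> \<Gamma> \<subseteq> {w. fst w < q}"
    and D: "finite D" "m \<le> card D" "\<And>\<Gamma>. \<Gamma> \<in> D \<Longrightarrow> periodic_orbit F \<Gamma> \<and> has_sliding F (X ` {1..n}) \<Gamma> \<and> \<Gamma> \<subseteq> {w. fst w < q}"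
    and node: "j = 0 \<and> J = 0 \<and> k \<noteq> 0 \<or> j = 1 \<and> J \<noteq> 0 \<and> k = 0"
    and new: "outer_zone (slope_angle s') (add_node F q k J) (insert q (X ` {1..n})) q c' Y' A' B'"
    and \<Gamma>: "crossing_limit_cycle (add_node F q k J) (insert q (X ` {1..n})) \<Gamma>" "\<not> \<Gamma> \<subseteq> {w. fst w < q}"
    and \<Gamma>': "j = 1 \<Longrightarrow> periodic_orbit (add_node F q k J) \<Gamma>' \<and>
      has_sliding (add_node F q k J) (insert q (X ` {1..n})) \<Gamma>' \<and> \<not> \<Gamma>' \<subseteq> {w. fst w < q}"
  shows "construction (Suc n) (m + j) s' (add_node F q k J) (X(Suc n := q))"
proof -
  interpret o: outer_zone "slope_angle s" F "X ` {1..n}" p c Y A B by (rule oz)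
  let ?G = "add_node F q k J" and ?X = "X(Suc n := q)" and ?P = "X ` {1..n}"
  have eq: "F x = ?G x" if "x < q" for x using that by (simp add: add_node_simps)
  have Xq: "X i < q" if "i \<in> {1..n}" for i using o.P_le q that by force
  have img: "?X ` {1..Suc n} = insert q ?P"
  proof -
    have "{1..Suc n} = insert (Suc n) {1..n}" by auto
    moreover have "?X ` {1..n} = ?P" by (rule image_cong) auto
    ultimately show ?thesis by (simp only: image_insert fun_upd_same)
  qed
  have P: "?P \<subseteq> {..<q}" using Xq by auto
  have mn: "m \<le> n" and jc: "card {i\<in>{1..n}. jump_at F (X i)} = m" and fc: "card {i\<in>{1..n}. fold_at F (X i)} = n - m"
    and mono: "strict_mono_on {1..n} X"
    using old by (simp_all add: construction_def)
  obtain a b A B where pwl: "F = pwl_function n a b A B X" "\<forall>i\<in>{1..n}. (A i)\<^sup>2 + (B i)\<^sup>2 \<noteq> 0"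
    using old unfolding construction_def by (elim conjE exE) (rule that)
  have jq: "jump_at ?G q \<longleftrightarrow> j = 1" using o.jump_add_node[OF q, of k J] node by auto
  have fq: "fold_at ?G q \<longleftrightarrow> j = 0"
  proof (cases "j = 0")
    case True
    then show ?thesis using o.fold_add_node[OF q, of k J] node by auto
  next
    case False
    then have "jump_at ?G q" using jq node by simp
    then show ?thesis using False isCont_not_jump[where F = ?G and p = q] by (auto simp: fold_at_def)
  qed
  have range: "{i\<in>{1..Suc n}. R (?X i)} = (if R q then insert (Suc n) {i\<in>{1..n}. R (X i)} else {i\<in>{1..n}. R (X i)})" for R
    by (auto simp: le_Suc_eq)
  have jset: "{i\<in>{1..n}. jump_at ?G (X i)} = {i\<in>{1..n}. jump_at F (X i)}"
    using jump_at_cong_below[OF eq Xq] by auto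
  have fset: "{i\<in>{1..n}. fold_at ?G (X i)} = {i\<in>{1..n}. fold_at F (X i)}"
    using fold_at_cong_below[OF eq Xq] by auto
  have j01: "j = 0 \<or> j = 1" using node by auto
  have jc': "card {i\<in>{1..Suc n}. jump_at ?G (?X i)} = m + j"
    unfolding range jset using jq jc j01 by auto
  have fc': "card {i\<in>{1..Suc n}. fold_at ?G (?X i)} = Suc n - (m + j)"
    unfolding range fset using fq fc j01 mn by auto
  have mono': "strict_mono_on {1..Suc n} ?X"
  proof (rule strict_mono_onI)
    fix r t assume *: "r \<in> {1..Suc n}" "t \<in> {1..Suc n}" "r < t"
    then have "r \<in> {1..n}" by auto
    then show "?X r < ?X t" using * Xq[of r] strict_mono_onD[OF mono, of r t] by (cases "t = Suc n") auto
  qed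
  have pwl': "\<exists>a b A B. ?G = pwl_function (Suc n) a b A B ?X \<and> (\<forall>i\<in>{1..Suc n}. (A i)\<^sup>2 + (B i)\<^sup>2 \<noteq> 0)"
    by (rule exI, rule exI, rule exI, rule exI, rule conjI, rule pwl_add_node[OF pwl(1)])
      (use pwl(2) node in \<open>auto simp: le_Suc_eq power2_eq_square\<close>)
  have newC: "\<Gamma> \<notin> C" using C(3) \<Gamma>(2) by blast
  define D' where "D' = (if j = 1 then insert \<Gamma>' D else D)"
  have "\<Gamma>' \<notin> D" if "j = 1" using D(3) \<Gamma>' that by blast
  then have D': "finite D'" "m + j \<le> card D'" using D(1,2) j01 by (auto simp: D'_def)
  have C': "finite (insert \<Gamma> C)" "Suc n \<le> card (insert \<Gamma> C)" using C newC by simp_all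
  have cc: "crossing_limit_cycle ?G (?X ` {1..Suc n}) \<Delta>" if "\<Delta> \<in> insert \<Gamma> C" for \<Delta>
  proof (cases "\<Delta> = \<Gamma>")
    case False
    then have *: "crossing_limit_cycle F (X ` {1..n}) \<Delta>" "\<Delta> \<subseteq> {w. fst w < q}" using C(3)[of \<Delta>] that by auto
    show ?thesis unfolding img by (rule crossing_limit_cycle_extend[of q F ?G, OF _ *(2) P *(1)]) (rule eq)
  qed (simp only: img \<Gamma>(1))
  have dd: "periodic_orbit ?G \<Delta> \<and> has_sliding ?G (?X ` {1..Suc n}) \<Delta>" if "\<Delta> \<in> D'" for \<Delta>
  proof (cases "\<Delta> \<in> D")
    case True
    note * = D(3)[OF True]
    have "periodic_orbit ?G \<Delta>" by (rule periodic_orbit_cong_below[of q F ?G]) (use eq * in auto)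
    moreover have "has_sliding ?G (insert q ?P) \<Delta>" by (rule has_sliding_extend[of q F ?G, OF _ P]) (use eq * in auto)
    ultimately show ?thesis unfolding img by blast
  next
    case False
    then have "j = 1" "\<Delta> = \<Gamma>'" using that by (auto simp: D'_def split: if_splits)
    then show ?thesis unfolding img using \<Gamma>' by blast
  qed
  show ?thesis unfolding construction_def
  proof (intro conjI pwl' mono' jc' fc')
    show "\<exists>p c Y A B. outer_zone (slope_angle s') ?G (?X ` {1..Suc n}) p c Y A B" unfolding img using new by blast
    show "m + j \<le> Suc n" using mn j01 by auto
    show "\<exists>C D. finite C \<and> finite D \<and> Suc n \<le> card C \<and> m + j \<le> card D \<and>
        (\<forall>\<Gamma>\<in>C. crossing_limit_cycle ?G (?X ` {1..Suc n}) \<Gamma>) \<and>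
        (\<forall>\<Gamma>\<in>D. periodic_orbit ?G \<Gamma> \<and> has_sliding ?G (?X ` {1..Suc n}) \<Gamma>)"
      by (intro exI[of _ "insert \<Gamma> C"] exI[of _ D'] conjI C' D' ballI cc dd)
  qed
qed

text \<open>Finitely many compact orbits have bounded abscissae, so a far node can be placed to the
  right of all of them.\<close>

lemma construction_cycles:
  assumes "construction n m s F X"
  obtains C D M where "finite C" "n \<le> card C" "finite D" "m \<le> card D"
    "\<And>\<Gamma>. \<Gamma> \<in> C \<Longrightarrow> crossing_limit_cycle F (X ` {1..n}) \<Gamma>"
    "\<And>\<Gamma>. \<Gamma> \<in> D \<Longrightarrow> periodic_orbit F \<Gamma> \<and> has_sliding F (X ` {1..n}) \<Gamma>"
    "\<And>\<Gamma>. \<Gamma> \<in> C \<union> D \<Longrightarrow> \<Gamma> \<subseteq> {w. fst w \<le> M}"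
proof -
  obtain C D where CD: "finite C" "finite D" "n \<le> card C" "m \<le> card D"
    "\<forall>\<Gamma>\<in>C. crossing_limit_cycle F (X ` {1..n}) \<Gamma>"
    "\<forall>\<Gamma>\<in>D. periodic_orbit F \<Gamma> \<and> has_sliding F (X ` {1..n}) \<Gamma>"
    using assms unfolding construction_def by (elim conjE exE) (rule that)
  have "compact \<Gamma>" if "\<Gamma> \<in> C \<union> D" for \<Gamma>
    using that CD(5,6) periodic_orbit_compact[of F \<Gamma>] by (auto simp: crossing_limit_cycle_def)
  then have "compact (\<Union>(C \<union> D))" using CD(1,2) by (intro compact_Union) auto
  then have "bounded (\<Union>(C \<union> D))" by (rule compact_imp_bounded)
  then obtain M where M: "\<forall>w\<in>\<Union>(C \<union> D). norm w \<le> M" unfolding bounded_iff by blast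
  have 1: "crossing_limit_cycle F (X ` {1..n}) \<Gamma>" if "\<Gamma> \<in> C" for \<Gamma> using CD(5) that by (rule bspec)
  have 2: "periodic_orbit F \<Gamma> \<and> has_sliding F (X ` {1..n}) \<Gamma>" if "\<Gamma> \<in> D" for \<Gamma> using CD(6) that by (rule bspec)
  show thesis
  proof (rule that[OF CD(1,3,2,4) 1 2])
    fix \<Gamma> assume \<Gamma>: "\<Gamma> \<in> C \<union> D"
    show "\<Gamma> \<subseteq> {w. fst w \<le> M}"
    proof
      fix w assume "w \<in> \<Gamma>"
      then have "norm w \<le> M" using M \<Gamma> by blast
      moreover have "fst w \<le> norm w" using norm_fst_le[of "fst w" "snd w"] by simp
      ultimately show "w \<in> {w. fst w \<le> M}" by simp
    qed
  qed
qed

text \<open>A jump keeps the slope, so the sign s = 1 is available again for the next jump.\<close>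

lemma construction_jump:
  assumes "construction n m 1 F X"
  shows "\<exists>G Z. construction (Suc n) (Suc m) 1 G Z"
proof -
  obtain p c Y A B where oz: "outer_zone (slope_angle 1) F (X ` {1..n}) p c Y A B"
    using assms unfolding construction_def by (elim conjE exE) (rule that)
  obtain C D M where CD: "finite C" "n \<le> card C" "finite D" "m \<le> card D"
    "\<And>\<Gamma>. \<Gamma> \<in> C \<Longrightarrow> crossing_limit_cycle F (X ` {1..n}) \<Gamma>"
    "\<And>\<Gamma>. \<Gamma> \<in> D \<Longrightarrow> periodic_orbit F \<Gamma> \<and> has_sliding F (X ` {1..n}) \<Gamma>"
    "\<And>\<Gamma>. \<Gamma> \<in> C \<union> D \<Longrightarrow> \<Gamma> \<subseteq> {w. fst w \<le> M}" by (rule construction_cycles[OF assms]) (rule that; assumption)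
  have s: "cos (pi / 3) / sin (pi / 3) + cos (slope_angle 1) / sin (slope_angle 1) > 0"
    using slope_angle_sign[of 1] by simp
  obtain q J c' Y' A' B' \<Gamma> \<Gamma>' where new: "p < q" "M < q" "J > 0"
    "outer_zone (slope_angle 1) (add_node F q 0 J) (insert q (X ` {1..n})) q c' Y' A' B'"
    "crossing_limit_cycle (add_node F q 0 J) (insert q (X ` {1..n})) \<Gamma>" "\<not> \<Gamma> \<subseteq> {w. fst w < q}"
    "periodic_orbit (add_node F q 0 J) \<Gamma>'" "has_sliding (add_node F q 0 J) (insert q (X ` {1..n})) \<Gamma>'" "\<not> \<Gamma>' \<subseteq> {w. fst w < q}"
    by (rule jump_step[OF oz s]) (rule that; assumption)
  have "\<Delta> \<subseteq> {w. fst w < q}" if "\<Delta> \<in> C \<union> D" for \<Delta> using CD(7)[OF that] new(2) by force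
  then have b: "\<Delta> \<subseteq> {w. fst w < q}" if "\<Delta> \<in> C \<or> \<Delta> \<in> D" for \<Delta> using that by blast
  have "construction (Suc n) (m + 1) 1 (add_node F q 0 J) (X(Suc n := q))"
  proof (rule construction_extend[OF assms oz new(1) CD(1,2) _ CD(3,4) _ _ new(4,5,6), where \<Gamma>' = \<Gamma>'])
    show "crossing_limit_cycle F (X ` {1..n}) \<Delta> \<and> \<Delta> \<subseteq> {w. fst w < q}" if "\<Delta> \<in> C" for \<Delta>
      using CD(5)[OF that] b[of \<Delta>] that by simp
    show "periodic_orbit F \<Delta> \<and> has_sliding F (X ` {1..n}) \<Delta> \<and> \<Delta> \<subseteq> {w. fst w < q}" if "\<Delta> \<in> D" for \<Delta>
      using CD(6)[OF that] b[of \<Delta>] that by simp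
  qed (use new in simp_all)
  then show ?thesis by auto
qed

text \<open>A fold exchanges the two slope angles, which is the reversal at infinity that
  \<open>fold_step\<close> asks for; folds can thus be repeated from either sign.\<close>

lemma construction_fold:
  assumes "construction n m s F X" and s: "s = 1 \<or> s = (-1::real)"
  shows "\<exists>G Z. construction (Suc n) m (- s) G Z"
proof -
  obtain p c Y A B where oz: "outer_zone (slope_angle s) F (X ` {1..n}) p c Y A B"
    using assms unfolding construction_def by (elim conjE exE) (rule that)
  obtain C D M where CD: "finite C" "n \<le> card C" "finite D" "m \<le> card D"
    "\<And>\<Gamma>. \<Gamma> \<in> C \<Longrightarrow> crossing_limit_cycle F (X ` {1..n}) \<Gamma>"
    "\<And>\<Gamma>. \<Gamma> \<in> D \<Longrightarrow> periodic_orbit F \<Gamma> \<and> has_sliding F (X ` {1..n}) \<Gamma>"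
    "\<And>\<Gamma>. \<Gamma> \<in> C \<union> D \<Longrightarrow> \<Gamma> \<subseteq> {w. fst w \<le> M}" by (rule construction_cycles[OF assms(1)]) (rule that; assumption)
  have "cos (pi / 3) \<noteq> cos (3 * pi / 4)"
    using cos_monotone_0_pi[of "pi / 3" "3 * pi / 4"] pi_gt_zero by simp
  then have ne: "cos (slope_angle (- s)) \<noteq> cos (slope_angle s)" using s by (auto simp: slope_angle_def)
  have sg: "- s * (cos (pi / 3) / sin (pi / 3) + cos (slope_angle (- s)) / sin (slope_angle (- s))) > 0"
    using slope_angle_sign[of "- s"] s by auto
  obtain q k c' Y' A' B' \<Gamma> where new: "p < q" "M < q" "k \<noteq> 0"
    "outer_zone (slope_angle (- s)) (add_node F q k 0) (insert q (X ` {1..n})) q c' Y' A' B'"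
    "crossing_limit_cycle (add_node F q k 0) (insert q (X ` {1..n})) \<Gamma>" "\<not> \<Gamma> \<subseteq> {w. fst w < q}"
    by (rule fold_step[OF oz slope_angle_zone ne s slope_angle_sign[OF s] sg]) (rule that; assumption)
  have "\<Delta> \<subseteq> {w. fst w < q}" if "\<Delta> \<in> C \<union> D" for \<Delta> using CD(7)[OF that] new(2) by force
  then have b: "\<Delta> \<subseteq> {w. fst w < q}" if "\<Delta> \<in> C \<or> \<Delta> \<in> D" for \<Delta> using that by blast
  have "construction (Suc n) (m + 0) (- s) (add_node F q k 0) (X(Suc n := q))"
  \<comment> \<open>A fold brings no sliding orbit, so \<Gamma>' gets a dummy value.\<close>
  proof (rule construction_extend[OF assms(1) oz new(1) CD(1,2) _ CD(3,4) _ _ new(4,5,6), where \<Gamma>' = undefined])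
    show "crossing_limit_cycle F (X ` {1..n}) \<Delta> \<and> \<Delta> \<subseteq> {w. fst w < q}" if "\<Delta> \<in> C" for \<Delta>
      using CD(5)[OF that] b[of \<Delta>] that by simp
    show "periodic_orbit F \<Delta> \<and> has_sliding F (X ` {1..n}) \<Delta> \<and> \<Delta> \<subseteq> {w. fst w < q}" if "\<Delta> \<in> D" for \<Delta>
      using CD(6)[OF that] b[of \<Delta>] that by simp
  qed (use new in simp_all)
  then show ?thesis by auto
qed

lemma construction_jumps: "\<exists>F X. construction m m 1 F X"
proof (induction m)
  case 0 show ?case using construction_0 by blast
next
  case (Suc m) then show ?case using construction_jump by blast
qed

lemma construction_exists: "\<exists>s F X. (s = 1 \<or> s = -1) \<and> construction (m + l) m s F X"
proof (induction l)
  case 0 show ?case using construction_jumps[of m] by auto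
next
  case (Suc l)
  then obtain s F X where s: "s = 1 \<or> s = -1" "construction (m + l) m s F X" by blast
  then obtain G Z where "construction (m + Suc l) m (- s) G Z" using construction_fold[OF s(2,1)] by auto
  moreover have "- s = 1 \<or> - s = -1" using s(1) by auto
  ultimately show ?case by blast
qed

theorem theorem4:
  fixes m n :: nat
  assumes "m \<le> n"
  shows "\<exists>F X. is_pwl F n X \<and>
           card {i\<in>{1..n}. jump_at F (X i)} = m \<and>
           card {i\<in>{1..n}. fold_at F (X i)} = n - m \<and>
           (\<exists>C. finite C \<and> card C \<ge> n + m \<and> (\<forall>\<Gamma>\<in>C. limit_cycle F (X ` {1..n}) \<Gamma>))"
proof -
  obtain s F X where con: "construction n m s F X" using construction_exists[of m "n - m"] assms by auto
  obtain p c Y A B where oz: "outer_zone (slope_angle s) F (X ` {1..n}) p c Y A B"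
    using con unfolding construction_def by (elim conjE exE) (rule that)
  interpret outer_zone "slope_angle s" F "X ` {1..n}" p c Y A B by (rule oz)
  obtain a b A B where pwl: "F = pwl_function n a b A B X" "\<forall>i\<in>{1..n}. (A i)\<^sup>2 + (B i)\<^sup>2 \<noteq> 0"
    using con unfolding construction_def by (elim conjE exE) (rule that)
  have "X i \<noteq> 0" if "i \<in> {1..n}" for i using P_pos that by force
  then have "\<forall>i\<in>{1..n}. ((A i)\<^sup>2 + (B i)\<^sup>2) * X i \<noteq> 0" using pwl(2) by simp
  then have "is_pwl F n X" using pwl(1) con unfolding is_pwl_def construction_def by blast
  moreover have "card {i\<in>{1..n}. jump_at F (X i)} = m" "card {i\<in>{1..n}. fold_at F (X i)} = n - m"
    using con by (simp_all add: construction_def)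
  moreover have "\<exists>C. finite C \<and> card C \<ge> n + m \<and> (\<forall>\<Gamma>\<in>C. limit_cycle F (X ` {1..n}) \<Gamma>)"
  proof -
    obtain C D M where CD: "finite C" "n \<le> card C" "finite D" "m \<le> card D"
      "\<And>\<Gamma>. \<Gamma> \<in> C \<Longrightarrow> crossing_limit_cycle F (X ` {1..n}) \<Gamma>"
      "\<And>\<Gamma>. \<Gamma> \<in> D \<Longrightarrow> periodic_orbit F \<Gamma> \<and> has_sliding F (X ` {1..n}) \<Gamma>"
      "\<And>\<Gamma>. \<Gamma> \<in> C \<union> D \<Longrightarrow> \<Gamma> \<subseteq> {w. fst w \<le> M}" by (rule construction_cycles[OF con]) (rule that; assumption)
    have "\<Gamma> \<notin> D" if "\<Gamma> \<in> C" for \<Gamma>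
      using crossing_limit_cycle_not_sliding[OF CD(5)[OF that]] CD(6)[of \<Gamma>] by metis
    then have "C \<inter> D = {}" by blast
    then have "n + m \<le> card (C \<union> D)" using CD(1-4) by (simp add: card_Un_disjoint)
    moreover have "limit_cycle F (X ` {1..n}) \<Gamma>" if "\<Gamma> \<in> C \<union> D" for \<Gamma>
    proof (cases "\<Gamma> \<in> C")
      case True
      then show ?thesis using CD(5)[OF True] by (simp add: limit_cycle_def)
    next
      case False
      then have "\<Gamma> \<in> D" using that by simp
      then show ?thesis using sliding_periodic_orbit_limit_cycle[OF ds] CD(6)[of \<Gamma>] by (simp add: limit_cycle_def)
    qed
    ultimately show ?thesis using CD(1,3) by (intro exI[of _ "C \<union> D"]) simp
  qed
  ultimately show ?thesis by blast
qed

end
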